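(* Let $d\ge 1$, $T>0$, and let $\boldsymbol Z(t)=(Z_1(t),\ldots,Z_d(t))^\top$, $t\ge 0$, be such that $Z_1,\ldots,Z_d$ are mutually independent centered Gaussian processes with a.s. continuous sample paths and stationary increments, with variance functions $v_i(t)=\mathrm{Var}(Z_i(t))$. Assume that for each $i\in\{1,\ldots,d\}$: (B0) $v_i\in C^1([0,T])$, $v_i$ is strictly increasing on $[0,T]$ and $v_i(0)=0$; (BI) $\dot v_i(T)>0$; (BII) $v_i(t)=o(t)$ as $t\to 0$. Let $A$ be a non-singular real $d\times d$ matrix, $\boldsymbol X(t)=A\boldsymbol Z(t)$, $\boldsymbol a\in\mathbb R^d\setminus(-\infty,0]^d$ and $\boldsymbol c\in\mathbb R^d$. Then $$\mathbb P\{\exists\, t\in[0,T]:\ \boldsymbol X(t)-\boldsymbol c t>u\boldsymbol a\}\ \sim\ \mathcal C\cdot \mathbb P\{\boldsymbol X(T)-\boldsymbol c T>u\boldsymbol a\},\qquad u\to\infty,$$ where $$\mathcal C=\frac{\sum_{i=1}^d\max\big(\lambda_i\,(AQA^{-1}\tilde{\boldsymbol a})_i,\,0\big)}{\sum_{i=1}^d\lambda_i\,(AQA^{-1}\tilde{\boldsymbol a})_i},\qquad Q=\mathrm{diag}\big(\dot v_1(T)/v_1(T),\ldots,\dot v_d(T)/v_d(T)\big),$$ is a positive constant; here $\tilde{\boldsymbol a}$ is the unique minimizer of $\boldsymbol x^\top\Sigma(T)^{-1}\boldsymbol x$ over $\{\boldsymbol x\in\mathbb R^d:\boldsymbol x\ge\boldsymbol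 a\}$, with $\Sigma(T)=A\,\mathrm{diag}(v_1(T),\ldots,v_d(T))A^\top$, and $\boldsymbol\lambda=\Sigma(T)^{-1}\tilde{\boldsymbol a}$.
   Context: Vector inequalities are componentwise: $\boldsymbol x>\boldsymbol y$ means $x_i>y_i$ for all $i$, and $\boldsymbol x\ge\boldsymbol y$ means $x_i\ge y_i$ for all $i$. The notation $f(u)\sim g(u)$ as $u\to\infty$ means $f(u)/g(u)\to1$. $\dot v_i$ denotes the derivative of $v_i$ (one-sided at the endpoints of $[0,T]$). $\Sigma(T)$ is the covariance matrix of $\boldsymbol X(T)$, which is positive definite, so the quadratic programming problem has a unique solution. *)

theory Defs
  imports "HOL-Probability.Probability"
begin

text \<open>Degenerate (almost surely constant) variables count as Gaussian.\<close>

definition gaussian_rv :: "'w measure \<Rightarrow> ('w \<Rightarrow> real) \<Rightarrow> bool" where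
  "gaussian_rv M X \<longleftrightarrow> X \<in> borel_measurable M \<and>
     (\<exists>m. (AE \<omega> in M. X \<omega> = m) \<or> (\<exists>s>0. distributed M lborel X (normal_density m s)))"

definition centered_gaussian_process :: "'w measure \<Rightarrow> real set \<Rightarrow> (real \<Rightarrow> 'w \<Rightarrow> real) \<Rightarrow> bool" where
  "centered_gaussian_process M I Y \<longleftrightarrow>
     (\<forall>F c. finite F \<and> F \<subseteq> I \<longrightarrow> gaussian_rv M (\<lambda>\<omega>. \<Sum>t\<in>F. c t * Y t \<omega>)) \<and>
     (\<forall>t\<in>I. Y t \<in> borel_measurable M \<and> prob_space.expectation M (Y t) = 0)"

text \<open>
  A process on \<open>I\<close> is viewed as a random element of the product space over \<open>I\<close>, so
  that equality of laws there is equality of all finite-dimensional distributions and independence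
  there is independence of the processes.
\<close>

definition process_space :: "real set \<Rightarrow> (real \<Rightarrow> real) measure" where
  "process_space I = (\<Pi>\<^sub>M t\<in>I. borel)"

definition process_law :: "'w measure \<Rightarrow> real set \<Rightarrow> (real \<Rightarrow> 'w \<Rightarrow> real) \<Rightarrow> (real \<Rightarrow> real) measure" where
  "process_law M I Y = distr M (process_space I) (\<lambda>\<omega>. \<lambda>t\<in>I. Y t \<omega>)"

definition stationary_increments :: "'w measure \<Rightarrow> (real \<Rightarrow> 'w \<Rightarrow> real) \<Rightarrow> bool" where
  "stationary_increments M Y \<longleftrightarrow>
     (\<forall>h\<ge>0. process_law M {0..} (\<lambda>t \<omega>. Y (t + h) \<omega> - Y h \<omega>)
           = process_law M {0..} (\<lambda>t \<omega>. Y t \<omega> - Y 0 \<omega>))"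

definition independent_processes ::
    "'w measure \<Rightarrow> real set \<Rightarrow> ('i \<Rightarrow> real \<Rightarrow> 'w \<Rightarrow> real) \<Rightarrow> 'i set \<Rightarrow> bool" where
  "independent_processes M I Y J \<longleftrightarrow>
     prob_space.indep_vars M (\<lambda>_. process_space I) (\<lambda>i \<omega>. \<lambda>t\<in>I. Y i t \<omega>) J"

definition diag_mat :: "real ^ 'n \<Rightarrow> real ^ 'n ^ 'n" where
  "diag_mat w = (\<chi> i j. if i = j then w $ i else 0)"

definition is_qp_solution :: "real ^ 'n ^ 'n \<Rightarrow> real ^ 'n \<Rightarrow> real ^ 'n \<Rightarrow> bool" where
  "is_qp_solution S a x \<longleftrightarrow>
     is_arg_min (\<lambda>x. x \<bullet> (matrix_inv S *v x)) (\<lambda>x. \<forall>i. a $ i \<le> x $ i) x"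

definition qp_solution :: "real ^ 'n ^ 'n \<Rightarrow> real ^ 'n \<Rightarrow> real ^ 'n" where
  "qp_solution S a = (THE x. is_qp_solution S a x)"

text \<open>
  Since paths are only almost surely continuous, the event below need not belong to the sigma-algebra
  of \<open>M\<close>, and \<^const>\<open>measure\<close> is \<open>0\<close> on non-measurable sets. It differs from
  a measurable event by a subset of a null set, so its probability is taken in the completion.
\<close>

definition exceed_prob ::
    "'w measure \<Rightarrow> (real \<Rightarrow> 'w \<Rightarrow> real ^ 'n) \<Rightarrow> real ^ 'n \<Rightarrow> real set \<Rightarrow> real ^ 'n \<Rightarrow> real" where
  "exceed_prob M X c I b =
     measure (completion M) {\<omega> \<in> space M. \<exists>t\<in>I. \<forall>i. (X t \<omega> - t *\<^sub>R c) $ i > b $ i}"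

end

theory Submission
  imports Defs
begin

text \<open>
  Regress \<open>Z(t)\<close> on \<open>Z(T)\<close>. The residual (bridge) is independent of \<open>Z(T)\<close>, and at time \<open>T - s/u\<^sup>2\<close> its
  variance is \<open>o(s/u\<^sup>2)\<close>, hence negligible on the relevant spatial scale \<open>1/u\<close>. Near \<open>T\<close> the
  process is therefore the deterministic motion \<open>X(T) - (s/2u) w\<close> with \<open>w = A Q A\<inverse> atil\<close>, and the exceedance event
  says that \<open>X(T)\<close> lies in the union of the translates along \<open>w\<close> of the target orthant. Under the
  exponential density \<open>exp (- lam \<bullet> y)\<close> the measure of this union is \<open>C\<close> times the measure of the orthant.
  Times bounded away from \<open>T\<close>, and values of \<open>X(T)\<close> away from \<open>u atil\<close>, are exponentially negligible.
  All suprema are controlled by dyadic chaining, carried out under conditioning on \<open>Z(T)\<close>.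
\<close>

subsection \<open>Lebesgue measure under linear maps\<close>

text \<open>Every estimate is relative to \<open>PT u (corner u)\<close>, which is itself
  exponentially small, so an error bound for the bridge must carry the probability of an event of
  the vector \<open>Z T\<close> as a factor. Therefore chaining is stated relative to an event
  \<open>G\<close>, and its input is that each single increment of the bridge is independent of all
  of \<open>Z T\<close>. The covariance enters through two facts: a bridge increment over a time h
  has variance at most v(h), which is o(h) by (BII), and the regression coefficient at T - h is 1 -
  h v'(T) / (2 v(T)) + o(h), where (BII) enters again. The factor 1/2 in the motion is harmless
  because C is homogeneous of degree 0 in w. Errors proportional to rescaled time are absorbed by
  tilting w / 2 to w / 2 +- K ep, bounded ones by a margin of size K ep; ep tends to 0 only after u
  tends to infinity. Constraints with multiplier 0 are either slack, hence void in the limit, or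
  tight, and then they restrict numerator and denominator alike.\<close>

lemma matrix_vector_measurable [measurable]: "(\<lambda>x. (B :: real^'n^'m) *v x) \<in> borel_measurable borel"
  by (intro borel_measurable_continuous_onI matrix_vector_mult_linear_continuous_on)

lemma nn_integral_lborel_translate:
  fixes f :: "'a::euclidean_space \<Rightarrow> ennreal"
  assumes [measurable]: "f \<in> borel_measurable borel"
  shows "(\<integral>\<^sup>+x. f (x + c) \<partial>lborel) = (\<integral>\<^sup>+x. f x \<partial>lborel)"
proof -
  have "(\<integral>\<^sup>+x. f x \<partial>lborel) = (\<integral>\<^sup>+x. f x \<partial>distr lborel borel ((+) c))"
    by (simp add: lborel_distr_plus)
  also have "\<dots> = (\<integral>\<^sup>+x. f (c + x) \<partial>lborel)"
    by (subst nn_integral_distr) auto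
  finally show ?thesis by (simp add: add.commute)
qed

text \<open>The Fubini argument for the uniqueness of Haar measure. The library computes the factor \<open>c\<close>
  as a determinant, but only for well-ordered index types.\<close>

lemma nn_integral_lborel_linear_ex:
  fixes L :: "real^'n^'n"
  assumes inv: "invertible L"
  shows "\<exists>c>0. \<forall>f\<in>borel_measurable borel. (\<integral>\<^sup>+x. f (L *v x) \<partial>lborel) = ennreal c * (\<integral>\<^sup>+x. f x \<partial>lborel)"
proof -
  obtain K where K: "L ** K = mat 1" "K ** L = mat 1"
    using inv unfolding invertible_def by auto
  have KL: "K *v (L *v x) = x" "L *v (K *v x) = x" for x :: "real^'n"
    by (simp_all add: K matrix_vector_mul_assoc)
  \<comment> \<open>Any test function with positive finite integral would serve; for the unit ball,
    c and d are controlled by the operator norms of L and K.\<close>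
  define g :: "real^'n \<Rightarrow> ennreal" where "g = indicator (cball 0 1)"
  have [measurable]: "g \<in> borel_measurable borel" unfolding g_def by (intro borel_measurable_indicator) auto
  define c where "c = (\<integral>\<^sup>+x. g (- (L *v x)) \<partial>lborel)"
  define d where "d = (\<integral>\<^sup>+x. g x \<partial>lborel)"
  have d: "d = emeasure lborel (cball (0::real^'n) 1)" unfolding d_def g_def by simp
  have dfin: "d < \<infinity>" unfolding d by (rule emeasure_lborel_cball_finite)
  have dpos: "d \<noteq> 0"
    unfolding d using content_cball_pos[of 1 "0::real^'n"] by (auto simp: measure_def)
  obtain BK where BK: "BK > 0" "\<And>x. norm (K *v x) \<le> BK * norm x"
    using linear_bounded_pos[of "(*v) K"] matrix_vector_mul_linear by (metis mult.commute)
  obtain BL where BL: "BL > 0" "\<And>x. norm (L *v x) \<le> BL * norm x"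
    using linear_bounded_pos[of "(*v) L"] matrix_vector_mul_linear by (metis mult.commute)
  have "c \<le> (\<integral>\<^sup>+x. indicator (cball 0 BK) x \<partial>(lborel :: (real^'n) measure))"
    unfolding c_def g_def
  proof (intro nn_integral_mono)
    fix x :: "real^'n"
    have "norm x \<le> BK" if "norm (L *v x) \<le> 1"
    proof -
      have "norm x \<le> BK * norm (L *v x)" using BK(2)[of "L *v x"] by (simp add: KL)
      also have "\<dots> \<le> BK * 1" using BK(1) that by (intro mult_left_mono) auto
      finally show ?thesis by simp
    qed
    then show "indicator (cball 0 1) (- (L *v x)) \<le> (indicator (cball 0 BK) x :: ennreal)"
      by (auto split: split_indicator)
  qed
  then have cfin: "c < \<infinity>"
    using emeasure_lborel_cball_finite[of "0::real^'n" BK] by (auto simp: le_less_trans)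
  \<comment> \<open>Both sides equal the double integral of \<open>f (L *v x + y) * g y\<close>. On
    the left, x is translated by \<open>K *v y\<close>. On the right, z = L x + y leaves
    \<open>g (z - L *v x)\<close>, and translating x by \<open>K *v z\<close> turns this into
    \<open>g (- (L *v x))\<close>, whence the sign in the definition of \<open>c\<close>.\<close>
  have key: "(\<integral>\<^sup>+x. f (L *v x) \<partial>lborel) * d = c * (\<integral>\<^sup>+x. f x \<partial>lborel)"
    if f [measurable]: "f \<in> borel_measurable borel" for f :: "real^'n \<Rightarrow> ennreal"
  proof -
    have "(\<integral>\<^sup>+x. f (L *v x) \<partial>lborel) * d = (\<integral>\<^sup>+y. (\<integral>\<^sup>+x. f (L *v x) \<partial>lborel) * g y \<partial>lborel)"
      unfolding d_def by (simp add: nn_integral_cmult)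
    also have "\<dots> = (\<integral>\<^sup>+y. (\<integral>\<^sup>+x. f (L *v x) * g y \<partial>lborel) \<partial>lborel)"
      by (simp add: nn_integral_multc)
    also have "\<dots> = (\<integral>\<^sup>+y. (\<integral>\<^sup>+x. f (L *v x + y) * g y \<partial>lborel) \<partial>lborel)"
    proof (rule nn_integral_cong)
      fix y
      have "(\<integral>\<^sup>+x. f (L *v x) * g y \<partial>lborel) = (\<integral>\<^sup>+x. f (L *v (x + K *v y)) * g y \<partial>lborel)"
        by (subst nn_integral_lborel_translate[of "\<lambda>x. f (L *v x) * g y"]) auto
      then show "(\<integral>\<^sup>+x. f (L *v x) * g y \<partial>lborel) = (\<integral>\<^sup>+x. f (L *v x + y) * g y \<partial>lborel)"
        by (simp add: matrix_vector_right_distrib KL)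
    qed
    also have "\<dots> = (\<integral>\<^sup>+x. (\<integral>\<^sup>+y. f (L *v x + y) * g y \<partial>lborel) \<partial>lborel)"
      by (subst lborel_pair.Fubini') auto
    also have "\<dots> = (\<integral>\<^sup>+x. (\<integral>\<^sup>+z. f z * g (z - L *v x) \<partial>lborel) \<partial>lborel)"
    proof (rule nn_integral_cong)
      fix x
      show "(\<integral>\<^sup>+y. f (L *v x + y) * g y \<partial>lborel) = (\<integral>\<^sup>+z. f z * g (z - L *v x) \<partial>lborel)"
        by (subst nn_integral_lborel_translate[of "\<lambda>z. f z * g (z - L *v x)" "L *v x", symmetric])
           (auto simp: add.commute)
    qed
    also have "\<dots> = (\<integral>\<^sup>+z. (\<integral>\<^sup>+x. f z * g (z - L *v x) \<partial>lborel) \<partial>lborel)"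
      by (subst lborel_pair.Fubini') auto
    also have "\<dots> = (\<integral>\<^sup>+z. f z * c \<partial>lborel)"
    proof (rule nn_integral_cong)
      fix z
      have "(\<integral>\<^sup>+x. g (z - L *v x) \<partial>lborel) = (\<integral>\<^sup>+x. g (z - L *v (x + K *v z)) \<partial>lborel)"
        by (subst nn_integral_lborel_translate[of "\<lambda>x. g (z - L *v x)"]) auto
      then show "(\<integral>\<^sup>+x. f z * g (z - L *v x) \<partial>lborel) = f z * c"
        by (simp add: matrix_vector_right_distrib KL c_def nn_integral_cmult)
    qed
    finally show ?thesis by (simp add: nn_integral_multc) (simp add: mult.commute)
  qed
  \<comment> \<open>The ball of radius BL contains the image of the unit ball under L, so its
    indicator composed with L has positive integral.\<close>
  have "c \<noteq> 0"
  proof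
    assume "c = 0"
    moreover have "(indicator (cball 0 BL) :: real^'n \<Rightarrow> ennreal) \<in> borel_measurable borel"
      by (intro borel_measurable_indicator) auto
    ultimately have "(\<integral>\<^sup>+x. indicator (cball 0 BL) (L *v x) \<partial>(lborel :: (real^'n) measure)) = 0"
      using key[of "indicator (cball 0 BL)"] dpos by simp
    moreover have "d \<le> (\<integral>\<^sup>+x. indicator (cball 0 BL) (L *v x) \<partial>lborel)"
      unfolding d_def g_def
    proof (intro nn_integral_mono)
      fix x :: "real^'n"
      have "norm (L *v x) \<le> BL" if "norm x \<le> 1"
        using order_trans[OF BL(2)[of x] mult_left_mono[OF that]] BL(1) by simp
      then show "indicator (cball 0 1) x \<le> (indicator (cball 0 BL) (L *v x) :: ennreal)"
        by (auto split: split_indicator)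
    qed
    ultimately show False using dpos by simp
  qed
  define e where "e = enn2real c / enn2real d"
  have "e > 0" unfolding e_def using \<open>c \<noteq> 0\<close> cfin dpos dfin
    by (simp add: enn2real_positive_iff zero_less_iff_neq_zero)
  moreover have "(\<integral>\<^sup>+x. f (L *v x) \<partial>lborel) = ennreal e * (\<integral>\<^sup>+x. f x \<partial>lborel)"
    if f: "f \<in> borel_measurable borel" for f :: "real^'n \<Rightarrow> ennreal"
  proof -
    have e: "ennreal e = c / d"
      unfolding e_def using cfin dfin dpos
      by (subst divide_ennreal[symmetric]) (auto simp: enn2real_positive_iff zero_less_iff_neq_zero)
    have "(\<integral>\<^sup>+x. f (L *v x) \<partial>lborel) = (\<integral>\<^sup>+x. f (L *v x) \<partial>lborel) * d / d"
      using dpos dfin by (simp add: ennreal_mult_divide_eq)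
    also have "\<dots> = c * (\<integral>\<^sup>+x. f x \<partial>lborel) / d" by (simp add: key[OF f])
    finally show ?thesis by (simp add: e ennreal_times_divide mult.commute)
  qed
  ultimately show ?thesis by blast
qed

lemma nn_integral_lborel_scale:
  fixes f :: "real^'n \<Rightarrow> ennreal" and d :: "'n \<Rightarrow> real"
  assumes [measurable]: "f \<in> borel_measurable borel" and d: "\<And>i. d i \<noteq> 0"
  shows "(\<integral>\<^sup>+x. f x \<partial>lborel) = ennreal (\<Prod>i\<in>UNIV. \<bar>d i\<bar>) * (\<integral>\<^sup>+x. f (\<chi> i. d i * x $ i) \<partial>lborel)"
proof -
  \<comment> \<open>The affine change of variables is indexed by basis vectors; this linear form
    takes the value \<open>d i\<close> at the i-th one.\<close>
  define c :: "real^'n \<Rightarrow> real" where "c b = (\<Sum>i\<in>UNIV. d i * b $ i)" for b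
  have cax: "c (axis i 1) = d i" for i
    unfolding c_def by (subst sum.remove[of _ i]) (auto simp: axis_def)
  have B: "(Basis :: (real^'n) set) = range (\<lambda>i. axis i 1)" by (auto simp: Basis_vec_def)
  have inj: "inj (\<lambda>i. axis i (1::real) :: real^'n)" by (auto simp: inj_on_def axis_eq_axis)
  have T: "(\<chi> i. d i * x $ i) = 0 + (\<Sum>j\<in>Basis. (c j * (x \<bullet> j)) *\<^sub>R j)" for x :: "real^'n"
    unfolding B sum.reindex[OF inj] 
    by (simp add: vec_eq_iff cax inner_axis) (simp add: axis_def if_distrib cong: if_cong)
  have cn: "c j \<noteq> 0" if "j \<in> Basis" for j using that d unfolding B by (auto simp: cax)
  have pr: "(\<Prod>j\<in>Basis. \<bar>c j\<bar>) = (\<Prod>i\<in>UNIV. \<bar>d i\<bar>)"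
    unfolding B prod.reindex[OF inj] by (simp add: cax)
  have eq: "lborel = density (distr lborel borel (\<lambda>x::real^'n. \<chi> i. d i * x $ i)) (\<lambda>_. (\<Prod>i\<in>UNIV. \<bar>d i\<bar>))"
    unfolding T pr[symmetric] by (rule lborel_affine_euclidean) (rule cn)
  have [measurable]: "(\<lambda>x::real^'n. \<chi> i. d i * x $ i) \<in> borel_measurable borel"
    by (intro borel_measurable_continuous_onI continuous_intros)
  show ?thesis
    by (subst eq, subst nn_integral_density)
      (auto simp: nn_integral_distr nn_integral_cmult)
qed

lemma nn_integral_lborel_prod_vec:
  fixes f :: "'n::finite \<Rightarrow> real \<Rightarrow> real"
  assumes m: "\<And>i. f i \<in> borel_measurable borel" and nn: "\<And>i x. 0 \<le> f i x"
  shows "(\<integral>\<^sup>+x. (\<Prod>i\<in>UNIV. f i (x $ i)) \<partial>(lborel :: (real^'n) measure)) = (\<Prod>i\<in>UNIV. \<integral>\<^sup>+x. f i x \<partial>lborel)"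
proof -
  have B: "(Basis :: (real^'n) set) = range (\<lambda>i. axis i 1)" by (auto simp: Basis_vec_def)
  have inj: "inj (\<lambda>i. axis i (1::real) :: real^'n)" by (auto simp: inj_on_def axis_eq_axis)
  define h where "h b = f (THE i. b = axis i (1::real))" for b :: "real^'n"
  have h: "h (axis i 1) = f i" for i unfolding h_def by (simp add: axis_eq_axis)
  show ?thesis
    using nn_integral_lborel_prod[of h] m nn
    unfolding B prod.reindex[OF inj] by (force simp: h inner_axis prod_ennreal[symmetric])
qed

text \<open>The shear \<open>S\<close> by \<open>v\<close> and the shear by \<open>2 v\<close> are conjugate by a coordinate scaling, while the latter
  is \<open>S \<circ> S\<close>. So the Jacobian \<open>c\<close> of \<open>S\<close> satisfies \<open>c = c\<^sup>2\<close>.\<close>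

lemma nn_integral_lborel_shear:
  fixes f :: "real^'n \<Rightarrow> ennreal" and v :: "real^'n"
  assumes f [measurable]: "f \<in> borel_measurable borel" and v: "v $ i = 0"
  shows "(\<integral>\<^sup>+x. f (x + x $ i *\<^sub>R v) \<partial>lborel) = (\<integral>\<^sup>+x. f x \<partial>lborel)"
proof -
  define L :: "real^'n^'n" where "L = (\<chi> j k. (if j = k then 1 else 0) + (if k = i then v $ j else 0))"
  define K :: "real^'n^'n" where "K = (\<chi> j k. (if j = k then 1 else 0) - (if k = i then v $ j else 0))"
  have L: "L *v x = x + x $ i *\<^sub>R v" for x
    by (simp add: vec_eq_iff L_def matrix_vector_mult_def distrib_right sum.distrib if_distrib[of "\<lambda>a. a * _"] cong: if_cong)
  have K: "K *v x = x - x $ i *\<^sub>R v" for x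
    by (simp add: vec_eq_iff K_def matrix_vector_mult_def left_diff_distrib sum_subtractf if_distrib[of "\<lambda>a. a * _"] cong: if_cong)
  have "L ** K = mat 1" "K ** L = mat 1"
    unfolding matrix_eq matrix_vector_mul_assoc[symmetric] by (simp_all add: L K v)
  then have "invertible L" unfolding invertible_def by auto
  from nn_integral_lborel_linear_ex[OF this] obtain c where c: "c > 0"
    "\<And>f :: real^'n \<Rightarrow> ennreal. f \<in> borel_measurable borel \<Longrightarrow> (\<integral>\<^sup>+x. f (x + x $ i *\<^sub>R v) \<partial>lborel) = ennreal c * (\<integral>\<^sup>+x. f x \<partial>lborel)"
    unfolding L by auto
  \<comment> \<open>A test function with integral 1 turns the two evaluations of the Jacobian of the
    double shear into an equation between numbers.\<close>
  define g :: "real^'n \<Rightarrow> ennreal" where "g = indicator (box 0 One)"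
  have [measurable]: "g \<in> borel_measurable borel" unfolding g_def by simp
  have g1: "(\<integral>\<^sup>+x. g x \<partial>lborel) = 1" unfolding g_def by (simp add: emeasure_lborel_box_eq inner_sum_left inner_Basis if_distrib cong: if_cong)
  have [measurable]: "(\<lambda>x::real^'n. x + x $ i *\<^sub>R v) \<in> borel_measurable borel" "(\<lambda>x::real^'n. x + (2 * x $ i) *\<^sub>R v) \<in> borel_measurable borel"
    by (intro borel_measurable_continuous_onI continuous_intros)+
  have "(\<integral>\<^sup>+x. g (x + (2 * x $ i) *\<^sub>R v) \<partial>lborel) = (\<integral>\<^sup>+x. g ((x + x $ i *\<^sub>R v) + (x + x $ i *\<^sub>R v) $ i *\<^sub>R v) \<partial>lborel)"
    by (simp add: v scaleR_add_left[symmetric] add.assoc)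
  also have "\<dots> = ennreal c * (ennreal c * 1)"
    by (subst c(2)[of "\<lambda>x. g (x + x $ i *\<^sub>R v)"], simp, subst c(2), simp, simp add: g1)
  finally have 1: "(\<integral>\<^sup>+x. g (x + (2 * x $ i) *\<^sub>R v) \<partial>lborel) = ennreal (c * c)"
    using c(1) by (simp add: ennreal_mult)
  define d where "d j = (if j = i then 1/2 else 1::real)" for j
  have d0: "d j \<noteq> 0" for j by (simp add: d_def)
  define D where "D x = (\<chi> j. d j * x $ j)" for x :: "real^'n"
  have [measurable]: "D \<in> borel_measurable borel" unfolding D_def
    by (intro borel_measurable_continuous_onI continuous_intros)
  define p where "p = ennreal (\<Prod>j\<in>UNIV. \<bar>d j\<bar>)"
  have sc: "(\<integral>\<^sup>+x. h x \<partial>lborel) = p * (\<integral>\<^sup>+x. h (D x) \<partial>lborel)"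
    if "h \<in> borel_measurable borel" for h :: "real^'n \<Rightarrow> ennreal"
    unfolding D_def p_def by (rule nn_integral_lborel_scale[OF that d0])
  have Dx: "D x + (2 * D x $ i) *\<^sub>R v = D (x + x $ i *\<^sub>R v)" for x
    by (auto simp: vec_eq_iff D_def d_def v distrib_left)
  have "(\<integral>\<^sup>+x. g (x + (2 * x $ i) *\<^sub>R v) \<partial>lborel) = p * (\<integral>\<^sup>+x. g (D (x + x $ i *\<^sub>R v)) \<partial>lborel)"
    by (subst sc) (auto simp: Dx)
  also have "\<dots> = ennreal c * (p * (\<integral>\<^sup>+x. g (D x) \<partial>lborel))"
    by (subst c(2)[of "\<lambda>x. g (D x)"]) (auto simp: mult_ac)
  also have "\<dots> = ennreal c"
    by (subst sc[symmetric]) (auto simp: g1)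
  finally have "c * c = c" using 1 c(1) by (metis ennreal_inj less_imp_le mult_nonneg_nonneg)
  then have "c = 1" using c(1) by simp
  with c(2)[OF f] show ?thesis by simp
qed

subsection \<open>Orthants swept along a direction\<close>

lemma AE_lborel_inner_neq:
  fixes a :: "'a::euclidean_space"
  assumes "a \<noteq> 0"
  shows "AE x in lborel. a \<bullet> x \<noteq> b"
proof -
  have c: "closed {x. a \<bullet> x = b}" by (rule closed_hyperplane)
  have "negligible {x. a \<bullet> x = b}" using assms by (intro negligible_hyperplane) auto
  then have "{x. a \<bullet> x = b} \<in> null_sets lborel"
    using c by (simp add: negligible_iff_null_sets null_sets_completion_iff)
  then show ?thesis by (rule AE_I') auto
qed

lemma AE_lborel_component_neq: "AE x in (lborel :: (real^'n) measure). x $ i \<noteq> b"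
  using AE_lborel_inner_neq[of "axis i 1 :: real^'n" b] by (simp add: inner_axis' axis_eq_0_iff)

lemma inner_vec_real: "(x :: real^'n) \<bullet> y = (\<Sum>i\<in>UNIV. x $ i * y $ i)"
  by (simp add: inner_vec_def)

text \<open>In the application \<open>lam\<close> is the vector of Lagrange multipliers of the
  quadratic program.\<close>

locale orthant_weight =
  fixes lam :: "real^'n"
  assumes lam_nonneg: "0 \<le> lam $ i" and lam_pos_ex: "\<exists>i. 0 < lam $ i"
begin

text \<open>The pointwise limit of the scaling \<open>scal u\<close> below, as u tends to
  infinity.\<close>

definition proj :: "real^'n \<Rightarrow> real^'n" where
  "proj y = (\<chi> i. if 0 < lam $ i then 0 else y $ i)"

text \<open>The union over all s of the orthant translated by \<open>s *\<^sub>R w\<close>. Here s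
  is the rescaled time before T and \<open>r\<close> an error margin. Only coordinates of positive
  weight are constrained: in the limit, all other constraints are independent of s.\<close>

definition sweep :: "real^'n \<Rightarrow> real \<Rightarrow> (real^'n) set" where
  "sweep w r = {y. \<exists>s\<ge>0. \<forall>i. 0 < lam $ i \<longrightarrow> y $ i > s * w $ i + r}"

definition orth :: "(real^'n) set" where
  "orth = {y. \<forall>i. 0 < lam $ i \<longrightarrow> y $ i > 0}"

text \<open>The constant C of the theorem for a general direction; replacing w by a positive
  multiple does not change it.\<close>

definition sweep_const :: "real^'n \<Rightarrow> real" where
  "sweep_const w = (\<Sum>i\<in>UNIV. max (lam $ i * w $ i) 0) / (lam \<bullet> w)"

text \<open>Up to ties, \<open>sweep_part w i\<close> is the part of the sweep in which \<open>y\<^sub>i / w\<^sub>i\<close> is the least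
  of the quotients \<open>y\<^sub>k / w\<^sub>k\<close> with \<open>w\<^sub>k > 0\<close>. A shear followed by a scaling of the \<open>i\<close>-th coordinate maps
  the orthant onto it and preserves \<open>lam \<bullet> y\<close>. Its Jacobian is the \<open>i\<close>-th summand of \<^const>\<open>sweep_const\<close>.\<close>

definition sweep_part :: "real^'n \<Rightarrow> 'n \<Rightarrow> (real^'n) set" where
  "sweep_part w i = {y. y $ i > 0 \<and> (\<forall>k. 0 < lam $ k \<and> k \<noteq> i \<longrightarrow> y $ k > y $ i / w $ i * w $ k)}"

lemma sweep_const_nonneg: "0 < lam \<bullet> w \<Longrightarrow> 0 \<le> sweep_const w"
  unfolding sweep_const_def by (intro divide_nonneg_pos sum_nonneg) auto

lemma lam_not_pos: "\<not> 0 < lam $ i \<Longrightarrow> lam $ i = 0"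
  using lam_nonneg[of i] by linarith

lemma open_sweep: "open (sweep w r)"
proof -
  have "sweep w r = (\<Union>s\<in>{0..}. \<Inter>i\<in>{i. 0 < lam $ i}. {y. y $ i > s * w $ i + r})"
    by (auto simp: sweep_def)
  moreover have "open \<dots>"
    by (intro open_UN ballI open_INT open_Collect_less continuous_intros) auto
  ultimately show ?thesis by simp
qed

lemma open_orth: "open orth"
proof -
  have "orth = (\<Inter>i\<in>{i. 0 < lam $ i}. {y. y $ i > 0})" by (auto simp: orth_def)
  moreover have "open \<dots>"
    by (intro ballI open_INT open_Collect_less continuous_intros) auto
  ultimately show ?thesis by simp
qed

lemma open_sweep_part: "open (sweep_part w i)"
proof -
  have "sweep_part w i = {y. y $ i > 0} \<inter> (\<Inter>k\<in>{k. 0 < lam $ k \<and> k \<noteq> i}. {y. y $ k > y $ i / w $ i * w $ k})"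
    by (auto simp: sweep_part_def)
  moreover have "open \<dots>"
    unfolding divide_inverse
    by (intro open_Int ballI open_INT open_Collect_less continuous_intros) auto
  ultimately show ?thesis by simp
qed

lemma borel_sets [measurable]: "sweep w r \<in> sets borel" "orth \<in> sets borel" "sweep_part w i \<in> sets borel"
  using open_sweep open_orth open_sweep_part by (auto intro: borel_open)

text \<open>If y is in the sweep with parameter s, then s can be raised to the least quotient y_i /
  w_i with w_i > 0: a constraint with w_k > 0 is met because its quotient is larger, one with w_k
  \<le> 0 only becomes weaker. Ties between quotients lie in finitely many hyperplanes, which are
  null sets.\<close>

lemma sweep_eq_UN_parts:
  assumes w: "lam \<bullet> w > 0"
  shows "AE y in lborel. indicator (sweep w 0) y = (\<Sum>i | 0 < lam $ i \<and> 0 < w $ i. indicator (sweep_part w i) y :: ennreal)"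
proof -
  define P where "P = {i. 0 < lam $ i \<and> 0 < w $ i}"
  have Pne: "P \<noteq> {}"
  proof
    assume "P = {}"
    then have "lam $ i * w $ i \<le> 0" for i
      using lam_nonneg[of i] unfolding P_def
      by (metis (mono_tags, lifting) empty_Collect_eq le_less linorder_not_le mult_nonneg_nonpos mult_zero_left)
    then have "lam \<bullet> w \<le> 0" unfolding inner_vec_real by (intro sum_nonpos) auto
    with w show False by simp
  qed
  have "AE y in lborel. y $ k * w $ i \<noteq> y $ i * w $ k" if "i \<in> P" "k \<noteq> i" for i k
  proof -
    have "axis k (w $ i) - axis i (w $ k) \<noteq> (0 :: real^'n)"
      using that by (auto simp: vec_eq_iff axis_def P_def)
    from AE_lborel_inner_neq[OF this, of 0] show ?thesis
      by (simp add: inner_diff_left inner_axis' mult.commute)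
  qed
  then have "AE y in lborel. \<forall>i\<in>P. \<forall>k\<in>-{i}. y $ k * w $ i \<noteq> y $ i * w $ k"
    by (intro AE_finite_allI) auto
  then show ?thesis
  proof eventually_elim
    case (elim y)
    have disj: "i = k" if "i \<in> P" "k \<in> P" "y \<in> sweep_part w i" "y \<in> sweep_part w k" for i k
    proof (rule ccontr)
      assume "i \<noteq> k"
      with that have "y $ k > y $ i / w $ i * w $ k" "y $ i > y $ k / w $ k * w $ i" "w $ i > 0" "w $ k > 0"
        by (auto simp: sweep_part_def P_def)
      then show False by (simp add: field_simps)
    qed
    have ex: "y \<in> sweep w 0 \<longleftrightarrow> (\<exists>i\<in>P. y \<in> sweep_part w i)"
    proof
      assume "y \<in> sweep w 0"
      then obtain s where s: "s \<ge> 0" "\<And>i. 0 < lam $ i \<Longrightarrow> y $ i > s * w $ i" by (auto simp: sweep_def)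
      obtain i where i: "i \<in> P" "\<And>k. k \<in> P \<Longrightarrow> y $ i / w $ i \<le> y $ k / w $ k"
        using arg_min_if_finite(1)[OF _ Pne, of "\<lambda>i. y $ i / w $ i"] arg_min_least[OF _ Pne, of _ "\<lambda>i. y $ i / w $ i"] by auto
      have wi: "w $ i > 0" "lam $ i > 0" using i by (auto simp: P_def)
      have si: "s < y $ i / w $ i" using s(2)[of i] wi by (simp add: field_simps)
      have "y $ k > y $ i / w $ i * w $ k" if k: "0 < lam $ k" "k \<noteq> i" for k
      proof (cases "w $ k > 0")
        case True
        then have "y $ i / w $ i \<le> y $ k / w $ k" using i(2)[of k] k by (simp add: P_def)
        then have "y $ i * w $ k \<le> y $ k * w $ i" using True wi by (simp add: field_simps)
        moreover have "y $ k * w $ i \<noteq> y $ i * w $ k" using elim i(1) k by auto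
        ultimately show ?thesis using wi by (simp add: field_simps)
      next
        case False
        then have "y $ i / w $ i * w $ k \<le> s * w $ k" using si by (intro mult_right_mono_neg) auto
        with s(2)[OF k(1)] show ?thesis by linarith
      qed
      moreover have "y $ i > 0" using s(1) si wi by (metis divide_le_0_iff le_less_trans less_le_not_le not_le)
      ultimately have "y \<in> sweep_part w i" by (auto simp: sweep_part_def)
      with i show "\<exists>i\<in>P. y \<in> sweep_part w i" by blast
    next
      assume "\<exists>i\<in>P. y \<in> sweep_part w i"
      then obtain i where i: "i \<in> P" "y \<in> sweep_part w i" by blast
      then have wi: "w $ i > 0" "lam $ i > 0" "y $ i > 0" by (auto simp: P_def sweep_part_def)
      define s0 where "s0 = y $ i / w $ i"
      have "s0 > 0" using wi by (simp add: s0_def)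
      \<comment> \<open>At \<open>s0\<close> itself the i-th constraint holds with equality only.
        Slightly below \<open>s0\<close> it is strict, and the others persist by continuity.\<close>
      have "eventually (\<lambda>s. \<forall>k\<in>{k. 0 < lam $ k}. y $ k > s * w $ k) (at_left s0)"
      proof (intro eventually_ball_finite ballI)
        fix k assume k: "k \<in> {k. 0 < lam $ k}"
        show "eventually (\<lambda>s. y $ k > s * w $ k) (at_left s0)"
        proof (cases "k = i")
          case True
          have "eventually (\<lambda>s. s < s0) (at_left s0)" by (auto simp: eventually_at_filter)
          then show ?thesis by eventually_elim (use True wi in \<open>simp add: s0_def field_simps\<close>)
        next
          case False
          then have "y $ k > s0 * w $ k" using i k by (auto simp: sweep_part_def s0_def)
          moreover have "((\<lambda>s. s * w $ k) \<longlongrightarrow> s0 * w $ k) (at_left s0)" by (intro tendsto_intros)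
          ultimately show ?thesis by (metis order_tendstoD(2))
        qed
      qed auto
      moreover have "eventually (\<lambda>s. s > 0) (at_left s0)"
        using \<open>s0 > 0\<close> by (rule eventually_at_leftI[rotated]) auto
      ultimately have "eventually (\<lambda>s. s > 0 \<and> (\<forall>k\<in>{k. 0 < lam $ k}. y $ k > s * w $ k)) (at_left s0)"
        by eventually_elim auto
      then obtain s where "s > 0" "\<forall>k\<in>{k. 0 < lam $ k}. y $ k > s * w $ k"
        using eventually_happens'[OF trivial_limit_at_left_real] by blast
      then show "y \<in> sweep w 0" by (auto simp: sweep_def intro!: exI[of _ s])
    qed
    show ?case
    proof (cases "y \<in> sweep w 0")
      case True
      then obtain i where i: "i \<in> P" "y \<in> sweep_part w i" using ex by blast
      then have "(\<Sum>i\<in>P. indicator (sweep_part w i) y :: ennreal) = indicator (sweep_part w i) y"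
        using disj by (subst sum.remove[of _ i]) (auto intro!: sum.neutral simp: indicator_def)
      with True i show ?thesis by (simp add: P_def)
    next
      case False
      then have "(\<Sum>i\<in>P. indicator (sweep_part w i) y :: ennreal) = 0"
        using ex by (intro sum.neutral) auto
      with False show ?thesis by (simp add: P_def)
    qed
  qed
qed

lemma nn_integral_sweep_part:
  assumes w: "lam \<bullet> w > 0" and i: "lam $ i > 0" "w $ i > 0"
    and H [measurable]: "H \<in> borel_measurable borel" and Hp: "\<And>y. H (proj y) = H y"
  shows "(\<integral>\<^sup>+y. indicator (sweep_part w i) y * (ennreal (exp (- (lam \<bullet> y))) * H y) \<partial>lborel) =
    ennreal (lam $ i * w $ i / (lam \<bullet> w)) * (\<integral>\<^sup>+y. indicator orth y * (ennreal (exp (- (lam \<bullet> y))) * H y) \<partial>lborel)"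
proof -
  define F where "F = (\<lambda>y. indicator (sweep_part w i) y * (ennreal (exp (- (lam \<bullet> y))) * H y))"
  have [measurable]: "F \<in> borel_measurable borel" unfolding F_def by measurable
  define v :: "real^'n" where "v = (\<chi> k. if 0 < lam $ k \<and> k \<noteq> i then w $ k / w $ i else 0)"
  have vi: "v $ i = 0" by (simp add: v_def)
  \<comment> \<open>The value of t is forced by preservation of \<open>lam \<bullet> y\<close>:
    after the map, the terms containing y_i add up to t y_i (lam \<bullet> w) / w_i, which must
    equal lam_i y_i.\<close>
  define t where "t = lam $ i * w $ i / (lam \<bullet> w)"
  have t: "t > 0" unfolding t_def using w i by simp
  define d where "d = (\<lambda>k. if k = i then t else 1)"
  define D where "D = (\<lambda>y::real^'n. \<chi> k. d k * y $ k)"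
  have [measurable]: "(\<lambda>x::real^'n. x + x $ i *\<^sub>R v) \<in> borel_measurable borel"
    by (intro borel_measurable_continuous_onI continuous_intros)
  have "(\<integral>\<^sup>+y. F y \<partial>lborel) = (\<integral>\<^sup>+y. F (y + y $ i *\<^sub>R v) \<partial>lborel)"
    by (rule nn_integral_lborel_shear[symmetric]) (auto simp: vi)
  also have "\<dots> = ennreal (\<Prod>k\<in>UNIV. \<bar>d k\<bar>) * (\<integral>\<^sup>+y. F (D y + D y $ i *\<^sub>R v) \<partial>lborel)"
    unfolding D_def by (rule nn_integral_lborel_scale) (use t in \<open>auto simp: d_def\<close>)
  also have "(\<Prod>k\<in>UNIV. \<bar>d k\<bar>) = t"
    using t by (subst prod.remove[of _ i]) (auto simp: d_def intro!: prod.neutral)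
  also have "(\<lambda>y. F (D y + D y $ i *\<^sub>R v)) = (\<lambda>y. indicator orth y * (ennreal (exp (- (lam \<bullet> y))) * H y))"
  proof
    fix y
    define z where "z = D y + D y $ i *\<^sub>R v"
    have zi: "z $ i = t * y $ i" by (simp add: z_def D_def d_def vi)
    have zk: "z $ k = y $ k + t * y $ i * (w $ k / w $ i)" if "k \<noteq> i" "0 < lam $ k" for k
      using that by (simp add: z_def D_def d_def v_def)
    have zo: "z $ k = y $ k" if "\<not> 0 < lam $ k" for k
      using that i by (auto simp: z_def D_def d_def v_def)
    have "proj z = proj y" by (simp add: proj_def vec_eq_iff zo)
    then have 1: "H z = H y" by (metis Hp)
    have 2: "z \<in> sweep_part w i \<longleftrightarrow> y \<in> orth"
      using t i by (auto simp: sweep_part_def orth_def zi zk zero_less_mult_iff) 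
    \<comment> \<open>All summands are brought to the form valid for k \<noteq> i, so that the last
      terms add up to a multiple of \<open>lam \<bullet> w\<close>; the correction at k = i amounts
      to - lam_i y_i.\<close>
    have "lam \<bullet> z = (\<Sum>k\<in>UNIV. lam $ k * y $ k + (if k = i then lam $ i * (t - 1) * y $ i - lam $ i * (t * y $ i) else 0) + t * y $ i / w $ i * (lam $ k * w $ k))"
      unfolding inner_vec_real
    proof (rule sum.cong)
      fix k
      show "lam $ k * z $ k = lam $ k * y $ k + (if k = i then lam $ i * (t - 1) * y $ i - lam $ i * (t * y $ i) else 0) + t * y $ i / w $ i * (lam $ k * w $ k)"
      proof (cases "k = i")
        case True then show ?thesis using i by (simp add: zi field_simps)
      next
        case False then show ?thesis
          using zk[of k] zo[of k] lam_not_pos[of k] by (cases "0 < lam $ k") (auto simp: field_simps)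
      qed
    qed simp
    also have "\<dots> = lam \<bullet> y + (lam $ i * (t - 1) * y $ i - lam $ i * (t * y $ i)) + t * y $ i / w $ i * (lam \<bullet> w)"
      unfolding inner_vec_real sum.distrib sum_distrib_left by (simp add: sum.delta)
    also have "t * y $ i / w $ i * (lam \<bullet> w) = lam $ i * y $ i"
      unfolding t_def using w i by (simp add: field_simps)
    finally have 3: "lam \<bullet> z = lam \<bullet> y" by (simp add: algebra_simps)
    show "F (D y + D y $ i *\<^sub>R v) = indicator orth y * (ennreal (exp (- (lam \<bullet> y))) * H y)"
      unfolding z_def[symmetric] F_def using 1 2 3 by (simp add: indicator_def)
  qed
  finally show ?thesis unfolding F_def t_def .
qed

text \<open>The parts contribute the summands of \<open>sweep_const w\<close>. The margin is removed
  by a translation by r in the coordinates of positive weight, which changes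
  \<open>lam \<bullet> y\<close> by r times the sum of the weights. The factor \<open>H\<close>
  depends on the other coordinates only and is not affected by any of these maps.\<close>

lemma nn_integral_sweep:
  assumes w: "lam \<bullet> w > 0"
    and H [measurable]: "H \<in> borel_measurable borel" and Hp: "\<And>y. H (proj y) = H y"
  shows "(\<integral>\<^sup>+y. indicator (sweep w r) y * (ennreal (exp (- (lam \<bullet> y))) * H y) \<partial>lborel) =
    ennreal (sweep_const w * exp (- (r * (\<Sum>i\<in>UNIV. lam $ i)))) * (\<integral>\<^sup>+y. indicator orth y * (ennreal (exp (- (lam \<bullet> y))) * H y) \<partial>lborel)"
proof -
  define e :: "real^'n" where "e = (\<chi> i. if 0 < lam $ i then 1 else 0)"
  define b where "b = exp (- (r * (\<Sum>i\<in>UNIV. lam $ i)))"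
  have le: "lam \<bullet> (y + r *\<^sub>R e) = lam \<bullet> y + r * (\<Sum>i\<in>UNIV. lam $ i)" for y
  proof -
    have "lam \<bullet> e = (\<Sum>i\<in>UNIV. lam $ i)" unfolding inner_vec_real e_def
      by (intro sum.cong) (auto simp: lam_not_pos)
    then show ?thesis by (simp add: inner_add_right)
  qed
  define J where "J = (\<integral>\<^sup>+y. indicator orth y * (ennreal (exp (- (lam \<bullet> y))) * H y) \<partial>lborel)"
  define P where "P = {i. 0 < lam $ i \<and> 0 < w $ i}"
  have "(\<integral>\<^sup>+y. indicator (sweep w r) y * (ennreal (exp (- (lam \<bullet> y))) * H y) \<partial>lborel) =
    (\<integral>\<^sup>+y. indicator (sweep w r) (y + r *\<^sub>R e) * (ennreal (exp (- (lam \<bullet> (y + r *\<^sub>R e)))) * H (y + r *\<^sub>R e)) \<partial>lborel)"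
    by (rule nn_integral_lborel_translate[symmetric]) simp
  also have "\<dots> = (\<integral>\<^sup>+y. ennreal b * (indicator (sweep w 0) y * (ennreal (exp (- (lam \<bullet> y))) * H y)) \<partial>lborel)"
  proof (rule nn_integral_cong)
    fix y
    have "proj (y + r *\<^sub>R e) = proj y" by (simp add: proj_def e_def vec_eq_iff)
    then have "H (y + r *\<^sub>R e) = H y" by (metis Hp)
    moreover have "y + r *\<^sub>R e \<in> sweep w r \<longleftrightarrow> y \<in> sweep w 0"
      unfolding sweep_def by (auto simp: e_def)
    moreover have "ennreal (exp (- (lam \<bullet> (y + r *\<^sub>R e)))) = ennreal b * ennreal (exp (- (lam \<bullet> y)))"
      unfolding le b_def by (simp add: ennreal_mult[symmetric] exp_add[symmetric])
    ultimately show "indicator (sweep w r) (y + r *\<^sub>R e) * (ennreal (exp (- (lam \<bullet> (y + r *\<^sub>R e)))) * H (y + r *\<^sub>R e)) =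
      ennreal b * (indicator (sweep w 0) y * (ennreal (exp (- (lam \<bullet> y))) * H y))"
      by (simp add: indicator_def mult_ac)
  qed
  also have "\<dots> = ennreal b * (\<integral>\<^sup>+y. indicator (sweep w 0) y * (ennreal (exp (- (lam \<bullet> y))) * H y) \<partial>lborel)"
    by (rule nn_integral_cmult) simp
  also have "(\<integral>\<^sup>+y. indicator (sweep w 0) y * (ennreal (exp (- (lam \<bullet> y))) * H y) \<partial>lborel) =
    (\<integral>\<^sup>+y. (\<Sum>i\<in>P. indicator (sweep_part w i) y * (ennreal (exp (- (lam \<bullet> y))) * H y)) \<partial>lborel)"
    using sweep_eq_UN_parts[OF w]
    by (intro nn_integral_cong_AE) (auto elim!: eventually_mono simp: P_def sum_distrib_right)
  also have "\<dots> = (\<Sum>i\<in>P. \<integral>\<^sup>+y. indicator (sweep_part w i) y * (ennreal (exp (- (lam \<bullet> y))) * H y) \<partial>lborel)"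
    by (rule nn_integral_sum) simp
  also have "\<dots> = (\<Sum>i\<in>P. ennreal (lam $ i * w $ i / (lam \<bullet> w)) * J)"
    unfolding J_def by (intro sum.cong refl nn_integral_sweep_part w Hp H) (auto simp: P_def)
  also have "\<dots> = (\<Sum>i\<in>P. ennreal (lam $ i * w $ i / (lam \<bullet> w))) * J"
    by (rule sum_distrib_right[symmetric])
  also have "(\<Sum>i\<in>P. ennreal (lam $ i * w $ i / (lam \<bullet> w))) = ennreal (\<Sum>i\<in>P. lam $ i * w $ i / (lam \<bullet> w))"
    using w by (intro sum_ennreal) (auto simp: P_def)
  also have "(\<Sum>i\<in>P. lam $ i * w $ i / (lam \<bullet> w)) = sweep_const w"
  proof -
    have "(\<Sum>i\<in>UNIV. max (lam $ i * w $ i) 0) = (\<Sum>i\<in>P. lam $ i * w $ i)"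
    proof (rule sum.mono_neutral_cong_right)
      show "\<forall>i\<in>UNIV - P. max (lam $ i * w $ i) 0 = 0"
        using lam_not_pos by (force simp: P_def max_def mult_le_0_iff not_less)
    qed (auto simp: P_def)
    then show ?thesis by (simp add: sweep_const_def sum_divide_distrib)
  qed
  finally show ?thesis
    unfolding b_def J_def[symmetric]
    using sweep_const_nonneg[OF w] by (simp add: ennreal_mult mult_ac)
qed

end

subsection \<open>Asymptotics of Gaussian orthant integrals\<close>

lemma nn_integral_exp_finite: "0 < l \<Longrightarrow> (\<integral>\<^sup>+x. ennreal (indicator {0<..} x * exp (- (l * x))) \<partial>lborel) < \<infinity>"
proof -
  assume l: "0 < l"
  interpret prob_space "density lborel (exponential_density l)" by (rule prob_space_exponential_density[OF l])
  have "(\<integral>\<^sup>+x. ennreal (indicator {0<..} x * exp (- (l * x))) \<partial>lborel)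
      \<le> (\<integral>\<^sup>+x. ennreal (1 / l) * ennreal (exponential_density l x) \<partial>lborel)"
  proof (rule nn_integral_mono)
    fix x :: real
    show "ennreal (indicator {0<..} x * exp (- (l * x))) \<le> ennreal (1 / l) * ennreal (exponential_density l x)"
      using l by (auto simp: exponential_density_def ennreal_mult[symmetric] field_simps indicator_def intro!: ennreal_leI)
  qed
  also have "\<dots> = ennreal (1 / l) * (\<integral>\<^sup>+x. ennreal (exponential_density l x) \<partial>lborel)"
    by (rule nn_integral_cmult) simp
  also have "(\<integral>\<^sup>+x. ennreal (exponential_density l x) \<partial>lborel) = 1"
    using emeasure_space_1 by (simp add: emeasure_density)
  finally show ?thesis by (simp add: le_less_trans)
qed

lemma nn_integral_gauss_finite: "0 < a \<Longrightarrow> (\<integral>\<^sup>+x. ennreal (exp (- (a / 2 * (x + c)\<^sup>2))) \<partial>lborel) < \<infinity>"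
proof -
  assume a: "0 < a"
  define s where "s = 1 / sqrt a"
  have s: "s > 0" "s\<^sup>2 = 1 / a" using a by (auto simp: s_def power_divide)
  interpret prob_space "density lborel (normal_density (-c) s)" by (rule prob_space_normal_density[OF s(1)])
  have eq: "exp (- (a / 2 * (x + c)\<^sup>2)) = sqrt (2 * pi * s\<^sup>2) * normal_density (-c) s x" for x
    using a s(1) by (simp add: normal_density_def s(2))
  have "(\<integral>\<^sup>+x. ennreal (exp (- (a / 2 * (x + c)\<^sup>2))) \<partial>lborel) = ennreal (sqrt (2 * pi * s\<^sup>2)) * (\<integral>\<^sup>+x. ennreal (normal_density (-c) s x) \<partial>lborel)"
    unfolding eq by (subst nn_integral_cmult[symmetric]) (auto simp: ennreal_mult)
  also have "(\<integral>\<^sup>+x. ennreal (normal_density (-c) s x) \<partial>lborel) = 1"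
    using emeasure_space_1 by (simp add: emeasure_density)
  finally show ?thesis by simp
qed

text \<open>In the application S is the inverse covariance matrix of X(T), b = a - atil and k = T c.
  Then b \<le> 0 is feasibility of the minimizer, and b_i = 0 for positive weight is complementary
  slackness.\<close>

locale gauss_orthant = orthant_weight lam for lam :: "real^'n" +
  fixes S :: "real^'n^'n" and al :: real and b k :: "real^'n"
  assumes al_pos: "0 < al" and form_ge: "al * (x \<bullet> x) \<le> x \<bullet> (S *v x)"
    and b_nonpos: "b $ i \<le> 0" and b_zero: "0 < lam $ i \<Longrightarrow> b $ i = 0"
begin

text \<open>What remains of the Gaussian density, recentred at u times the minimizer, after the
  constant and the part linear in u are split off.\<close>

definition gform :: "real^'n \<Rightarrow> real" where
  "gform x = exp (- ((x + k) \<bullet> (S *v (x + k)) / 2))"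

text \<open>In the application this is, up to a factor depending on u alone, the probability that
  X(T) - T c - u atil lies in E; see \<open>PT_eq_wt\<close>.\<close>

definition wt :: "real \<Rightarrow> (real^'n) set \<Rightarrow> real" where
  "wt u E = enn2real (\<integral>\<^sup>+x. indicator E x * ennreal (exp (- (u * (lam \<bullet> x))) * gform x) \<partial>lborel)"

text \<open>Under the density in \<^const>\<open>wt\<close>, coordinates of positive weight fluctuate on the scale \<open>1 / u\<close>, the others on
  the scale \<open>1\<close>.\<close>

definition scal :: "real \<Rightarrow> real^'n \<Rightarrow> real^'n" where
  "scal u y = (\<chi> i. (if 0 < lam $ i then 1 / u else 1) * y $ i)"

definition scaled_wt :: "real \<Rightarrow> (real^'n) set \<Rightarrow> real" where
  "scaled_wt u E = (\<integral>y. indicator E (scal u y) * (exp (- (lam \<bullet> y)) * gform (scal u y)) \<partial>lborel)"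

text \<open>A majorant of \<open>gform (scal u y)\<close> that is free of u. It provides decay
  exactly in the coordinates in which \<open>exp (- (lam \<bullet> y))\<close> has none.\<close>

definition gtail :: "real^'n \<Rightarrow> real" where
  "gtail y = exp (- (al / 2 * (\<Sum>j | \<not> 0 < lam $ j. (y $ j + k $ j)\<^sup>2)))"

text \<open>The values x of X(T) - T c - u atil, at distance at most ep u from 0, for which the
  deterministic motion x - (s / u) w exceeds the level with margin r / u at a time T - s / u^2 no
  earlier than T - de; the inequality is multiplied by u.\<close>

definition sweep_event :: "real \<Rightarrow> real^'n \<Rightarrow> real \<Rightarrow> real \<Rightarrow> real \<Rightarrow> (real^'n) set" where
  "sweep_event u w r de ep = {x. norm x \<le> ep * u \<and> (\<exists>s\<in>{0..de * u\<^sup>2}. \<forall>i. u * x $ i > u\<^sup>2 * b $ i + s * w $ i + r)}"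

definition corner :: "real \<Rightarrow> (real^'n) set" where
  "corner u = {x. \<forall>i. x $ i > u * b $ i}"

text \<open>Coordinates of zero weight with an active constraint contribute a factor that is the same in
  numerator and denominator.\<close>

definition tight_pos :: "(real^'n) set" where
  "tight_pos = {y. \<forall>j. \<not> 0 < lam $ j \<and> b $ j = 0 \<longrightarrow> y $ j > 0}"

definition jac :: "real \<Rightarrow> real" where
  "jac u = (\<Prod>i\<in>UNIV. \<bar>if 0 < lam $ i then 1 / u else 1\<bar>)"

lemma gform_cont: "continuous_on UNIV gform"
  unfolding gform_def
  by (intro continuous_intros continuous_on_compose2[OF matrix_vector_mult_linear_continuous_on[of UNIV S]]) auto

lemma measurable_gform [measurable]: "gform \<in> borel_measurable borel"
  by (rule borel_measurable_continuous_onI[OF gform_cont])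

lemma measurable_scal [measurable]: "scal u \<in> borel_measurable borel"
  unfolding scal_def by (intro borel_measurable_continuous_onI continuous_intros)

lemma gtail_cont: "continuous_on UNIV gtail"
  unfolding gtail_def by (intro continuous_intros)

lemma measurable_gtail [measurable]: "gtail \<in> borel_measurable borel"
  by (rule borel_measurable_continuous_onI[OF gtail_cont])

lemma gform_nonneg: "0 \<le> gform x" and gtail_nonneg: "0 \<le> gtail x"
  by (simp_all add: gform_def gtail_def)

lemma open_corner: "open (corner u)"
proof -
  have "corner u = (\<Inter>i\<in>UNIV. {x. x $ i > u * b $ i})" by (auto simp: corner_def)
  moreover have "open \<dots>"
    by (intro ballI open_INT open_Collect_less continuous_intros) auto
  ultimately show ?thesis by simp
qed

lemma open_tight_pos: "open tight_pos"
proof -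
  have "tight_pos = (\<Inter>j\<in>{j. \<not> 0 < lam $ j \<and> b $ j = 0}. {y. y $ j > 0})" by (auto simp: tight_pos_def)
  moreover have "open \<dots>"
    by (intro ballI open_INT open_Collect_less continuous_intros) auto
  ultimately show ?thesis by simp
qed

lemma sweep_event_borel: "sweep_event u w r de ep \<in> sets borel"
proof -
  have eq: "sweep_event u w r de ep = cball 0 (ep * u) \<inter>
     (\<Union>s\<in>{0..de * u\<^sup>2}. \<Inter>i\<in>UNIV. {x. u * x $ i > u\<^sup>2 * b $ i + s * w $ i + r})"
    by (auto simp: sweep_event_def)
  have "open (\<Union>s\<in>{0..de * u\<^sup>2}. \<Inter>i\<in>UNIV. {x. u * x $ i > u\<^sup>2 * b $ i + s * w $ i + r})"
    by (intro ballI open_UN open_INT open_Collect_less continuous_intros) auto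
  then show ?thesis unfolding eq by auto
qed

lemma gauss_borel_sets [measurable]: "corner u \<in> sets borel" "tight_pos \<in> sets borel" "sweep_event u w r de ep \<in> sets borel"
  using open_corner open_tight_pos sweep_event_borel by (auto intro: borel_open)

lemma wt_eq_scaled:
  assumes u: "u > 0" and [measurable]: "E \<in> sets borel"
  shows "wt u E = jac u * scaled_wt u E"
proof -
  have lam: "u * (lam \<bullet> scal u y) = lam \<bullet> y" for y
    unfolding inner_vec_real sum_distrib_left
    by (intro sum.cong) (use u in \<open>auto simp: scal_def dest: lam_not_pos\<close>)
  have "(\<integral>\<^sup>+x. indicator E x * ennreal (exp (- (u * (lam \<bullet> x))) * gform x) \<partial>lborel)
    = ennreal (jac u) * (\<integral>\<^sup>+y. indicator E (scal u y) * ennreal (exp (- (u * (lam \<bullet> scal u y))) * gform (scal u y)) \<partial>lborel)"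
    unfolding jac_def scal_def by (rule nn_integral_lborel_scale) (use u in auto)
  also have "\<dots> = ennreal (jac u) * (\<integral>\<^sup>+y. ennreal (indicator E (scal u y) * (exp (- (lam \<bullet> y)) * gform (scal u y))) \<partial>lborel)"
    unfolding lam by (intro arg_cong2[of _ _ _ _ times] nn_integral_cong refl) (auto simp: indicator_def)
  finally have "wt u E = enn2real \<dots>" unfolding wt_def by simp
  also have "\<dots> = jac u * scaled_wt u E"
    unfolding scaled_wt_def
    by (subst integral_eq_nn_integral) (auto simp: enn2real_mult jac_def prod_nonneg gform_nonneg)
  finally show ?thesis .
qed

text \<open>Ellipticity of S, with the squares of the coordinates of positive weight dropped; the
  scaling leaves the remaining coordinates fixed.\<close>

lemma gform_le_gtail: "gform (scal u y) \<le> gtail y"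
proof -
  let ?x = "scal u y + k"
  have "(\<Sum>j | \<not> 0 < lam $ j. (y $ j + k $ j)\<^sup>2) = (\<Sum>j | \<not> 0 < lam $ j. (?x $ j)\<^sup>2)"
    by (intro sum.cong) (auto simp: scal_def)
  also have "\<dots> \<le> (\<Sum>j\<in>UNIV. (?x $ j)\<^sup>2)" by (intro sum_mono2) auto
  also have "\<dots> = ?x \<bullet> ?x" by (simp add: inner_vec_real power2_eq_square)
  finally have "al * (\<Sum>j | \<not> 0 < lam $ j. (y $ j + k $ j)\<^sup>2) \<le> ?x \<bullet> (S *v ?x)"
    using form_ge[of ?x] al_pos by (meson mult_le_cancel_left_pos order_trans)
  then show ?thesis by (simp add: gform_def gtail_def)
qed

lemma gtail_proj: "gtail (proj y) = gtail y"
  unfolding gtail_def proj_def by (intro arg_cong[of _ _ exp] arg_cong[of _ _ uminus] arg_cong2[of _ _ _ _ times] sum.cong) auto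

text \<open>The integrand is a product over coordinates: exponential on a half-line where the weight
  is positive, Gaussian otherwise.\<close>

lemma nn_integral_orth_gtail: "(\<integral>\<^sup>+y. indicator orth y * (ennreal (exp (- (lam \<bullet> y))) * ennreal (gtail y)) \<partial>lborel) < \<infinity>"
proof -
  define f where "f i = (if 0 < lam $ i then (\<lambda>x. indicator {0<..} x * exp (- (lam $ i * x)))
     else (\<lambda>x. exp (- (al / 2 * (x + k $ i)\<^sup>2))))" for i
  have fm: "f i \<in> borel_measurable borel" and fn: "0 \<le> f i x" for i x
    unfolding f_def by auto
  have "indicator orth y * (ennreal (exp (- (lam \<bullet> y))) * ennreal (gtail y)) = ennreal (\<Prod>i\<in>UNIV. f i (y $ i))" for y
  proof -
    have "(\<Prod>i\<in>UNIV. f i (y $ i)) = (\<Prod>i | 0 < lam $ i. f i (y $ i)) * (\<Prod>i | \<not> 0 < lam $ i. f i (y $ i))"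
      by (subst prod.union_disjoint[symmetric]) (auto intro!: prod.cong)
    also have "(\<Prod>i | \<not> 0 < lam $ i. f i (y $ i)) = gtail y"
      unfolding gtail_def by (simp add: f_def exp_sum[symmetric] sum_negf sum_distrib_left)
    also have "(\<Prod>i | 0 < lam $ i. f i (y $ i)) = indicator orth y * exp (- (lam \<bullet> y))"
    proof (cases "y \<in> orth")
      case True
      then have "(\<Prod>i | 0 < lam $ i. f i (y $ i)) = (\<Prod>i | 0 < lam $ i. exp (- (lam $ i * y $ i)))"
        by (intro prod.cong) (auto simp: f_def orth_def)
      also have "\<dots> = exp (- (\<Sum>i | 0 < lam $ i. lam $ i * y $ i))"
        by (simp add: exp_sum[symmetric] sum_negf)
      also have "(\<Sum>i | 0 < lam $ i. lam $ i * y $ i) = lam \<bullet> y"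
        unfolding inner_vec_real by (intro sum.mono_neutral_left) (auto dest: lam_not_pos)
      finally show ?thesis using True by simp
    next
      case False
      then obtain i where "0 < lam $ i" "\<not> 0 < y $ i" by (auto simp: orth_def)
      then have "(\<Prod>i | 0 < lam $ i. f i (y $ i)) = 0" by (intro prod_zero) (auto simp: f_def)
      with False show ?thesis by simp
    qed
    finally show ?thesis by (auto simp: indicator_def ennreal_mult gtail_nonneg)
  qed
  then have "(\<integral>\<^sup>+y. indicator orth y * (ennreal (exp (- (lam \<bullet> y))) * ennreal (gtail y)) \<partial>lborel)
    = (\<Prod>i\<in>UNIV. \<integral>\<^sup>+x. f i x \<partial>lborel)"
    by (simp add: nn_integral_lborel_prod_vec[of f, OF fm fn])
  also have "\<dots> < \<infinity>"
  proof -
    have "(\<integral>\<^sup>+x. f i x \<partial>lborel) < \<infinity>" for i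
      using nn_integral_gauss_finite[OF al_pos, of "k $ i"] nn_integral_exp_finite[of "lam $ i"]
      by (cases "0 < lam $ i") (simp_all add: f_def)
    then show ?thesis by (simp add: ennreal_prod_eq_top less_top[symmetric] less_imp_neq)
  qed
  finally show ?thesis .
qed

definition orth_gtail :: real where
  "orth_gtail = enn2real (\<integral>\<^sup>+y. indicator orth y * (ennreal (exp (- (lam \<bullet> y))) * ennreal (gtail y)) \<partial>lborel)"

text \<open>The sweep reaches outside every translate of the orthant, but
  \<open>nn_integral_sweep\<close> reduces it to the orthant. The explicit value provides the
  dominating function below and makes the growth in the margin visible.\<close>

lemma gtail_sweep:
  assumes w: "lam \<bullet> w > 0"
  shows "has_bochner_integral lborel (\<lambda>y. indicator (sweep w r) y * (exp (- (lam \<bullet> y)) * gtail y))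
     (sweep_const w * exp (- (r * (\<Sum>i\<in>UNIV. lam $ i))) * orth_gtail)"
proof (rule has_bochner_integral_nn_integral)
  have "(\<integral>\<^sup>+y. ennreal (indicator (sweep w r) y * (exp (- (lam \<bullet> y)) * gtail y)) \<partial>lborel) =
    (\<integral>\<^sup>+y. indicator (sweep w r) y * (ennreal (exp (- (lam \<bullet> y))) * ennreal (gtail y)) \<partial>lborel)"
    by (intro nn_integral_cong) (auto simp: indicator_def ennreal_mult gtail_nonneg)
  also have "\<dots> = ennreal (sweep_const w * exp (- (r * (\<Sum>i\<in>UNIV. lam $ i)))) * 
      (\<integral>\<^sup>+y. indicator orth y * (ennreal (exp (- (lam \<bullet> y))) * ennreal (gtail y)) \<partial>lborel)"
    by (rule nn_integral_sweep[OF w]) (auto simp: gtail_proj)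
  also have "\<dots> = ennreal (sweep_const w * exp (- (r * (\<Sum>i\<in>UNIV. lam $ i))) * orth_gtail)"
    unfolding orth_gtail_def using nn_integral_orth_gtail sweep_const_nonneg[OF w]
    by (simp add: ennreal_mult)
  finally show "(\<integral>\<^sup>+y. ennreal (indicator (sweep w r) y * (exp (- (lam \<bullet> y)) * gtail y)) \<partial>lborel) = \<dots>" .
qed (use sweep_const_nonneg[OF w] in \<open>auto simp: gtail_nonneg orth_gtail_def\<close>)

section \<open>Limits of the scaled integrals\<close>

definition limit_fn :: "(real^'n) set \<Rightarrow> real^'n \<Rightarrow> real" where
  "limit_fn E y = indicator E y * (indicator tight_pos y * (exp (- (lam \<bullet> y)) * gform (proj y)))"

lemma measurable_proj [measurable]: "proj \<in> borel_measurable borel"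
proof -
  have eq: "proj = (\<lambda>y. \<chi> i. (if 0 < lam $ i then 0 else 1) * y $ i)" by (auto simp: proj_def fun_eq_iff vec_eq_iff)
  show ?thesis unfolding eq by (intro borel_measurable_continuous_onI continuous_intros)
qed

lemma measurable_limit_fn [measurable]:
  assumes [measurable]: "E \<in> sets borel"
  shows "limit_fn E \<in> borel_measurable borel"
  unfolding limit_fn_def by measurable

lemma scal_tendsto: "((\<lambda>u. scal u y) \<longlongrightarrow> proj y) at_top"
proof (rule vec_tendstoI)
  fix i
  have "((\<lambda>u. y $ i / u) \<longlongrightarrow> 0) at_top"
    by (intro tendsto_divide_0[OF tendsto_const] filterlim_at_top_imp_at_infinity filterlim_ident)
  then show "((\<lambda>u. scal u y $ i) \<longlongrightarrow> proj y $ i) at_top"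
    by (auto simp: scal_def proj_def)
qed

lemma gform_scal_tendsto: "((\<lambda>u. gform (scal u y)) \<longlongrightarrow> gform (proj y)) at_top"
  using gform_cont scal_tendsto by (metis (no_types) continuous_on_tendsto_compose UNIV_I eventuallyI)

text \<open>Dominated convergence with the majorant of \<open>gtail_sweep\<close>. Off the
  coordinate hyperplanes the indicators are eventually constant in u, so membership is assumed to
  stabilize only there.\<close>

lemma scaled_wt_tendsto:
  fixes E :: "real \<Rightarrow> (real^'n) set"
  assumes w: "lam \<bullet> w > 0" and [measurable]: "\<And>u. E u \<in> sets borel" "F \<in> sets borel"
    and sub: "\<And>u y. u > 0 \<Longrightarrow> scal u y \<in> E u \<Longrightarrow> y \<in> sweep w r"
    and ev: "\<And>y. (\<And>i. y $ i \<noteq> 0) \<Longrightarrow> eventually (\<lambda>u. scal u y \<in> E u \<longleftrightarrow> y \<in> F \<and> y \<in> tight_pos) at_top"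
  shows "((\<lambda>u. scaled_wt u (E u)) \<longlongrightarrow> integral\<^sup>L lborel (limit_fn F)) at_top"
  unfolding scaled_wt_def
proof (rule integral_dominated_convergence_at_top)
  show "integrable lborel (\<lambda>y. indicator (sweep w r) y * (exp (- (lam \<bullet> y)) * gtail y))"
    using gtail_sweep[OF w] by (rule integrable.intros)
  show "\<forall>\<^sub>F u in at_top. AE y in lborel. norm (indicator (E u) (scal u y) * (exp (- (lam \<bullet> y)) * gform (scal u y))) \<le> indicator (sweep w r) y * (exp (- (lam \<bullet> y)) * gtail y)"
    using eventually_gt_at_top[of 0]
  proof eventually_elim
    case (elim u)
    show ?case
    proof (rule AE_I2)
      fix y
      have "norm (indicator (E u) (scal u y) * (exp (- (lam \<bullet> y)) * gform (scal u y))) = indicator (E u) (scal u y) * (exp (- (lam \<bullet> y)) * gform (scal u y))"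
        by (simp add: abs_mult gform_nonneg)
      also have "\<dots> \<le> indicator (sweep w r) y * (exp (- (lam \<bullet> y)) * gtail y)"
        using sub[OF elim, of y] gform_le_gtail[of u y] 
        by (intro mult_mono) (auto simp: indicator_def gform_nonneg)
      finally show "norm (indicator (E u) (scal u y) * (exp (- (lam \<bullet> y)) * gform (scal u y))) \<le> indicator (sweep w r) y * (exp (- (lam \<bullet> y)) * gtail y)" .
    qed
  qed
  have "AE y in (lborel :: (real^'n) measure). \<forall>i\<in>UNIV. y $ i \<noteq> 0"
    by (intro AE_finite_allI AE_lborel_component_neq) auto
  then show "AE y in lborel. ((\<lambda>u. indicator (E u) (scal u y) * (exp (- (lam \<bullet> y)) * gform (scal u y))) \<longlongrightarrow> limit_fn F y) at_top"
  proof eventually_elim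
    case (elim y)
    have "((\<lambda>u. indicator F y * (indicator tight_pos y * (exp (- (lam \<bullet> y)) * gform (scal u y)))) \<longlongrightarrow> limit_fn F y) at_top"
      unfolding limit_fn_def by (intro tendsto_intros gform_scal_tendsto)
    moreover have "eventually (\<lambda>u. scal u y \<in> E u \<longleftrightarrow> y \<in> F \<and> y \<in> tight_pos) at_top"
      by (rule ev) (use elim in auto)
    then have "eventually (\<lambda>u. indicator F y * (indicator tight_pos y * (exp (- (lam \<bullet> y)) * gform (scal u y))) = indicator (E u) (scal u y) * (exp (- (lam \<bullet> y)) * gform (scal u y))) at_top"
      by eventually_elim (auto simp: indicator_def)
    ultimately show ?case by (rule Lim_transform_eventually)
  qed
qed (use assms in measurable)

text \<open>\<open>nn_integral_sweep\<close> with \<open>H\<close> the product of the indicator of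
  \<open>tight_pos\<close> and \<open>gform \<circ> proj\<close>, both of which depend on
  \<open>proj y\<close> only.\<close>

lemma integral_limit_sweep:
  assumes w: "lam \<bullet> w > 0"
  shows "integral\<^sup>L lborel (limit_fn (sweep w r)) = sweep_const w * exp (- (r * (\<Sum>i\<in>UNIV. lam $ i))) * integral\<^sup>L lborel (limit_fn orth)"
proof -
  have eq: "integral\<^sup>L lborel (limit_fn E) = enn2real (\<integral>\<^sup>+y. indicator E y * (ennreal (exp (- (lam \<bullet> y))) * ennreal (indicator tight_pos y * gform (proj y))) \<partial>lborel)"
    if [measurable]: "E \<in> sets borel" for E
  proof (subst integral_eq_nn_integral)
    show "enn2real (\<integral>\<^sup>+ x. ennreal (limit_fn E x) \<partial>lborel) = enn2real (\<integral>\<^sup>+y. indicator E y * (ennreal (exp (- (lam \<bullet> y))) * ennreal (indicator tight_pos y * gform (proj y))) \<partial>lborel)"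
      by (intro arg_cong[of _ _ enn2real] nn_integral_cong) (auto simp: limit_fn_def indicator_def ennreal_mult gform_nonneg)
  qed (auto simp: limit_fn_def gform_nonneg)
  have pp: "proj (proj y) = proj y" for y by (simp add: proj_def vec_eq_iff)
  have tp: "proj y \<in> tight_pos \<longleftrightarrow> y \<in> tight_pos" for y by (auto simp: proj_def tight_pos_def)
  show ?thesis
    unfolding eq[OF borel_sets(1)] eq[OF borel_sets(2)]
    by (subst nn_integral_sweep[OF w]) (auto simp: pp tp indicator_def enn2real_mult sweep_const_nonneg[OF w] mult.assoc)
qed

text \<open>A slack constraint has b_i < 0 and holds once u is large; the tight ones do not depend
  on u > 0 after scaling.\<close>

lemma eventually_corner:
  assumes nz: "\<And>i. y $ i \<noteq> 0"
  shows "eventually (\<lambda>u. scal u y \<in> corner u \<longleftrightarrow> y \<in> orth \<and> y \<in> tight_pos) at_top"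
proof -
  have "eventually (\<lambda>u. scal u y $ i > u * b $ i \<longleftrightarrow> (if 0 < lam $ i \<or> b $ i = 0 then y $ i > 0 else True)) at_top" for i
  proof (cases "0 < lam $ i \<or> b $ i = 0")
    case True
    show ?thesis using eventually_gt_at_top[of "0::real"]
      by eventually_elim (use True b_zero[of i] in \<open>auto simp: scal_def zero_less_divide_iff\<close>)
  next
    case False
    then have "b $ i < 0" using b_nonpos[of i] by simp
    have "eventually (\<lambda>u. u > y $ i / b $ i) at_top" by (rule eventually_gt_at_top)
    then show ?thesis by eventually_elim (use False \<open>b $ i < 0\<close> in \<open>simp add: scal_def field_simps\<close>)
  qed
  then have "eventually (\<lambda>u. \<forall>i\<in>UNIV. scal u y $ i > u * b $ i \<longleftrightarrow> (if 0 < lam $ i \<or> b $ i = 0 then y $ i > 0 else True)) at_top"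
    by (intro eventually_ball_finite) auto
  then show ?thesis
    by eventually_elim (auto simp: corner_def orth_def tight_pos_def)
qed

text \<open>The delicate case is a tight constraint j of zero weight with y_j < 0, which a large s
  could rescue if w_j < 0. But s is bounded independently of u by the constraints of positive
  weight, while u y_j tends to minus infinity.\<close>

lemma eventually_sweep_event:
  assumes w: "lam \<bullet> w > 0" and de: "de > 0" and ep: "ep > 0" and nz: "\<And>i. y $ i \<noteq> 0"
  shows "eventually (\<lambda>u. scal u y \<in> sweep_event u w r de ep \<longleftrightarrow> y \<in> sweep w r \<and> y \<in> tight_pos) at_top"
proof (cases "y \<in> sweep w r")
  case False
  show ?thesis using eventually_gt_at_top[of 0]
  proof eventually_elim
    case (elim u)
    have "scal u y \<notin> sweep_event u w r de ep"
    proof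
      assume "scal u y \<in> sweep_event u w r de ep"
      then obtain s where s: "0 \<le> s" "\<And>i. u * scal u y $ i > u\<^sup>2 * b $ i + s * w $ i + r" by (auto simp: sweep_event_def)
      have "y $ i > s * w $ i + r" if "0 < lam $ i" for i
        using s(2)[of i] that elim b_zero[OF that] by (simp add: scal_def)
      with s(1) False show False by (auto simp: sweep_def)
    qed
    with False show ?case by simp
  qed
next
  case True
  show ?thesis
  proof (cases "y \<in> tight_pos")
    case tp: True
    from True obtain s where s: "s \<ge> 0" "\<And>i. 0 < lam $ i \<Longrightarrow> y $ i > s * w $ i + r" by (auto simp: sweep_def)
    have "eventually (\<lambda>u. u * scal u y $ i > u\<^sup>2 * b $ i + s * w $ i + r) at_top" for i
    proof (cases "0 < lam $ i")
      case True
      show ?thesis using eventually_gt_at_top[of 0]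
        by eventually_elim (use s(2)[OF True] True b_zero[OF True] in \<open>auto simp: scal_def\<close>)
    next
      case False
      have "filterlim (\<lambda>u. u * (y $ i - u * b $ i)) at_top at_top"
      proof (cases "b $ i = 0")
        case True
        then have "y $ i > 0" using tp False by (auto simp: tight_pos_def)
        then show ?thesis unfolding True
          by (simp add: filterlim_ident filterlim_tendsto_pos_mult_at_top[OF tendsto_const] mult.commute[of _ "y $ i"])
      next
        case b: False
        then have "b $ i < 0" using b_nonpos[of i] by simp
        then have "filterlim (\<lambda>u. y $ i + (- b $ i) * u) at_top at_top"
          by (intro filterlim_tendsto_add_at_top[OF tendsto_const] filterlim_tendsto_pos_mult_at_top[OF tendsto_const] filterlim_ident) auto
        then have "filterlim (\<lambda>u. u * (y $ i + (- b $ i) * u)) at_top at_top"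
          by (intro filterlim_at_top_mult_at_top filterlim_ident)
        then show ?thesis by (simp add: mult.commute)
      qed
      then have "eventually (\<lambda>u. u * (y $ i - u * b $ i) > s * w $ i + r) at_top"
        by (simp add: filterlim_at_top_dense)
      then show ?thesis
        by eventually_elim (use False in \<open>simp add: scal_def algebra_simps power2_eq_square\<close>)
    qed
    then have 1: "eventually (\<lambda>u. \<forall>i\<in>UNIV. u * scal u y $ i > u\<^sup>2 * b $ i + s * w $ i + r) at_top"
      by (intro eventually_ball_finite) auto
    have "filterlim (\<lambda>u. de * u\<^sup>2) at_top at_top"
      using de by (intro filterlim_tendsto_pos_mult_at_top[OF tendsto_const] filterlim_pow_at_top filterlim_ident) auto
    then have 2: "eventually (\<lambda>u. de * u\<^sup>2 \<ge> s) at_top" by (simp add: filterlim_at_top)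
    have "filterlim (\<lambda>u. ep * u) at_top at_top"
      using ep by (intro filterlim_tendsto_pos_mult_at_top[OF tendsto_const] filterlim_ident) auto
    then have "eventually (\<lambda>u. ep * u \<ge> norm (proj y) + 1) at_top" by (simp add: filterlim_at_top)
    moreover have "eventually (\<lambda>u. norm (scal u y) < norm (proj y) + 1) at_top"
      using scal_tendsto[of y] by (intro order_tendstoD(2)[OF tendsto_norm]) auto
    ultimately have "eventually (\<lambda>u. norm (scal u y) \<le> ep * u) at_top" by eventually_elim auto
    with 1 2 show ?thesis
      by eventually_elim (use True tp s(1) in \<open>auto simp: sweep_event_def\<close>)
  next
    case ntp: False
    then obtain j where j: "\<not> 0 < lam $ j" "b $ j = 0" "y $ j < 0"
      using nz by (force simp: tight_pos_def not_less order_le_less)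
    \<comment> \<open>Weighting the constraints by \<open>lam\<close> and adding them gives s (lam
      \<bullet> w) + r (sum of lam) \<le> lam \<bullet> y, hence s \<le> sm.\<close>
    define sm where "sm = \<bar>(lam \<bullet> y - r * (\<Sum>i\<in>UNIV. lam $ i)) / (lam \<bullet> w)\<bar>"
    have "filterlim (\<lambda>u. (- y $ j) * u) at_top at_top"
      using j by (intro filterlim_tendsto_pos_mult_at_top[OF tendsto_const] filterlim_ident) auto
    then have "eventually (\<lambda>u. (- y $ j) * u > sm * \<bar>w $ j\<bar> + \<bar>r\<bar>) at_top" by (simp add: filterlim_at_top_dense)
    then show ?thesis using eventually_gt_at_top[of 0]
    proof eventually_elim
      case (elim u)
      have "scal u y \<notin> sweep_event u w r de ep"
      proof
        assume "scal u y \<in> sweep_event u w r de ep"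
        then obtain s where s: "0 \<le> s" "\<And>i. u * scal u y $ i > u\<^sup>2 * b $ i + s * w $ i + r" by (auto simp: sweep_event_def)
        have "lam $ i * (s * w $ i + r) \<le> lam $ i * y $ i" for i
          using s(2)[of i] elim b_zero[of i] lam_not_pos[of i] by (cases "0 < lam $ i") (auto simp: scal_def)
        then have "(\<Sum>i\<in>UNIV. lam $ i * (s * w $ i + r)) \<le> lam \<bullet> y"
          unfolding inner_vec_real by (intro sum_mono)
        moreover have "(\<Sum>i\<in>UNIV. lam $ i * (s * w $ i + r)) = s * (lam \<bullet> w) + r * (\<Sum>i\<in>UNIV. lam $ i)"
          unfolding inner_vec_real sum_distrib_left sum.distrib[symmetric] by (intro sum.cong) (auto simp: algebra_simps)
        ultimately have "s \<le> (lam \<bullet> y - r * (\<Sum>i\<in>UNIV. lam $ i)) / (lam \<bullet> w)" using w by (simp add: field_simps)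
        then have "s \<le> sm" unfolding sm_def by linarith
        then have "s * \<bar>w $ j\<bar> \<le> sm * \<bar>w $ j\<bar>" by (intro mult_right_mono) auto
        moreover have "\<bar>s * w $ j\<bar> = s * \<bar>w $ j\<bar>" using s(1) by (simp add: abs_mult)
        ultimately have "s * w $ j + r \<ge> - (sm * \<bar>w $ j\<bar> + \<bar>r\<bar>)" by linarith
        with s(2)[of j] j elim show False by (auto simp: scal_def mult.commute)
      qed
      with ntp show ?case by simp
    qed
  qed
qed

text \<open>This makes the majorant of \<open>gtail_sweep\<close> available for the corner too: a
  direction with positive inner product with \<open>lam\<close> is required, and \<open>lam\<close>
  itself is one.\<close>

lemma orth_subset_sweep_lam: "orth \<subseteq> sweep lam 0"
  by (auto simp: orth_def sweep_def intro!: exI[of _ 0])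

lemma lam_inner_pos: "lam \<bullet> lam > 0"
  using lam_pos_ex by (auto simp: vec_eq_iff) (metis less_irrefl)

lemma scaled_wt_corner: "((\<lambda>u. scaled_wt u (corner u)) \<longlongrightarrow> integral\<^sup>L lborel (limit_fn orth)) at_top"
proof (rule scaled_wt_tendsto[OF lam_inner_pos])
  fix u y assume u: "(u::real) > 0" and "scal u y \<in> corner u"
  then have "0 < lam $ i \<Longrightarrow> y $ i > 0" for i
    using b_zero[of i] by (auto simp: corner_def scal_def zero_less_divide_iff dest!: spec[of _ i])
  then show "y \<in> sweep lam 0" using orth_subset_sweep_lam by (auto simp: orth_def)
qed (auto intro: eventually_corner)

lemma scal_sweep_eventD:
  assumes "u > 0" "scal u y \<in> sweep_event u w r de ep"
  shows "y \<in> sweep w r"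
proof -
  from assms(2) obtain s where s: "0 \<le> s" "\<And>i. u * scal u y $ i > u\<^sup>2 * b $ i + s * w $ i + r" by (auto simp: sweep_event_def)
  have "y $ i > s * w $ i + r" if "0 < lam $ i" for i
    using s(2)[of i] that assms(1) b_zero[OF that] by (simp add: scal_def)
  with s(1) show ?thesis by (auto simp: sweep_def)
qed

lemma scaled_wt_sweep_event:
  assumes "lam \<bullet> w > 0" "de > 0" "ep > 0"
  shows "((\<lambda>u. scaled_wt u (sweep_event u w r de ep)) \<longlongrightarrow>
     sweep_const w * exp (- (r * (\<Sum>i\<in>UNIV. lam $ i))) * integral\<^sup>L lborel (limit_fn orth)) at_top"
  unfolding integral_limit_sweep[OF assms(1), symmetric]
  by (rule scaled_wt_tendsto[OF assms(1)]) (auto intro: scal_sweep_eventD eventually_sweep_event assms)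

text \<open>This integral is the limiting denominator. Its integrand is positive on the open unit
  box, all of whose points satisfy every sign condition.\<close>

lemma integral_limit_orth_pos: "integral\<^sup>L lborel (limit_fn orth) > 0"
proof -
  have nn: "0 \<le> limit_fn orth y" for y by (simp add: limit_fn_def gform_nonneg)
  have int: "integrable lborel (limit_fn orth)"
  proof (rule Bochner_Integration.integrable_bound)
    show "integrable lborel (\<lambda>y. indicator (sweep lam 0) y * (exp (- (lam \<bullet> y)) * gtail y))"
      using gtail_sweep[OF lam_inner_pos] by (rule integrable.intros)
    show "AE y in lborel. norm (limit_fn orth y) \<le> norm (indicator (sweep lam 0) y * (exp (- (lam \<bullet> y)) * gtail y))"
    proof (rule AE_I2)
      fix y
      have "gform (proj y) \<le> gtail y"
        using gform_scal_tendsto by (rule tendsto_upperbound) (auto simp: gform_le_gtail)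
      then show "norm (limit_fn orth y) \<le> norm (indicator (sweep lam 0) y * (exp (- (lam \<bullet> y)) * gtail y))"
        using orth_subset_sweep_lam by (auto simp: limit_fn_def indicator_def gform_nonneg gtail_nonneg)
    qed
  qed simp
  have "\<not> (integral\<^sup>L lborel (limit_fn orth) = 0)"
  proof
    assume "integral\<^sup>L lborel (limit_fn orth) = 0"
    then have ae: "AE y in lborel. limit_fn orth y = 0"
      using integral_nonneg_eq_0_iff_AE[OF int] nn by simp
    have "box 0 One \<subseteq> {y. limit_fn orth y \<noteq> 0}"
    proof
      fix y :: "real^'n" assume "y \<in> box 0 One"
      then have y: "0 < y $ i" for i
        by (auto simp: mem_box Basis_vec_def inner_axis)
      then show "y \<in> {y. limit_fn orth y \<noteq> 0}"
        by (auto simp: limit_fn_def orth_def tight_pos_def gform_def)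
    qed
    then have "AE y in lborel. y \<notin> box 0 (One :: real^'n)"
      using ae by (auto elim!: eventually_mono)
    then have "emeasure lborel (box 0 (One :: real^'n)) = 0"
      by (subst (asm) AE_iff_measurable[of "box 0 One"]) (auto simp del: emeasure_lborel_box)
    then show False
      by (simp add: emeasure_lborel_box_eq inner_sum_left inner_Basis if_distrib cong: if_cong)
  qed
  moreover have "integral\<^sup>L lborel (limit_fn orth) \<ge> 0" by (rule integral_nonneg_AE) (simp add: nn)
  ultimately show ?thesis by simp
qed

section \<open>Ratios and bounds in the original coordinates\<close>

lemma jac_pos: "u > 0 \<Longrightarrow> jac u > 0"
  unfolding jac_def by (intro prod_pos) auto

lemma wt_ratio:
  assumes "lam \<bullet> w > 0" "de > 0" "ep > 0"
  shows "((\<lambda>u. wt u (sweep_event u w r de ep) / wt u (corner u)) \<longlongrightarrow>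
    sweep_const w * exp (- (r * (\<Sum>i\<in>UNIV. lam $ i)))) at_top"
proof -
  let ?c = "integral\<^sup>L lborel (limit_fn orth)"
  have "((\<lambda>u. scaled_wt u (sweep_event u w r de ep) / scaled_wt u (corner u)) \<longlongrightarrow>
     sweep_const w * exp (- (r * (\<Sum>i\<in>UNIV. lam $ i))) * ?c / ?c) at_top"
    using integral_limit_orth_pos by (intro tendsto_divide scaled_wt_sweep_event scaled_wt_corner assms) auto
  moreover have "eventually (\<lambda>u. scaled_wt u (sweep_event u w r de ep) / scaled_wt u (corner u)
     = wt u (sweep_event u w r de ep) / wt u (corner u)) at_top"
    using eventually_gt_at_top[of 0]
  proof eventually_elim
    case (elim u)
    then show ?case using jac_pos[OF elim] by (simp add: wt_eq_scaled)
  qed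
  ultimately show ?thesis
    using integral_limit_orth_pos by (simp add: Lim_transform_eventually)
qed

text \<open>The threshold for u does not depend on r. This allows the bound to be summed over
  infinitely many margins at one fixed u.\<close>

lemma wt_sweep_event_bound:
  assumes w: "lam \<bullet> w > 0"
  shows "\<exists>K>0. eventually (\<lambda>u. \<forall>r\<ge>0. \<forall>de ep. wt u (sweep_event u w (- r) de ep)
      \<le> K * exp (r * (\<Sum>i\<in>UNIV. lam $ i)) * wt u (corner u)) at_top"
proof -
  define c where "c = integral\<^sup>L lborel (limit_fn orth)"
  have c: "c > 0" using integral_limit_orth_pos by (simp add: c_def)
  \<comment> \<open>The 2 comes from the lower bound c / 2 for the scaled weight of the corner;
    adding 1 makes K positive.\<close>
  define K where "K = 2 * (sweep_const w * orth_gtail + 1) / c"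
  have og: "0 \<le> sweep_const w * orth_gtail"
    using sweep_const_nonneg[OF w] by (simp add: orth_gtail_def)
  then have K: "K > 0" unfolding K_def using c by simp
  have "eventually (\<lambda>u. scaled_wt u (corner u) > c / 2) at_top"
    using scaled_wt_corner c unfolding c_def[symmetric] by (intro order_tendstoD(1)) auto
  then have "eventually (\<lambda>u. \<forall>r\<ge>0. \<forall>de ep. wt u (sweep_event u w (- r) de ep)
      \<le> K * exp (r * (\<Sum>i\<in>UNIV. lam $ i)) * wt u (corner u)) at_top"
    using eventually_gt_at_top[of 0]
  proof eventually_elim
    case (elim u)
    show ?case
    proof (intro allI impI)
      fix r de ep :: real
      let ?E = "exp (r * (\<Sum>i\<in>UNIV. lam $ i))"
      note hb = gtail_sweep[OF w, of "- r"]
      have "scaled_wt u (sweep_event u w (- r) de ep) \<le> (\<integral>y. indicator (sweep w (- r)) y * (exp (- (lam \<bullet> y)) * gtail y) \<partial>lborel)"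
        unfolding scaled_wt_def
      proof (rule integral_mono')
        show "integrable lborel (\<lambda>y. indicator (sweep w (- r)) y * (exp (- (lam \<bullet> y)) * gtail y))"
          using hb by (rule integrable.intros)
        fix y
        show "indicator (sweep_event u w (- r) de ep) (scal u y) * (exp (- (lam \<bullet> y)) * gform (scal u y))
          \<le> indicator (sweep w (- r)) y * (exp (- (lam \<bullet> y)) * gtail y)"
          using scal_sweep_eventD[OF elim(2)] gform_le_gtail[of u y]
          by (intro mult_mono) (auto simp: indicator_def gform_nonneg)
      qed (simp add: gtail_nonneg)
      also have "\<dots> = sweep_const w * orth_gtail * ?E"
        using hb by (simp add: has_bochner_integral_integral_eq mult_ac)
      also have "\<dots> \<le> (sweep_const w * orth_gtail + 1) * ?E" by simp
      also have "\<dots> = K * ?E * (c / 2)" unfolding K_def using c by simp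
      also have "\<dots> \<le> K * ?E * scaled_wt u (corner u)"
        using elim(1) K by (intro mult_left_mono) auto
      finally have "jac u * scaled_wt u (sweep_event u w (- r) de ep) \<le> jac u * (K * ?E * scaled_wt u (corner u))"
        using jac_pos[OF elim(2)] by (intro mult_left_mono) auto
      then show "wt u (sweep_event u w (- r) de ep) \<le> K * ?E * wt u (corner u)"
        using elim(2) by (simp add: wt_eq_scaled mult_ac)
    qed
  qed
  with K show ?thesis by blast
qed

text \<open>The Jacobian of \<open>scal u\<close> is at least u^(-d) for u \<ge> 1. A polynomial
  lower bound suffices, since it is compared with exponentially small terms only.\<close>

lemma wt_corner_lower: "\<exists>K>0. eventually (\<lambda>u. K / u ^ CARD('n) \<le> wt u (corner u)) at_top"
proof -
  define c where "c = integral\<^sup>L lborel (limit_fn orth)"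
  have c: "c > 0" using integral_limit_orth_pos by (simp add: c_def)
  have "eventually (\<lambda>u. scaled_wt u (corner u) > c / 2) at_top"
    using scaled_wt_corner c unfolding c_def[symmetric] by (intro order_tendstoD(1)) auto
  then have "eventually (\<lambda>u. (c / 2) / u ^ CARD('n) \<le> wt u (corner u)) at_top"
    using eventually_ge_at_top[of 1]
  proof eventually_elim
    case (elim u)
    have "(1 / u) ^ CARD('n) = (\<Prod>i\<in>(UNIV::'n set). 1 / u)" by simp
    also have "\<dots> \<le> jac u" unfolding jac_def using elim by (intro prod_mono) auto
    finally have "(1 / u) ^ CARD('n) * (c / 2) \<le> jac u * scaled_wt u (corner u)"
      using elim c jac_pos[of u] by (intro mult_mono) auto
    then show ?case using elim by (simp add: wt_eq_scaled power_one_over)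
  qed
  then show ?thesis using c by (intro exI[of _ "c/2"]) auto
qed

end

subsection \<open>Dyadic chaining\<close>

lemma (in prob_space) prob_UN_geometric:
  fixes B :: "nat \<Rightarrow> 'a set"
  assumes B: "\<And>n. B n \<in> events" and le: "\<And>n. prob (B n) \<le> c * (1/2) ^ n"
  shows "prob (\<Union>n. B n) \<le> 2 * c"
proof -
  have sm: "summable (\<lambda>n. c * (1/2) ^ n)" by (intro summable_mult summable_geometric) auto
  have sm2: "summable (\<lambda>n. prob (B n))" by (rule summable_comparison_test'[OF sm]) (use le in auto)
  have "prob (\<Union>n. B n) \<le> (\<Sum>n. prob (B n))"
    by (rule finite_measure_subadditive_countably) (use B sm2 in auto)
  also have "\<dots> \<le> (\<Sum>n. c * (1/2) ^ n)" by (rule suminf_le[OF le sm2 sm])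
  also have "\<dots> = 2 * c" by (subst suminf_mult) (auto simp: suminf_geometric)
  finally show ?thesis .
qed

text \<open>The constant \<open>4^8\<close> makes the bound trivial unless the exponent is large enough for the
  union bound over the dyadic increments to be a convergent geometric series.\<close>

lemma (in prob_space) dyadic_chaining:
  fixes W :: "real \<Rightarrow> 'a \<Rightarrow> real"
  assumes pos: "L > 0" "K > 0" "x > 0" and G: "G \<in> events"
    and meas: "\<And>t. t \<in> {0..L} \<Longrightarrow> W t \<in> borel_measurable M"
    and tail: "\<And>s t y. 0 \<le> s \<Longrightarrow> s < t \<Longrightarrow> t \<le> L \<Longrightarrow> 0 < y \<Longrightarrow>
       prob {\<omega> \<in> G. \<bar>W t \<omega> - W s \<omega>\<bar> > y} \<le> 2 * exp (- (y\<^sup>2 / (2 * K * (t - s)))) * prob G"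
    and cont: "AE \<omega> in M. continuous_on {0..L} (\<lambda>t. W t \<omega>)"
  shows "\<exists>D\<in>events. prob D \<le> 4 ^ 8 * exp (- (x\<^sup>2 / (32 * K * L))) * prob G \<and>
     (AE \<omega> in M. \<omega> \<in> G \<longrightarrow> \<omega> \<notin> D \<longrightarrow> (\<forall>t\<in>{0..L}. \<bar>W t \<omega> - W 0 \<omega>\<bar> \<le> x))"
proof (cases "x\<^sup>2 / (32 * K * L) \<le> 8 * ln 4")
  case True
  have "exp (- (8 * ln 4)) \<le> exp (- (x\<^sup>2 / (32 * K * L)))" using True by simp
  moreover have "exp (- (8 * ln (4::real))) = 1 / 4 ^ 8"
  proof -
    have "exp (8 * ln (4::real)) = 4 ^ 8" by (metis exp_ln exp_of_nat_mult of_nat_numeral zero_less_numeral)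
    then show ?thesis by (simp add: exp_minus inverse_eq_divide)
  qed
  ultimately have "1 * prob G \<le> 4 ^ 8 * exp (- (x\<^sup>2 / (32 * K * L))) * prob G"
    by (intro mult_right_mono) auto
  then show ?thesis using G by (intro bexI[of _ G]) auto
next
  case False
  define be where "be = x\<^sup>2 / (32 * K * L)"
  \<comment> \<open>The allowances sum to x because 1 / (1 - 3/4) = 4. The squared ratio 9/16 times
    the factor 2 gained from halving the time step is 9/8 > 1, so the tail exponents grow
    geometrically in k.\<close>
  define y where "y k = x / 4 * (3/4) ^ k" for k :: nat
  define B where "B k j = {\<omega> \<in> G. \<bar>W (L * real (Suc j) / 2 ^ k) \<omega> - W (L * real j / 2 ^ k) \<omega>\<bar> > y k}" for k j :: nat
  define D where "D = (\<Union>k. \<Union>j<2 ^ k. B k j)"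
  have in0L: "L * real j / 2 ^ k \<in> {0..L}" if "j \<le> 2 ^ k" for j k :: nat
  proof -
    have "real j \<le> real (2 ^ k)" using that of_nat_mono by blast
    then show ?thesis using pos by (simp add: field_simps)
  qed
  have Bev: "B k j \<in> events" if "j < 2 ^ k" for k j
  proof -
    have [measurable]: "W (L * real (Suc j) / 2 ^ k) \<in> borel_measurable M" "W (L * real j / 2 ^ k) \<in> borel_measurable M" 
      using that by (intro meas in0L; simp)+
    have "B k j = G \<inter> {\<omega> \<in> space M. \<bar>W (L * real (Suc j) / 2 ^ k) \<omega> - W (L * real j / 2 ^ k) \<omega>\<bar> > y k}"
      using sets.sets_into_space[OF G] by (auto simp: B_def)
    also have "\<dots> \<in> events" by (intro sets.Int G) measurable
    finally show ?thesis .
  qed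
  have ev: "(\<Union>j<2 ^ k. B k j) \<in> events" for k using Bev by auto
  have Dev: "D \<in> events" unfolding D_def using ev by auto
  have pB: "prob (B k j) \<le> 2 * exp (- (be * (9/8) ^ k)) * prob G" if "j < 2 ^ k" for k j
  proof -
    have d: "L * real (Suc j) / 2 ^ k - L * real j / 2 ^ k = L / 2 ^ k" by (simp add: field_simps)
    have "prob (B k j) \<le> 2 * exp (- ((y k)\<^sup>2 / (2 * K * (L / 2 ^ k)))) * prob G"
      unfolding B_def d[symmetric] using in0L[of j k] in0L[of "Suc j" k] that pos
      by (intro tail) (auto simp: y_def divide_strict_right_mono)
    also have "(y k)\<^sup>2 / (2 * K * (L / 2 ^ k)) = be * (((3/4) ^ k)\<^sup>2 * 2 ^ k)"
      unfolding y_def be_def using pos by (simp add: field_simps power2_eq_square)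
    also have "((3/4) ^ k)\<^sup>2 * 2 ^ k = ((9/8)::real) ^ k"
      by (simp add: power_mult_distrib[symmetric] power2_eq_square)
    finally show ?thesis .
  qed
  have be: "be > 8 * ln 4" using False by (simp add: be_def)
  \<comment> \<open>The factor 2 accounts for the doubling of the number of increments from one
    level to the next.\<close>
  have half: "2 * exp (- (be / 8)) \<le> 1 / 2"
  proof -
    have "exp (- (be / 8)) \<le> exp (- ln (4::real))" using be by simp
    also have "\<dots> = 1 / 4" by (simp add: exp_minus)
    finally show ?thesis by simp
  qed
  have pk: "prob (\<Union>j<2 ^ k. B k j) \<le> 2 * exp (- be) * prob G * (1/2) ^ k" for k
  proof -
    \<comment> \<open>Replacing the geometric growth of the exponent by its linear lower bound is
      enough to get a geometric series.\<close>
    have bern: "1 + real k / 8 \<le> (9/8) ^ k"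
      using Bernoulli_inequality[of "1/8" k] by simp
    have "be > 0" using be by (smt (verit) ln_gt_zero)
    have "prob (\<Union>j<2 ^ k. B k j) \<le> (\<Sum>j<2 ^ k. prob (B k j))"
      by (intro finite_measure_subadditive_finite) (auto simp: Bev)
    also have "\<dots> \<le> (\<Sum>j<(2::nat) ^ k. 2 * exp (- (be * (9/8) ^ k)) * prob G)"
      by (intro sum_mono pB) auto
    also have "\<dots> = 2 ^ k * (2 * exp (- (be * (9/8) ^ k)) * prob G)" by simp
    also have "\<dots> \<le> 2 ^ k * (2 * exp (- (be * (1 + real k / 8))) * prob G)"
      using bern \<open>be > 0\<close> by (intro mult_left_mono mult_right_mono) auto
    also have "exp (- (be * (1 + real k / 8))) = exp (- be) * exp (- (be / 8)) ^ k"
      by (simp add: exp_of_nat_mult[symmetric] exp_add[symmetric] algebra_simps)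
    also have "2 ^ k * (2 * (exp (- be) * exp (- (be / 8)) ^ k) * prob G) = 2 * exp (- be) * prob G * (2 * exp (- (be / 8))) ^ k"
      by (simp add: power_mult_distrib)
    also have "\<dots> \<le> 2 * exp (- be) * prob G * (1 / 2) ^ k"
      using half by (intro mult_left_mono power_mono) auto
    finally show ?thesis by simp
  qed
  have "prob D \<le> 2 * (2 * exp (- be) * prob G)"
    unfolding D_def by (rule prob_UN_geometric[OF ev pk])
  also have "\<dots> \<le> 4 ^ 8 * exp (- be) * prob G"
    by (simp add: mult_right_mono)
  finally have pD: "prob D \<le> 4 ^ 8 * exp (- be) * prob G" .
  have "AE \<omega> in M. \<omega> \<in> G \<longrightarrow> \<omega> \<notin> D \<longrightarrow> (\<forall>t\<in>{0..L}. \<bar>W t \<omega> - W 0 \<omega>\<bar> \<le> x)"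
    using cont
  proof (eventually_elim, intro impI ballI)
    fix \<omega> t assume c: "continuous_on {0..L} (\<lambda>t. W t \<omega>)" and w: "\<omega> \<in> G" "\<omega> \<notin> D" and t: "t \<in> {0..L}"
    have inc: "\<bar>W (L * real (Suc j) / 2 ^ k) \<omega> - W (L * real j / 2 ^ k) \<omega>\<bar> \<le> y k" if "j < 2 ^ k" for j k
    proof -
      have "\<omega> \<notin> B k j" using w that unfolding D_def by blast
      then show ?thesis using w by (auto simp: B_def not_less)
    qed
    \<comment> \<open>A dyadic point of level n + 1 either has level n or is the right neighbour of
      a point of level n, at the cost of one increment.\<close>
    have dy: "\<bar>W (L * real j / 2 ^ n) \<omega> - W 0 \<omega>\<bar> \<le> (\<Sum>k\<le>n. y k)" if "j \<le> 2 ^ n" for j n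
      using that
    proof (induction n arbitrary: j)
      case 0
      then have "j = 0 \<or> j = 1" by auto
      moreover have "0 \<le> y 0" using pos by (simp add: y_def)
      ultimately show ?case using inc[of 0 0] by auto
    next
      case (Suc n)
      have yn: "0 \<le> y (Suc n)" using pos by (simp add: y_def)
      define i where "i = j div 2"
      have i: "i \<le> 2 ^ n" using Suc.prems by (auto simp: i_def)
      have IH: "\<bar>W (L * real (2 * i) / 2 ^ Suc n) \<omega> - W 0 \<omega>\<bar> \<le> (\<Sum>k\<le>n. y k)"
        using Suc.IH[OF i] by (simp add: field_simps)
      show ?case
      proof (cases "even j")
        case True
        then have "j = 2 * i" by (simp add: i_def)
        with IH yn show ?thesis by simp
      next
        case False
        then have j: "j = Suc (2 * i)" by (simp add: i_def)
        then have "2 * i < 2 ^ Suc n" using Suc.prems by simp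
        from inc[OF this] IH show ?thesis unfolding j by (simp del: power_Suc)
      qed
    qed
    have ys: "(\<Sum>k\<le>n. y k) \<le> x" for n
    proof -
      have "(\<Sum>k\<le>n. y k) = x / 4 * (\<Sum>k\<le>n. (3/4) ^ k)" unfolding y_def by (simp add: sum_distrib_left)
      also have "(\<Sum>k\<le>n. (3/4) ^ k) = (1 - (3/4) ^ Suc n) / (1 - (3/4 :: real))"
        by (subst sum_gp0) auto
      also have "x / 4 * ((1 - (3/4) ^ Suc n) / (1 - (3/4 :: real))) = x * (1 - (3/4) ^ Suc n)" by simp
      also have "\<dots> \<le> x * 1" using pos by (intro mult_left_mono) auto
      finally show ?thesis by simp
    qed
    \<comment> \<open>Dyadic points converging to t from the left; path continuity carries the bound
      over to t.\<close>
    define j where "j n = nat \<lfloor>2 ^ n * (t / L)\<rfloor>" for n :: nat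
    have tL: "0 \<le> t / L" "t / L \<le> 1" using t pos by auto
    have rj: "real (j n) = of_int \<lfloor>2 ^ n * (t / L)\<rfloor>" for n
    proof -
      have "0 \<le> 2 ^ n * (t / L)" using tL by (intro mult_nonneg_nonneg) auto
      then show ?thesis unfolding j_def by (simp del: times_divide_eq_right)
    qed
    have jle: "j n \<le> 2 ^ n" for n
    proof -
      have "2 ^ n * (t / L) \<le> 2 ^ n * 1" using tL by (intro mult_left_mono) auto
      then have "real (j n) \<le> 2 ^ n" unfolding rj by linarith
      then show ?thesis by (metis of_nat_le_iff of_nat_numeral of_nat_power)
    qed
    define s where "s n = L * real (j n) / 2 ^ n" for n
    have "s \<longlonglongrightarrow> t"
    proof (rule tendsto_sandwich)
      have f: "2 ^ n * (t / L) - 1 \<le> real (j n)" "real (j n) \<le> 2 ^ n * (t / L)" for n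
        unfolding rj by linarith+
      show "\<forall>\<^sub>F n in sequentially. t - L * (1/2) ^ n \<le> s n"
      proof (rule always_eventually, rule allI)
        fix n
        have "L * (2 ^ n * (t / L) - 1) / 2 ^ n \<le> s n" unfolding s_def using f(1)[of n] pos
          by (intro divide_right_mono mult_left_mono) auto
        also have "L * (2 ^ n * (t / L) - 1) / 2 ^ n = t - L * (1/2) ^ n"
          using pos by (simp add: field_simps power_one_over)
        finally show "t - L * (1/2) ^ n \<le> s n" .
      qed
      show "\<forall>\<^sub>F n in sequentially. s n \<le> t"
      proof (rule always_eventually, rule allI)
        fix n
        have "s n \<le> L * (2 ^ n * (t / L)) / 2 ^ n" unfolding s_def using f(2)[of n] pos
          by (intro divide_right_mono mult_left_mono) auto
        also have "L * (2 ^ n * (t / L)) / 2 ^ n = t" using pos by simp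
        finally show "s n \<le> t" .
      qed
      have "(\<lambda>n. t - L * (1/2) ^ n) \<longlonglongrightarrow> t - L * 0"
        by (intro tendsto_intros LIMSEQ_power_zero) auto
      then show "(\<lambda>n. t - L * (1/2) ^ n) \<longlonglongrightarrow> t" by simp
    qed simp
    moreover have "s n \<in> {0..L}" for n unfolding s_def by (rule in0L[OF jle])
    ultimately have "(\<lambda>n. W (s n) \<omega>) \<longlonglongrightarrow> W t \<omega>"
      by (intro continuous_on_tendsto_compose[OF c _ t]) auto
    then have "(\<lambda>n. \<bar>W (s n) \<omega> - W 0 \<omega>\<bar>) \<longlonglongrightarrow> \<bar>W t \<omega> - W 0 \<omega>\<bar>" by (intro tendsto_intros)
    moreover have "\<bar>W (s n) \<omega> - W 0 \<omega>\<bar> \<le> x" for n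
      unfolding s_def using dy[OF jle] ys order_trans by blast
    ultimately show "\<bar>W t \<omega> - W 0 \<omega>\<bar> \<le> x"
      by (intro tendsto_upperbound[of _ _ sequentially]) auto
  qed
  with Dev pD show ?thesis unfolding be_def by blast
qed

subsection \<open>Centered Gaussian variables\<close>

context prob_space begin

lemma gaussian_rv_centered_cases:
  assumes g: "gaussian_rv M X" and m: "expectation X = 0"
  obtains (deg) "AE \<omega> in M. X \<omega> = 0" "expectation (\<lambda>\<omega>. (X \<omega>)\<^sup>2) = 0"
  | (normal) s where "s > 0" "distributed M lborel X (normal_density 0 s)" "expectation (\<lambda>\<omega>. (X \<omega>)\<^sup>2) = s\<^sup>2"
proof -
  from g have [measurable]: "X \<in> borel_measurable M" by (simp add: gaussian_rv_def)
  from g consider c where "AE \<omega> in M. X \<omega> = c" | c s where "s > 0" "distributed M lborel X (normal_density c s)"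
    by (auto simp: gaussian_rv_def)
  then show thesis
  proof cases
    case 1
    then have "expectation X = expectation (\<lambda>_. c)" by (intro integral_cong_AE) auto
    with m have c: "c = 0" by (simp add: prob_space)
    have "expectation (\<lambda>\<omega>. (X \<omega>)\<^sup>2) = expectation (\<lambda>_. 0)"
      using 1 c by (intro integral_cong_AE) (auto elim!: eventually_mono)
    then show ?thesis using 1 c deg by auto
  next
    case 2
    then have "c = 0" using normal_distributed_expectation m by metis
    moreover have "variance X = s\<^sup>2" using normal_distributed_variance 2 by blast
    ultimately show ?thesis using 2 normal m by auto
  qed
qed

lemma gaussian_rv_integrable_square:
  assumes g: "gaussian_rv M X" and m: "expectation X = 0"
  shows "integrable M (\<lambda>\<omega>. (X \<omega>)\<^sup>2)"
  using g m
proof (cases rule: gaussian_rv_centered_cases)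
  case deg
  have [measurable]: "X \<in> borel_measurable M" using g by (simp add: gaussian_rv_def)
  show ?thesis by (rule integrable_cong_AE_imp[of _ "\<lambda>_. 0"]) (use deg in \<open>auto elim!: eventually_mono\<close>)
next
  case (normal s)
  have "integrable lborel (\<lambda>x. normal_density 0 s x * (x - 0) ^ 2)" by (rule integrable_normal_moment[OF normal(1)])
  then show ?thesis using distributed_integrable[OF normal(2), of "\<lambda>x. x\<^sup>2"] by simp
qed

lemma gaussian_rv_exp_moment:
  assumes g: "gaussian_rv M X" and m: "expectation X = 0"
  shows "integrable M (\<lambda>\<omega>. exp (a * X \<omega>))"
    and "expectation (\<lambda>\<omega>. exp (a * X \<omega>)) = exp (a\<^sup>2 * expectation (\<lambda>\<omega>. (X \<omega>)\<^sup>2) / 2)"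
proof -
  have "integrable M (\<lambda>\<omega>. exp (a * X \<omega>)) \<and> expectation (\<lambda>\<omega>. exp (a * X \<omega>)) = exp (a\<^sup>2 * expectation (\<lambda>\<omega>. (X \<omega>)\<^sup>2) / 2)"
    using g m
  proof (cases rule: gaussian_rv_centered_cases)
    case deg
    have [measurable]: "X \<in> borel_measurable M" using g by (simp add: gaussian_rv_def)
    have "AE \<omega> in M. exp (a * X \<omega>) = 1" using deg by (auto elim!: eventually_mono)
    then have "expectation (\<lambda>\<omega>. exp (a * X \<omega>)) = expectation (\<lambda>_. 1)"
      by (intro integral_cong_AE) auto
    moreover have "integrable M (\<lambda>\<omega>. exp (a * X \<omega>))"
      by (rule integrable_cong_AE_imp[of _ "\<lambda>_. 1"]) (use \<open>AE \<omega> in M. exp (a * X \<omega>) = 1\<close> in \<open>auto elim!: eventually_mono\<close>)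
    ultimately show ?thesis by (simp add: deg prob_space)
  next
    case (normal s)
    have eq: "normal_density 0 s x * exp (a * x) = exp (a\<^sup>2 * s\<^sup>2 / 2) * normal_density (a * s\<^sup>2) s x" for x
    proof -
      have "- (x\<^sup>2 / (2 * s\<^sup>2)) + a * x = a\<^sup>2 * s\<^sup>2 / 2 + - ((x - a * s\<^sup>2)\<^sup>2 / (2 * s\<^sup>2))"
        using normal(1) by (simp add: field_simps power2_eq_square)
      then have "exp (- (x\<^sup>2 / (2 * s\<^sup>2))) * exp (a * x) = exp (a\<^sup>2 * s\<^sup>2 / 2) * exp (- ((x - a * s\<^sup>2)\<^sup>2 / (2 * s\<^sup>2)))"
        by (simp add: exp_add[symmetric])
      then show ?thesis by (simp add: normal_density_def)
    qed
    have "integrable lborel (\<lambda>x. normal_density 0 s x * exp (a * x))"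
      unfolding eq using normal(1) by simp
    moreover have "(\<integral>x. normal_density 0 s x * exp (a * x) \<partial>lborel) = exp (a\<^sup>2 * s\<^sup>2 / 2)"
      unfolding eq using normal(1) by simp
    ultimately show ?thesis
      using distributed_integrable[OF normal(2), of "\<lambda>x. exp (a * x)"] distributed_integral[OF normal(2), of "\<lambda>x. exp (a * x)"]
      by (simp add: normal)
  qed
  then show "integrable M (\<lambda>\<omega>. exp (a * X \<omega>))"
    and "expectation (\<lambda>\<omega>. exp (a * X \<omega>)) = exp (a\<^sup>2 * expectation (\<lambda>\<omega>. (X \<omega>)\<^sup>2) / 2)" by auto
qed

lemma gaussian_rv_char:
  assumes g: "gaussian_rv M X" and m: "expectation X = 0"
  shows "(CLINT \<omega>|M. iexp (X \<omega>)) = complex_of_real (exp (- (expectation (\<lambda>\<omega>. (X \<omega>)\<^sup>2) / 2)))"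
  using g m
proof (cases rule: gaussian_rv_centered_cases)
  case deg
  have [measurable]: "X \<in> borel_measurable M" using g by (simp add: gaussian_rv_def)
  have "(CLINT \<omega>|M. iexp (X \<omega>)) = (CLINT \<omega>|M. 1)"
    using deg by (intro integral_cong_AE) (auto elim!: eventually_mono)
  then show ?thesis by (simp add: deg prob_space)
next
  case (normal s)
  have "distributed M lborel (\<lambda>x. X x / s) std_normal_density"
    using normal_standard_normal_convert[of s X 0] normal by simp
  then have d: "distr M lborel (\<lambda>x. X x / s) = density lborel (\<lambda>x. ennreal (std_normal_density x))"
    and [measurable]: "(\<lambda>x. X x / s) \<in> M \<rightarrow>\<^sub>M lborel"
    by (auto simp: distributed_def)
  have [measurable]: "(\<lambda>x. X x / s) \<in> borel_measurable M" using \<open>(\<lambda>x. X x / s) \<in> M \<rightarrow>\<^sub>M lborel\<close> by simp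
  have "(CLINT \<omega>|M. iexp (X \<omega>)) = (CLINT \<omega>|M. iexp (s * (X \<omega> / s)))" using normal(1) by simp
  also have "\<dots> = (CLINT x|distr M lborel (\<lambda>x. X x / s). iexp (s * x))"
    by (subst integral_distr) auto
  also have "\<dots> = char std_normal_distribution s" unfolding d char_def ..
  also have "\<dots> = complex_of_real (exp (- (s^2) / 2))" by (simp add: char_std_normal_distribution)
  finally show ?thesis by (simp add: normal)
qed

text \<open>Chernoff bound. Only an upper bound s for the variance enters, and the exponential
  moment formula covers degenerate variables too.\<close>

lemma gaussian_rv_tail:
  assumes g: "gaussian_rv M X" and m: "expectation X = 0" and s: "expectation (\<lambda>\<omega>. (X \<omega>)\<^sup>2) \<le> s" "s > 0" and x: "x > 0"
  shows "prob {\<omega> \<in> space M. \<bar>X \<omega>\<bar> > x} \<le> 2 * exp (- (x\<^sup>2 / (2 * s)))"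
proof -
  have [measurable]: "X \<in> borel_measurable M" using g by (simp add: gaussian_rv_def)
  have one: "prob {\<omega> \<in> space M. d * X \<omega> > x} \<le> exp (- (x\<^sup>2 / (2 * s)))" if d: "d\<^sup>2 = 1" for d
  proof -
    \<comment> \<open>The minimizer of a^2 s / 2 - a x.\<close>
    define a where "a = x / s"
    have a: "a > 0" using x s by (simp add: a_def)
    have "prob {\<omega> \<in> space M. d * X \<omega> > x} \<le> prob {\<omega> \<in> space M. exp (a * d * X \<omega>) \<ge> exp (a * x)}"
      using a by (intro finite_measure_mono) (auto simp: mult.assoc)
    also have "\<dots> \<le> expectation (\<lambda>\<omega>. exp (a * d * X \<omega>)) / exp (a * x)"
      by (rule integral_Markov_inequality_measure[where A="{}"]) (auto intro: gaussian_rv_exp_moment[OF g m])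
    also have "\<dots> = exp ((a * d)\<^sup>2 * expectation (\<lambda>\<omega>. (X \<omega>)\<^sup>2) / 2 - a * x)"
      by (simp add: gaussian_rv_exp_moment(2)[OF g m] exp_diff)
    also have "\<dots> \<le> exp (a\<^sup>2 * s / 2 - a * x)"
      using s d by (simp add: power_mult_distrib mult_left_mono)
    also have "a\<^sup>2 * s / 2 - a * x = - (x\<^sup>2 / (2 * s))"
      unfolding a_def using s by (simp add: field_simps power2_eq_square)
    finally show ?thesis .
  qed
  have "{\<omega> \<in> space M. \<bar>X \<omega>\<bar> > x} = {\<omega> \<in> space M. 1 * X \<omega> > x} \<union> {\<omega> \<in> space M. (-1) * X \<omega> > x}" by auto
  then have "prob {\<omega> \<in> space M. \<bar>X \<omega>\<bar> > x} \<le> prob {\<omega> \<in> space M. 1 * X \<omega> > x} + prob {\<omega> \<in> space M. (-1) * X \<omega> > x}"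
    by (simp only:) (rule measure_Un_le; measurable)
  also have "\<dots> \<le> exp (- (x\<^sup>2 / (2 * s))) + exp (- (x\<^sup>2 / (2 * s)))"
    by (intro add_mono one) auto
  finally show ?thesis by simp
qed

text \<open>The probability measure with density \<open>h / E h\<close> gives \<open>X\<close> the same characteristic function as \<open>M\<close> does.\<close>

lemma weighted_law_eq:
  fixes X h :: "'a \<Rightarrow> real"
  assumes [measurable]: "X \<in> borel_measurable M" "h \<in> borel_measurable M"
    and h0: "\<And>\<omega>. 0 \<le> h \<omega>" and hint: "integrable M h" and hpos: "expectation h > 0"
    and char: "\<And>t. (CLINT \<omega>|M. complex_of_real (h \<omega>) * iexp (t * X \<omega>)) = complex_of_real (expectation h) * (CLINT \<omega>|M. iexp (t * X \<omega>))"
    and E [measurable]: "E \<in> sets borel"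
  shows "expectation (\<lambda>\<omega>. h \<omega> * indicator E (X \<omega>)) = expectation h * prob (X -` E \<inter> space M)"
proof -
  define c where "c = expectation h"
  define N where "N = density M (\<lambda>\<omega>. ennreal (h \<omega> / c))"
  have c: "c > 0" using hpos by (simp add: c_def)
  have [measurable]: "X \<in> borel_measurable N" unfolding N_def by simp
  interpret N: prob_space N
  proof
    have "emeasure N (space N) = (\<integral>\<^sup>+\<omega>. ennreal (h \<omega> / c) \<partial>M)"
      by (simp add: N_def emeasure_density cong: nn_integral_cong)
    also have "\<dots> = ennreal (expectation (\<lambda>\<omega>. h \<omega> / c))"
      by (rule nn_integral_eq_integral) (use hint h0 c in auto)
    also have "\<dots> = 1" using c by (simp add: c_def[symmetric])
    finally show "emeasure N (space N) = 1" .
  qed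
  have "distr N borel X = distr M borel X"
  proof (rule Levy_uniqueness)
    show "real_distribution (distr N borel X)"
      by (intro real_distribution.intro N.prob_space_distr real_distribution_axioms.intro) auto
    show "real_distribution (distr M borel X)"
      by (intro real_distribution.intro prob_space_distr real_distribution_axioms.intro) auto
    show "char (distr N borel X) = char (distr M borel X)"
    proof
      fix t
      have "char (distr N borel X) t = (CLINT \<omega>|N. iexp (t * X \<omega>))"
        unfolding char_def by (subst integral_distr) auto
      also have "\<dots> = (CLINT \<omega>|M. (h \<omega> / c) *\<^sub>R iexp (t * X \<omega>))"
        unfolding N_def by (subst integral_density) (use h0 c in auto)
      also have "\<dots> = (CLINT \<omega>|M. (1 / complex_of_real c) * (complex_of_real (h \<omega>) * iexp (t * X \<omega>)))"
        by (intro Bochner_Integration.integral_cong) (auto simp: scaleR_conv_of_real)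
      also have "\<dots> = (CLINT \<omega>|M. iexp (t * X \<omega>))"
        by (simp only: integral_mult_right_zero char c_def[symmetric]) (use c in simp)
      also have "\<dots> = char (distr M borel X) t"
        unfolding char_def by (subst integral_distr) auto
      finally show "char (distr N borel X) t = char (distr M borel X) t" .
    qed
  qed
  then have "measure (distr N borel X) E = measure (distr M borel X) E" by simp
  then have "N.prob (X -` E \<inter> space M) = prob (X -` E \<inter> space M)"
    by (simp add: measure_distr N_def)
  moreover have "N.prob (X -` E \<inter> space M) = expectation (\<lambda>\<omega>. h \<omega> * indicator E (X \<omega>)) / c"
  proof -
    have "N.prob (X -` E \<inter> space M) = enn2real (\<integral>\<^sup>+\<omega>. ennreal (h \<omega> / c) * indicator (X -` E \<inter> space M) \<omega> \<partial>M)"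
      unfolding measure_def N_def by (subst emeasure_density) auto
    also have "(\<integral>\<^sup>+\<omega>. ennreal (h \<omega> / c) * indicator (X -` E \<inter> space M) \<omega> \<partial>M) = (\<integral>\<^sup>+\<omega>. ennreal (h \<omega> * indicator E (X \<omega>) / c) \<partial>M)"
      by (intro nn_integral_cong) (auto simp: indicator_def)
    also have "enn2real \<dots> = expectation (\<lambda>\<omega>. h \<omega> * indicator E (X \<omega>) / c)"
      by (rule integral_eq_nn_integral[symmetric]) (use h0 c in auto)
    finally show ?thesis by simp
  qed
  ultimately show ?thesis using c by (simp add: c_def[symmetric] field_simps)
qed

lemma integrable_mult_square_integrable:
  fixes X Y :: "'a \<Rightarrow> real"
  assumes [measurable]: "X \<in> borel_measurable M" "Y \<in> borel_measurable M"
    and i: "integrable M (\<lambda>\<omega>. (X \<omega>)\<^sup>2)" "integrable M (\<lambda>\<omega>. (Y \<omega>)\<^sup>2)"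
  shows "integrable M (\<lambda>\<omega>. X \<omega> * Y \<omega>)"
proof (rule Bochner_Integration.integrable_bound[of _ "\<lambda>\<omega>. (X \<omega>)\<^sup>2 + (Y \<omega>)\<^sup>2"])
  show "AE \<omega> in M. norm (X \<omega> * Y \<omega>) \<le> norm ((X \<omega>)\<^sup>2 + (Y \<omega>)\<^sup>2)"
  proof (rule AE_I2)
    fix \<omega>
    have "0 \<le> (\<bar>X \<omega>\<bar> - \<bar>Y \<omega>\<bar>)\<^sup>2" by simp
    then have "2 * (\<bar>X \<omega>\<bar> * \<bar>Y \<omega>\<bar>) \<le> (X \<omega>)\<^sup>2 + (Y \<omega>)\<^sup>2" by (simp add: power2_diff)
    moreover have "0 \<le> \<bar>X \<omega>\<bar> * \<bar>Y \<omega>\<bar>" by simp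
    ultimately show "norm (X \<omega> * Y \<omega>) \<le> norm ((X \<omega>)\<^sup>2 + (Y \<omega>)\<^sup>2)"
      unfolding real_norm_def abs_mult by linarith
  qed
qed (use i in auto)

text \<open>One-dimensional uniqueness of characteristic functions suffices if it is used twice
  through \<open>weighted_law_eq\<close>. With weights 1 + cos(a U) and 1 + sin(a U) on the law of Y
  it shows that the indicator of {Y in E} is uncorrelated with cos(a U) and sin(a U). This is the
  identity required for the law of U under the weight given by that indicator.\<close>

lemma gaussian_uncorrelated_indep:
  fixes U Y :: "'a \<Rightarrow> real"
  assumes g: "\<And>a b. gaussian_rv M (\<lambda>\<omega>. a * U \<omega> + b * Y \<omega>)"
    and mU: "expectation U = 0" and mY: "expectation Y = 0" and cor: "expectation (\<lambda>\<omega>. U \<omega> * Y \<omega>) = 0"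
    and F [measurable]: "F \<in> sets borel" and E [measurable]: "E \<in> sets borel"
  shows "prob {\<omega> \<in> space M. U \<omega> \<in> F \<and> Y \<omega> \<in> E} = prob {\<omega> \<in> space M. U \<omega> \<in> F} * prob {\<omega> \<in> space M. Y \<omega> \<in> E}"
proof -
  have gU: "gaussian_rv M U" and gY: "gaussian_rv M Y" using g[of 1 0] g[of 0 1] by simp_all
  have [measurable]: "U \<in> borel_measurable M" "Y \<in> borel_measurable M"
    using gU gY by (auto simp: gaussian_rv_def)
  have iU2: "integrable M (\<lambda>\<omega>. (U \<omega>)\<^sup>2)" and iY2: "integrable M (\<lambda>\<omega>. (Y \<omega>)\<^sup>2)"
    using gaussian_rv_integrable_square gU gY mU mY by auto
  have iU: "integrable M U" and iY: "integrable M Y"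
    using iU2 iY2 by (auto intro: square_integrable_imp_integrable)
  have iUY: "integrable M (\<lambda>\<omega>. U \<omega> * Y \<omega>)"
    using iU2 iY2 by (intro integrable_mult_square_integrable) auto
  define u where "u = expectation (\<lambda>\<omega>. (U \<omega>)\<^sup>2)"
  define y where "y = expectation (\<lambda>\<omega>. (Y \<omega>)\<^sup>2)"
  \<comment> \<open>The joint characteristic function factorizes because the mixed term in the
    variance of a U + b Y vanishes.\<close>
  have ch: "(CLINT \<omega>|M. iexp (a * U \<omega> + b * Y \<omega>)) = complex_of_real (exp (- (a\<^sup>2 * u / 2))) * complex_of_real (exp (- (b\<^sup>2 * y / 2)))" for a b
  proof -
    have "expectation (\<lambda>\<omega>. a * U \<omega> + b * Y \<omega>) = 0" using iU iY mU mY by simp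
    then have "(CLINT \<omega>|M. iexp (a * U \<omega> + b * Y \<omega>)) = complex_of_real (exp (- (expectation (\<lambda>\<omega>. (a * U \<omega> + b * Y \<omega>)\<^sup>2) / 2)))"
      by (rule gaussian_rv_char[OF g])
    also have "expectation (\<lambda>\<omega>. (a * U \<omega> + b * Y \<omega>)\<^sup>2) = expectation (\<lambda>\<omega>. a\<^sup>2 * (U \<omega>)\<^sup>2 + b\<^sup>2 * (Y \<omega>)\<^sup>2 + 2 * a * b * (U \<omega> * Y \<omega>))"
      by (intro Bochner_Integration.integral_cong) (auto simp: power2_eq_square algebra_simps)
    also have "\<dots> = a\<^sup>2 * u + b\<^sup>2 * y" using iU2 iY2 iUY cor by (simp add: u_def y_def)
    finally show ?thesis by (simp add: exp_add[symmetric] add_divide_distrib mult_exp_exp flip: of_real_mult)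
  qed
  have chU: "(CLINT \<omega>|M. iexp (a * U \<omega>)) = complex_of_real (exp (- (a\<^sup>2 * u / 2)))" for a using ch[of a 0] by simp
  have chY: "(CLINT \<omega>|M. iexp (b * Y \<omega>)) = complex_of_real (exp (- (b\<^sup>2 * y / 2)))" for b using ch[of 0 b] by simp
  have ii: "integrable M (\<lambda>\<omega>. iexp (f \<omega>))" if [measurable]: "f \<in> borel_measurable M" for f
    using integrable_iexp[of "\<lambda>\<omega>. complex_of_real (f \<omega>)"] by simp
  have ii2: "integrable M (\<lambda>\<omega>. iexp (a * U \<omega> + b * Y \<omega>))" for a b by (rule ii) simp
  have ibd: "integrable M f" if "f \<in> borel_measurable M" "\<And>\<omega>. norm (f \<omega>) \<le> B" for f :: "'a \<Rightarrow> real" and B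
    using that by (intro integrable_const_bound[of _ B]) auto
  have cosU: "complex_of_real (cos x) = (iexp x + iexp (- x)) / 2" for x :: real
    by (simp add: cos_of_real[symmetric] cos_exp_eq)
  have sinU: "complex_of_real (sin x) = (iexp x - iexp (- x)) / (2 * \<i>)" for x :: real
    by (simp add: sin_of_real[symmetric] sin_exp_eq)
  have cosI: "(CLINT \<omega>|M. complex_of_real (cos (a * U \<omega>)) * iexp (t * Y \<omega>)) = complex_of_real (exp (- (a\<^sup>2 * u / 2))) * complex_of_real (exp (- (t\<^sup>2 * y / 2)))" for a t
  proof -
    have "(CLINT \<omega>|M. complex_of_real (cos (a * U \<omega>)) * iexp (t * Y \<omega>)) = (CLINT \<omega>|M. (iexp (a * U \<omega> + t * Y \<omega>) + iexp ((- a) * U \<omega> + t * Y \<omega>)) / 2)"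
      unfolding cosU by (intro Bochner_Integration.integral_cong) (auto simp: field_simps mult_exp_exp)
    also have "\<dots> = ((CLINT \<omega>|M. iexp (a * U \<omega> + t * Y \<omega>)) + (CLINT \<omega>|M. iexp ((- a) * U \<omega> + t * Y \<omega>))) / 2"
      by (simp only: integral_divide_zero Bochner_Integration.integral_add[OF ii2 ii2])
    finally show ?thesis unfolding ch by simp
  qed
  have sinI: "(CLINT \<omega>|M. complex_of_real (sin (a * U \<omega>)) * iexp (t * Y \<omega>)) = 0" for a t
  proof -
    have "(CLINT \<omega>|M. complex_of_real (sin (a * U \<omega>)) * iexp (t * Y \<omega>)) = (CLINT \<omega>|M. (iexp (a * U \<omega> + t * Y \<omega>) - iexp ((- a) * U \<omega> + t * Y \<omega>)) / (2 * \<i>))"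
      unfolding sinU by (intro Bochner_Integration.integral_cong) (auto simp: field_simps mult_exp_exp)
    also have "\<dots> = ((CLINT \<omega>|M. iexp (a * U \<omega> + t * Y \<omega>)) - (CLINT \<omega>|M. iexp ((- a) * U \<omega> + t * Y \<omega>))) / (2 * \<i>)"
      by (simp only: integral_divide_zero Bochner_Integration.integral_diff[OF ii2 ii2])
    finally show ?thesis unfolding ch by simp
  qed
  have cosE: "expectation (\<lambda>\<omega>. cos (a * U \<omega>)) = exp (- (a\<^sup>2 * u / 2))" for a
    using cosI[of a 0] by (simp add: integral_complex_of_real flip: of_real_mult)
  have sinE: "expectation (\<lambda>\<omega>. sin (a * U \<omega>)) = 0" for a
    using sinI[of a 0] by (simp add: integral_complex_of_real)
  define p where "p = prob (Y -` E \<inter> space M)"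
  have pY: "expectation (\<lambda>\<omega>. indicat_real E (Y \<omega>)) = p"
  proof -
    have "expectation (\<lambda>\<omega>. indicat_real E (Y \<omega>)) = expectation (indicat_real (Y -` E \<inter> space M))"
      by (intro Bochner_Integration.integral_cong) (auto simp: indicator_def)
    then show ?thesis by (simp add: p_def)
  qed
  \<comment> \<open>Adding 1 makes the weight 1 + f non-negative and, since E f \<ge> 0, of positive
    mean; the contribution of the 1 is subtracted again at the end.\<close>
  have trig: "expectation (\<lambda>\<omega>. f \<omega> * indicat_real E (Y \<omega>)) = expectation f * p"
    if [measurable]: "f \<in> borel_measurable M" and b: "\<And>\<omega>. \<bar>f \<omega>\<bar> \<le> 1" and e: "expectation f \<ge> 0"
      and ci: "\<And>t. (CLINT \<omega>|M. complex_of_real (f \<omega>) * iexp (t * Y \<omega>)) = complex_of_real (expectation f) * (CLINT \<omega>|M. iexp (t * Y \<omega>))"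
    for f
  proof -
    have fi: "integrable M f" using b by (intro ibd[of _ 1]) auto
    have e1: "expectation (\<lambda>\<omega>. 1 + f \<omega>) = 1 + expectation f" using fi by (simp add: prob_space)
    have "expectation (\<lambda>\<omega>. (1 + f \<omega>) * indicat_real E (Y \<omega>)) = expectation (\<lambda>\<omega>. 1 + f \<omega>) * p"
      unfolding p_def
    proof (rule weighted_law_eq)
      show "0 \<le> 1 + f \<omega>" for \<omega> using b[of \<omega>] by linarith
      show "integrable M (\<lambda>\<omega>. 1 + f \<omega>)" using fi by simp
      show "0 < expectation (\<lambda>\<omega>. 1 + f \<omega>)" using e1 e by simp
      fix t
      have i2: "integrable M (\<lambda>\<omega>. complex_of_real (f \<omega>) * iexp (t * Y \<omega>))"
        using b by (intro integrable_const_bound[of _ 1]) (auto simp: norm_mult)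
      have "(CLINT \<omega>|M. complex_of_real (1 + f \<omega>) * iexp (t * Y \<omega>)) = (CLINT \<omega>|M. iexp (t * Y \<omega>) + complex_of_real (f \<omega>) * iexp (t * Y \<omega>))"
        by (intro Bochner_Integration.integral_cong) (auto simp: algebra_simps)
      also have "\<dots> = (CLINT \<omega>|M. iexp (t * Y \<omega>)) + (CLINT \<omega>|M. complex_of_real (f \<omega>) * iexp (t * Y \<omega>))"
        by (rule Bochner_Integration.integral_add[OF ii i2]) simp
      finally show "(CLINT \<omega>|M. complex_of_real (1 + f \<omega>) * iexp (t * Y \<omega>)) = complex_of_real (expectation (\<lambda>\<omega>. 1 + f \<omega>)) * (CLINT \<omega>|M. iexp (t * Y \<omega>))"
        unfolding ci e1 by (simp add: algebra_simps)
    qed auto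
    moreover have "expectation (\<lambda>\<omega>. (1 + f \<omega>) * indicat_real E (Y \<omega>)) = p + expectation (\<lambda>\<omega>. f \<omega> * indicat_real E (Y \<omega>))"
    proof -
      have "integrable M (\<lambda>\<omega>. f \<omega> * indicat_real E (Y \<omega>))" "integrable M (\<lambda>\<omega>. indicat_real E (Y \<omega>) :: real)"
        using b by (auto intro!: ibd[of _ 1] simp: indicator_def)
      then show ?thesis by (simp add: distrib_right pY)
    qed
    ultimately show ?thesis unfolding e1 by (simp add: algebra_simps)
  qed
  have cosT: "expectation (\<lambda>\<omega>. cos (a * U \<omega>) * indicat_real E (Y \<omega>)) = exp (- (a\<^sup>2 * u / 2)) * p" for a
  proof -
    have "expectation (\<lambda>\<omega>. cos (a * U \<omega>) * indicat_real E (Y \<omega>)) = expectation (\<lambda>\<omega>. cos (a * U \<omega>)) * p"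
      by (rule trig; (simp only: cosE cosI chY)?) (auto simp: cosE)
    then show ?thesis by (simp add: cosE)
  qed
  have sinT: "expectation (\<lambda>\<omega>. sin (a * U \<omega>) * indicat_real E (Y \<omega>)) = 0" for a
  proof -
    have "expectation (\<lambda>\<omega>. sin (a * U \<omega>) * indicat_real E (Y \<omega>)) = expectation (\<lambda>\<omega>. sin (a * U \<omega>)) * p"
      by (rule trig; (simp only: sinE sinI of_real_0 mult_zero_left)?) (auto simp: sinE)
    then show ?thesis by (simp add: sinE)
  qed
  show ?thesis
  \<comment> \<open>A weight must have positive mean; if {Y in E} is a null event, both sides are
    0.\<close>
  proof (cases "p = 0")
    case True
    have "prob {\<omega> \<in> space M. U \<omega> \<in> F \<and> Y \<omega> \<in> E} \<le> p"
      unfolding p_def by (intro finite_measure_mono) auto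
    moreover have "{\<omega> \<in> space M. Y \<omega> \<in> E} = Y -` E \<inter> space M" by auto
    ultimately show ?thesis using True by (simp add: p_def measure_le_0_iff)
  next
    case False
    then have p: "p > 0" unfolding p_def by (simp add: zero_less_measure_iff)
    have "expectation (\<lambda>\<omega>. indicat_real E (Y \<omega>) * indicat_real F (U \<omega>)) = expectation (\<lambda>\<omega>. indicat_real E (Y \<omega>)) * prob (U -` F \<inter> space M)"
    proof (rule weighted_law_eq)
      show "integrable M (\<lambda>\<omega>. indicat_real E (Y \<omega>) :: real)" by (auto intro!: ibd[of _ 1] simp: indicator_def)
      fix t
      have i: "integrable M (\<lambda>\<omega>. complex_of_real (cos (t * U \<omega>) * indicat_real E (Y \<omega>)))" "integrable M (\<lambda>\<omega>. complex_of_real (sin (t * U \<omega>) * indicat_real E (Y \<omega>)))"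
        by (auto intro!: integrable_const_bound[of _ 1] simp: indicator_def simp flip: of_real_mult)
      have "(CLINT \<omega>|M. complex_of_real (indicat_real E (Y \<omega>)) * iexp (t * U \<omega>)) =
        (CLINT \<omega>|M. complex_of_real (cos (t * U \<omega>) * indicat_real E (Y \<omega>)) + \<i> * complex_of_real (sin (t * U \<omega>) * indicat_real E (Y \<omega>)))"
        by (intro Bochner_Integration.integral_cong) (auto simp: exp_Euler cos_of_real sin_of_real algebra_simps simp flip: of_real_mult)
      also have "\<dots> = complex_of_real (exp (- (t\<^sup>2 * u / 2)) * p)"
        by (subst Bochner_Integration.integral_add) (use i in \<open>auto simp only: integral_complex_of_real cosT sinT integral_mult_right_zero integrable_mult_right mult_zero_right of_real_0 add_0_right\<close>)
      finally show "(CLINT \<omega>|M. complex_of_real (indicat_real E (Y \<omega>)) * iexp (t * U \<omega>)) = complex_of_real (expectation (\<lambda>\<omega>. indicat_real E (Y \<omega>))) * (CLINT \<omega>|M. iexp (t * U \<omega>))"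
        by (simp only: chU pY) simp
    qed (use p pY in auto)
    moreover have "expectation (\<lambda>\<omega>. indicat_real E (Y \<omega>) * indicat_real F (U \<omega>)) = prob {\<omega> \<in> space M. U \<omega> \<in> F \<and> Y \<omega> \<in> E}"
    proof -
      have "expectation (\<lambda>\<omega>. indicat_real E (Y \<omega>) * indicat_real F (U \<omega>)) = expectation (indicat_real {\<omega> \<in> space M. U \<omega> \<in> F \<and> Y \<omega> \<in> E})"
        by (intro Bochner_Integration.integral_cong) (auto simp: indicator_def)
      then show ?thesis by simp
    qed
    moreover have "{\<omega> \<in> space M. Y \<omega> \<in> E} = Y -` E \<inter> space M" "{\<omega> \<in> space M. U \<omega> \<in> F} = U -` F \<inter> space M" by auto
    ultimately show ?thesis by (simp add: pY p_def mult.commute)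
  qed
qed

end

subsection \<open>Gaussian processes with stationary increments\<close>

lemma measure_eqI_box:
  fixes M N :: "'a::euclidean_space measure"
  assumes "finite_measure M" and sets: "sets M = sets borel" "sets N = sets borel"
    and eq: "\<And>l u. emeasure M (box l u) = emeasure N (box l u)"
  shows "M = N"
proof (rule measure_eqI_generator_eq)
  interpret finite_measure M by fact
  let ?E = "range (\<lambda>(a, b). box a b::'a set)"
  show "Int_stable ?E" by (auto simp: Int_stable_def box_Int_box)
  show "?E \<subseteq> Pow UNIV" "sets M = sigma_sets UNIV ?E" "sets N = sigma_sets UNIV ?E"
    by (simp_all add: borel_eq_box sets)
  let ?A = "\<lambda>n::nat. box (- (real n *\<^sub>R One)) (real n *\<^sub>R One) :: 'a set"
  show "range ?A \<subseteq> ?E" "(\<Union>i. ?A i) = UNIV" unfolding UN_box_eq_UNIV by auto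
  show "emeasure M (?A i) \<noteq> \<infinity>" for i using emeasure_finite by (simp add: top_unique)
  show "emeasure M X = emeasure N X" if "X \<in> ?E" for X
    using that by (auto simp: eq)
qed

context prob_space begin

lemma gaussian_process_comb3:
  assumes g: "centered_gaussian_process M I Y" and "s \<in> I" "t \<in> I" "r \<in> I"
  shows "gaussian_rv M (\<lambda>\<omega>. a * Y s \<omega> + b * Y t \<omega> + c * Y r \<omega>)"
proof -
  \<comment> \<open>Adding the coefficients point by point allows s, t and r to coincide.\<close>
  define d where "d p = (if p = s then a else 0) + (if p = t then b else 0) + (if p = r then c else 0)" for p
  have "gaussian_rv M (\<lambda>\<omega>. \<Sum>p\<in>{s,t,r}. d p * Y p \<omega>)"
    using g[unfolded centered_gaussian_process_def, THEN conjunct1, rule_format, of "{s,t,r}" d] assms(2-4) by simp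
  moreover have "(\<Sum>p\<in>{s,t,r}. d p * Y p \<omega>) = a * Y s \<omega> + b * Y t \<omega> + c * Y r \<omega>" for \<omega>
  proof -
    have "(\<Sum>p\<in>{s,t,r}. (if p = q then e else 0) * Y p \<omega>) = e * Y q \<omega>" if "q \<in> {s,t,r}" for q e
      using that by (subst sum.remove[of _ q]) (auto intro!: sum.neutral)
    then show ?thesis unfolding d_def distrib_right sum.distrib by simp
  qed
  ultimately show ?thesis by simp
qed

end

locale gauss_process = prob_space M for M :: "'w measure" +
  fixes Z :: "real \<Rightarrow> 'w \<Rightarrow> real^'d" and v dv :: "'d \<Rightarrow> real \<Rightarrow> real" and T :: real
  assumes T_pos: "T > 0"
    and indep: "independent_processes M {0..} (\<lambda>i t \<omega>. Z t \<omega> $ i) UNIV"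
    and gauss: "\<And>i. centered_gaussian_process M {0..} (\<lambda>t \<omega>. Z t \<omega> $ i)"
    and cont_paths: "\<And>i. AE \<omega> in M. continuous_on {0..} (\<lambda>t. Z t \<omega> $ i)"
    and stat: "\<And>i. stationary_increments M (\<lambda>t \<omega>. Z t \<omega> $ i)"
    and var: "\<And>i t. t \<ge> 0 \<Longrightarrow> v i t = variance (\<lambda>\<omega>. Z t \<omega> $ i)"
    and v_deriv: "\<And>i t. t \<in> {0..T} \<Longrightarrow> (v i has_real_derivative dv i t) (at t within {0..T})"
    and v_mono: "\<And>i. strict_mono_on {0..T} (v i)"
    and v_zero: "\<And>i. v i 0 = 0"
    and dv_pos: "\<And>i. dv i T > 0"
    and v_small: "\<And>i. v i \<in> o[at_right 0](\<lambda>t. t)"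
begin

lemma Z_measurable [measurable (raw)]: "t \<ge> 0 \<Longrightarrow> (\<lambda>\<omega>. Z t \<omega> $ i) \<in> borel_measurable M"
  and Z_mean: "t \<ge> 0 \<Longrightarrow> expectation (\<lambda>\<omega>. Z t \<omega> $ i) = 0"
  using gauss[of i] by (auto simp: centered_gaussian_process_def)

lemma Z_vec_measurable: "t \<ge> 0 \<Longrightarrow> Z t \<in> borel_measurable M"
  by (subst borel_measurable_euclidean_space) (auto simp: Basis_vec_def inner_axis Z_measurable)

lemma Z_gauss: "t \<ge> 0 \<Longrightarrow> gaussian_rv M (\<lambda>\<omega>. Z t \<omega> $ i)"
  using gaussian_process_comb3[OF gauss[of i], of t t t 1 0 0] by simp

lemma Z_square_integrable: "t \<ge> 0 \<Longrightarrow> integrable M (\<lambda>\<omega>. (Z t \<omega> $ i)\<^sup>2)"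
  using gaussian_rv_integrable_square[OF Z_gauss Z_mean] .

lemma Z_integrable: "t \<ge> 0 \<Longrightarrow> integrable M (\<lambda>\<omega>. Z t \<omega> $ i)"
  using Z_square_integrable Z_measurable by (blast intro: square_integrable_imp_integrable)

lemma Z_second_moment: "t \<ge> 0 \<Longrightarrow> expectation (\<lambda>\<omega>. (Z t \<omega> $ i)\<^sup>2) = v i t"
  by (simp add: var Z_mean)

lemma Z_mult_integrable: "s \<ge> 0 \<Longrightarrow> t \<ge> 0 \<Longrightarrow> integrable M (\<lambda>\<omega>. Z s \<omega> $ i * Z t \<omega> $ i)"
  by (intro integrable_mult_square_integrable Z_measurable Z_square_integrable)

lemma v_nonneg: "t \<ge> 0 \<Longrightarrow> 0 \<le> v i t"
  by (subst Z_second_moment[symmetric]) auto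

lemma v_T_pos: "v i T > 0"
  using v_mono[of i] T_pos v_zero[of i] by (auto dest: strict_mono_onD[of _ _ 0 T])

lemma Z_zero: "AE \<omega> in M. Z 0 \<omega> $ i = 0"
proof -
  have "expectation (\<lambda>\<omega>. (Z 0 \<omega> $ i)\<^sup>2) = 0" by (simp add: Z_second_moment v_zero)
  then have "AE \<omega> in M. (Z 0 \<omega> $ i)\<^sup>2 = 0"
    using integral_nonneg_eq_0_iff_AE[OF Z_square_integrable[of 0 i]] by simp
  then show ?thesis by simp
qed

text \<open>Stationarity is an equality of laws on path space; the squared evaluation at t - s is
  integrated against both laws, and Z(0) vanishes almost surely because v(0) = 0.\<close>

lemma Z_increment: 
  assumes "0 \<le> s" "s \<le> t"
  shows "expectation (\<lambda>\<omega>. (Z t \<omega> $ i - Z s \<omega> $ i)\<^sup>2) = v i (t - s)"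
proof -
  have law: "expectation (\<lambda>\<omega>. (Y (t - s) \<omega>)\<^sup>2) = (\<integral>f. (f (t - s))\<^sup>2 \<partial>process_law M {0..} Y)"
    if "\<And>t. t \<ge> 0 \<Longrightarrow> Y t \<in> borel_measurable M" for Y :: "real \<Rightarrow> 'w \<Rightarrow> real"
  proof -
    have "(\<lambda>f. (f (t - s))\<^sup>2) \<in> borel_measurable (process_space {0..})"
      unfolding process_space_def using assms by (intro borel_measurable_power measurable_component_singleton) auto
    moreover have "(\<lambda>\<omega>. \<lambda>t\<in>{0..}. Y t \<omega>) \<in> M \<rightarrow>\<^sub>M process_space {0..}"
      unfolding process_space_def using that by (intro measurable_restrict) auto
    ultimately show ?thesis unfolding process_law_def using assms by (subst integral_distr) auto
  qed
  have "expectation (\<lambda>\<omega>. (Z ((t - s) + s) \<omega> $ i - Z s \<omega> $ i)\<^sup>2) = expectation (\<lambda>\<omega>. (Z (t - s) \<omega> $ i - Z 0 \<omega> $ i)\<^sup>2)"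
    using stat[of i] assms unfolding stationary_increments_def
    by (subst law[of "\<lambda>t \<omega>. Z (t + s) \<omega> $ i - Z s \<omega> $ i"], force)
       (subst law[of "\<lambda>t \<omega>. Z t \<omega> $ i - Z 0 \<omega> $ i"], force, simp)
  also have "\<dots> = expectation (\<lambda>\<omega>. (Z (t - s) \<omega> $ i)\<^sup>2)"
    using Z_zero[of i] assms by (intro integral_cong_AE) (auto elim!: eventually_mono)
  finally show ?thesis using assms by (simp add: Z_second_moment)
qed

lemma Z_cov: 
  assumes "0 \<le> s" "s \<le> t"
  shows "expectation (\<lambda>\<omega>. Z s \<omega> $ i * Z t \<omega> $ i) = (v i s + v i t - v i (t - s)) / 2"
proof -
  have "v i (t - s) = expectation (\<lambda>\<omega>. (Z t \<omega> $ i)\<^sup>2 + (Z s \<omega> $ i)\<^sup>2 - 2 * (Z s \<omega> $ i * Z t \<omega> $ i))"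
    unfolding Z_increment[OF assms, symmetric]
    by (intro Bochner_Integration.integral_cong) (auto simp: power2_eq_square algebra_simps)
  also have "\<dots> = v i t + v i s - 2 * expectation (\<lambda>\<omega>. Z s \<omega> $ i * Z t \<omega> $ i)"
    using assms by (simp add: Z_square_integrable Z_mult_integrable Z_second_moment)
  finally show ?thesis by simp
qed

text \<open>The regression coefficient Cov(Z_i(t), Z_i(T)) / Var Z_i(T) for 0 \<le> t \<le> T, with
  the covariance expressed through v by stationarity of the increments.\<close>

definition rho :: "'d \<Rightarrow> real \<Rightarrow> real" where
  "rho i t = (v i t + v i T - v i (T - t)) / (2 * v i T)"

text \<open>The residual of the regression of \<open>Z t\<close> on \<open>Z T\<close>.\<close>

definition bridge :: "'d \<Rightarrow> real \<Rightarrow> 'w \<Rightarrow> real" where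
  "bridge i t \<omega> = Z t \<omega> $ i - rho i t * Z T \<omega> $ i"

lemma Z_cov_T: "t \<in> {0..T} \<Longrightarrow> expectation (\<lambda>\<omega>. Z t \<omega> $ i * Z T \<omega> $ i) = rho i t * v i T"
  using Z_cov[of t T i] v_T_pos[of i] by (simp add: rho_def)

lemma bridge_measurable: "t \<in> {0..T} \<Longrightarrow> bridge i t \<in> borel_measurable M"
  unfolding bridge_def using T_pos by measurable

lemma bridge_increment_gauss:
  assumes "s \<in> {0..T}" "t \<in> {0..T}"
  shows "gaussian_rv M (\<lambda>\<omega>. a * (bridge i t \<omega> - bridge i s \<omega>) + b * Z T \<omega> $ i)"
proof -
  have "gaussian_rv M (\<lambda>\<omega>. a * Z t \<omega> $ i + (- a) * Z s \<omega> $ i + (b - a * (rho i t - rho i s)) * Z T \<omega> $ i)"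
    by (rule gaussian_process_comb3[OF gauss]) (use assms T_pos in auto)
  then show ?thesis by (simp add: bridge_def algebra_simps)
qed

lemma bridge_increment_mean:
  assumes "s \<in> {0..T}" "t \<in> {0..T}"
  shows "expectation (\<lambda>\<omega>. bridge i t \<omega> - bridge i s \<omega>) = 0"
  unfolding bridge_def using assms T_pos by (simp add: Z_integrable Z_mean)

lemma bridge_increment_cov:
  assumes "s \<in> {0..T}" "t \<in> {0..T}"
  shows "expectation (\<lambda>\<omega>. (bridge i t \<omega> - bridge i s \<omega>) * Z T \<omega> $ i) = 0"
proof -
  have "expectation (\<lambda>\<omega>. (bridge i t \<omega> - bridge i s \<omega>) * Z T \<omega> $ i) =
    expectation (\<lambda>\<omega>. Z t \<omega> $ i * Z T \<omega> $ i - Z s \<omega> $ i * Z T \<omega> $ i - (rho i t - rho i s) * (Z T \<omega> $ i)\<^sup>2)"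
    unfolding bridge_def by (intro Bochner_Integration.integral_cong) (auto simp: power2_eq_square algebra_simps)
  also have "\<dots> = 0"
    using assms T_pos by (simp add: Z_square_integrable Z_mult_integrable Z_second_moment Z_cov_T) (simp add: algebra_simps)
  finally show ?thesis .
qed

text \<open>Pythagoras: the increment of Z is the increment of the bridge plus a multiple of Z(T),
  and the two are uncorrelated.\<close>

lemma bridge_increment_var:
  assumes "0 \<le> s" "s \<le> t" "t \<le> T"
  shows "expectation (\<lambda>\<omega>. (bridge i t \<omega> - bridge i s \<omega>)\<^sup>2) \<le> v i (t - s)"
proof -
  define d where "d = rho i t - rho i s"
  let ?U = "\<lambda>\<omega>. bridge i t \<omega> - bridge i s \<omega>"
  have st: "s \<in> {0..T}" "t \<in> {0..T}" using assms by auto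
  have g: "gaussian_rv M ?U" using bridge_increment_gauss[OF st, of 1 i 0] by simp
  have m: "?U \<in> borel_measurable M" using g by (simp add: gaussian_rv_def)
  have i: "integrable M (\<lambda>\<omega>. (?U \<omega>)\<^sup>2)" by (rule gaussian_rv_integrable_square[OF g bridge_increment_mean[OF st]])
  have iUT: "integrable M (\<lambda>\<omega>. ?U \<omega> * Z T \<omega> $ i)"
    using T_pos by (intro integrable_mult_square_integrable m i Z_measurable Z_square_integrable) auto
  have "v i (t - s) = expectation (\<lambda>\<omega>. (?U \<omega>)\<^sup>2 + 2 * d * (?U \<omega> * Z T \<omega> $ i) + d\<^sup>2 * (Z T \<omega> $ i)\<^sup>2)"
    unfolding Z_increment[OF assms(1,2), symmetric] bridge_def d_def
    by (intro Bochner_Integration.integral_cong) (auto simp: power2_eq_square algebra_simps)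
  also have "\<dots> = expectation (\<lambda>\<omega>. (?U \<omega>)\<^sup>2) + d\<^sup>2 * v i T"
    using T_pos i iUT bridge_increment_cov[OF st] by (simp add: Z_square_integrable Z_second_moment)
  finally show ?thesis using v_T_pos[of i] by simp
qed

text \<open>In coordinate i a path functional is recorded next to the final value; in the other
  coordinates a constant takes its place, so that all pairs form one independent family.\<close>

lemma indep_pairs:
  assumes g: "g \<in> borel_measurable (process_space {0..})"
  shows "indep_vars (\<lambda>_. borel \<Otimes>\<^sub>M borel) (\<lambda>k \<omega>. (if k = i then g (\<lambda>t\<in>{0..}. Z t \<omega> $ k) else 0, Z T \<omega> $ k)) (UNIV :: 'd set)"
proof -
  have "indep_vars (\<lambda>_. borel \<Otimes>\<^sub>M borel) (\<lambda>k \<omega>. (\<lambda>f. (if k = i then g f else 0, f T)) (\<lambda>t\<in>{0..}. Z t \<omega> $ k)) (UNIV :: 'd set)"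
    by (rule indep_vars_compose2[OF indep[unfolded independent_processes_def]])
       (use T_pos g in \<open>auto simp: process_space_def intro!: measurable_Pair measurable_component_singleton\<close>)
  then show ?thesis using T_pos by (simp cong: if_cong)
qed

lemma indep_Z_T: "indep_vars (\<lambda>_. borel) (\<lambda>i \<omega>. Z T \<omega> $ i) (UNIV :: 'd set)"
proof -
  have "indep_vars (\<lambda>_. borel) (\<lambda>k \<omega>. (\<lambda>f. f T) (\<lambda>t\<in>{0..}. Z t \<omega> $ k)) (UNIV :: 'd set)"
    by (rule indep_vars_compose2[OF indep[unfolded independent_processes_def]])
       (use T_pos in \<open>auto simp: process_space_def intro!: measurable_component_singleton\<close>)
  then show ?thesis using T_pos by simp
qed

text \<open>On boxes, independence of the coordinates isolates the i-th one, where the increment and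
  the final value are jointly Gaussian and uncorrelated. Boxes determine finite measures, so the
  factorization extends to all Borel sets.\<close>

lemma bridge_increment_indep:
  assumes st: "s \<in> {0..T}" "t \<in> {0..T}" and F [measurable]: "F \<in> sets borel" and E: "E \<in> sets borel"
  shows "prob {\<omega> \<in> space M. bridge i t \<omega> - bridge i s \<omega> \<in> F \<and> Z T \<omega> \<in> E} =
    prob {\<omega> \<in> space M. bridge i t \<omega> - bridge i s \<omega> \<in> F} * prob {\<omega> \<in> space M. Z T \<omega> \<in> E}"
proof -
  let ?U = "\<lambda>\<omega>. bridge i t \<omega> - bridge i s \<omega>"
  have [measurable]: "?U \<in> borel_measurable M" using bridge_measurable[OF st(1)] bridge_measurable[OF st(2)] by measurable
  have [measurable]: "Z T \<in> borel_measurable M" using T_pos by (intro Z_vec_measurable) auto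
  have [measurable]: "(\<lambda>\<omega>. Z T \<omega> $ k) \<in> borel_measurable M" for k using T_pos by (intro Z_measurable) auto
  define p where "p = prob {\<omega> \<in> space M. ?U \<omega> \<in> F}"
  define N where "N = density M (indicator {\<omega> \<in> space M. ?U \<omega> \<in> F})"
  \<comment> \<open>P is the law of \<open>Z T\<close> restricted to the event that the increment
    lies in F, and R is p times the full law of \<open>Z T\<close>.\<close>
  define P where "P = distr N borel (Z T)"
  define R where "R = density (distr M borel (Z T)) (\<lambda>_. ennreal p)"
  have P: "emeasure P A = ennreal (prob {\<omega> \<in> space M. ?U \<omega> \<in> F \<and> Z T \<omega> \<in> A})" if [measurable]: "A \<in> sets borel" for A
  proof -
    have "emeasure P A = emeasure M ({\<omega> \<in> space M. ?U \<omega> \<in> F} \<inter> (Z T -` A \<inter> space M))"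
      unfolding P_def N_def by (subst emeasure_distr) (auto simp: emeasure_restricted)
    also have "{\<omega> \<in> space M. ?U \<omega> \<in> F} \<inter> (Z T -` A \<inter> space M) = {\<omega> \<in> space M. ?U \<omega> \<in> F \<and> Z T \<omega> \<in> A}" by auto
    finally show ?thesis by (simp add: emeasure_eq_measure)
  qed
  have R: "emeasure R A = ennreal (p * prob {\<omega> \<in> space M. Z T \<omega> \<in> A})" if [measurable]: "A \<in> sets borel" for A
  proof -
    have "emeasure R A = ennreal p * emeasure (distr M borel (Z T)) A"
      unfolding R_def by (subst emeasure_density) (auto simp: nn_integral_cmult_indicator)
    also have "emeasure (distr M borel (Z T)) A = emeasure M (Z T -` A \<inter> space M)"
      by (subst emeasure_distr) auto
    also have "Z T -` A \<inter> space M = {\<omega> \<in> space M. Z T \<omega> \<in> A}" by auto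
    finally show ?thesis by (simp add: emeasure_eq_measure ennreal_mult p_def)
  qed
  have "P = R"
  proof (rule measure_eqI_box)
    show "finite_measure P" by standard (use P[of UNIV] in \<open>simp add: P_def\<close>)
    show "sets P = sets borel" "sets R = sets borel" by (auto simp: P_def R_def)
    fix l u :: "real^'d"
    define A where "A k = {l $ k <..< u $ k}" for k
    define g where "g f = f t - f s - (rho i t - rho i s) * f T" for f :: "real \<Rightarrow> real"
    have gm: "g \<in> borel_measurable (process_space {0..})"
      unfolding g_def process_space_def
      by (intro borel_measurable_diff borel_measurable_times borel_measurable_const measurable_component_singleton) (use st T_pos in auto)
    have gU: "g (\<lambda>t\<in>{0..}. Z t \<omega> $ i) = ?U \<omega>" for \<omega>
      using st T_pos by (simp add: g_def bridge_def algebra_simps)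
    note ip = indep_varsD_finite[OF indep_pairs[OF gm, of i], of "\<lambda>k. (if k = i then F else UNIV) \<times> A k"]
    have 1: "prob {\<omega> \<in> space M. ?U \<omega> \<in> F \<and> Z T \<omega> \<in> box l u} =
      prob {\<omega> \<in> space M. ?U \<omega> \<in> F \<and> Z T \<omega> $ i \<in> A i} * (\<Prod>k\<in>UNIV-{i}. prob {\<omega> \<in> space M. Z T \<omega> $ k \<in> A k})"
    proof -
      have "{\<omega> \<in> space M. ?U \<omega> \<in> F \<and> Z T \<omega> \<in> box l u} = (\<Inter>k\<in>UNIV. (\<lambda>\<omega>. (if k = i then g (\<lambda>t\<in>{0..}. Z t \<omega> $ k) else 0, Z T \<omega> $ k)) -` ((if k = i then F else UNIV) \<times> A k) \<inter> space M)"
        by (auto simp: mem_box_cart A_def gU split: if_splits)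
      also have "prob \<dots> = (\<Prod>k\<in>UNIV. prob ((\<lambda>\<omega>. (if k = i then g (\<lambda>t\<in>{0..}. Z t \<omega> $ k) else 0, Z T \<omega> $ k)) -` ((if k = i then F else UNIV) \<times> A k) \<inter> space M))"
        by (rule ip) (auto simp: A_def)
      also have "\<dots> = prob {\<omega> \<in> space M. ?U \<omega> \<in> F \<and> Z T \<omega> $ i \<in> A i} * (\<Prod>k\<in>UNIV-{i}. prob {\<omega> \<in> space M. Z T \<omega> $ k \<in> A k})"
        by (subst prod.remove[of _ i])
           (auto simp: gU intro!: arg_cong2[of _ _ _ _ times] prod.cong arg_cong[of _ _ prob])
      finally show ?thesis .
    qed
    have 2: "prob {\<omega> \<in> space M. ?U \<omega> \<in> F \<and> Z T \<omega> $ i \<in> A i} = p * prob {\<omega> \<in> space M. Z T \<omega> $ i \<in> A i}"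
      unfolding p_def
      by (rule gaussian_uncorrelated_indep)
         (use T_pos in \<open>auto simp: A_def Z_mean bridge_increment_gauss[OF st] bridge_increment_mean[OF st] bridge_increment_cov[OF st]\<close>)
    have 3: "prob {\<omega> \<in> space M. Z T \<omega> \<in> box l u} = (\<Prod>k\<in>UNIV. prob {\<omega> \<in> space M. Z T \<omega> $ k \<in> A k})"
    proof -
      have "{\<omega> \<in> space M. Z T \<omega> \<in> box l u} = (\<Inter>k\<in>UNIV. (\<lambda>\<omega>. Z T \<omega> $ k) -` A k \<inter> space M)"
        by (auto simp: mem_box_cart A_def)
      also have "prob \<dots> = (\<Prod>k\<in>UNIV. prob ((\<lambda>\<omega>. Z T \<omega> $ k) -` A k \<inter> space M))"
        by (rule indep_varsD_finite[OF indep_Z_T]) (auto simp: A_def)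
      finally show ?thesis by (simp add: vimage_def Int_def conj_commute)
    qed
    also have "\<dots> = prob {\<omega> \<in> space M. Z T \<omega> $ i \<in> A i} * (\<Prod>k\<in>UNIV-{i}. prob {\<omega> \<in> space M. Z T \<omega> $ k \<in> A k})"
      by (subst prod.remove[of _ i]) auto
    finally show "emeasure P (box l u) = emeasure R (box l u)"
      by (subst P, simp, subst R, simp) (simp add: 1 2 mult.assoc)
  qed
  then have "ennreal (prob {\<omega> \<in> space M. ?U \<omega> \<in> F \<and> Z T \<omega> \<in> E}) = ennreal (p * prob {\<omega> \<in> space M. Z T \<omega> \<in> E})"
    using P[OF E] R[OF E] by simp
  then show ?thesis by (simp add: p_def)
qed

text \<open>The tail hypothesis of \<open>dyadic_chaining\<close>, with \<open>G\<close> an event of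
  \<open>Z T\<close>.\<close>

lemma bridge_increment_tail:
  assumes st: "0 \<le> s" "s < t" "t \<le> T" and E: "E \<in> sets borel" and eta: "v i (t - s) \<le> eta * (t - s)" "eta > 0" and x: "x > 0"
  shows "prob {\<omega> \<in> {\<omega> \<in> space M. Z T \<omega> \<in> E}. \<bar>bridge i t \<omega> - bridge i s \<omega>\<bar> > x}
     \<le> 2 * exp (- (x\<^sup>2 / (2 * eta * (t - s)))) * prob {\<omega> \<in> space M. Z T \<omega> \<in> E}"
proof -
  have st': "s \<in> {0..T}" "t \<in> {0..T}" using st by auto
  let ?U = "\<lambda>\<omega>. bridge i t \<omega> - bridge i s \<omega>"
  have F: "{y. \<bar>y\<bar> > x} \<in> sets borel" by measurable
  have "prob {\<omega> \<in> {\<omega> \<in> space M. Z T \<omega> \<in> E}. \<bar>?U \<omega>\<bar> > x} = prob {\<omega> \<in> space M. ?U \<omega> \<in> {y. \<bar>y\<bar> > x} \<and> Z T \<omega> \<in> E}"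
    by (rule arg_cong[of _ _ prob]) auto
  also have "\<dots> = prob {\<omega> \<in> space M. ?U \<omega> \<in> {y. \<bar>y\<bar> > x}} * prob {\<omega> \<in> space M. Z T \<omega> \<in> E}"
    by (rule bridge_increment_indep[OF st' F E])
  also have "prob {\<omega> \<in> space M. ?U \<omega> \<in> {y. \<bar>y\<bar> > x}} \<le> 2 * exp (- (x\<^sup>2 / (2 * (eta * (t - s)))))"
    unfolding mem_Collect_eq
  proof (rule gaussian_rv_tail)
    show "gaussian_rv M ?U" using bridge_increment_gauss[OF st', of 1 i 0] by simp
    show "expectation ?U = 0" by (rule bridge_increment_mean[OF st'])
    show "expectation (\<lambda>\<omega>. (?U \<omega>)\<^sup>2) \<le> eta * (t - s)"
      using bridge_increment_var[of s t i] st eta by linarith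
  qed (use st eta x in auto)
  finally show ?thesis by (simp add: mult_right_mono mult.assoc)
qed

lemma Z_T_density: "distr M borel (Z T) = density lborel (\<lambda>z. ennreal (\<Prod>i\<in>UNIV. normal_density 0 (sqrt (v i T)) (z $ i)))"
proof (rule measure_eqI_box)
  have T0: "T \<ge> 0" using T_pos by simp
  have [measurable]: "Z T \<in> borel_measurable M" using T0 by (rule Z_vec_measurable)
  have [measurable]: "(\<lambda>\<omega>. Z T \<omega> $ k) \<in> borel_measurable M" for k using T0 by (rule Z_measurable)
  let ?n = "\<lambda>i. normal_density 0 (sqrt (v i T))"
  interpret D: prob_space "distr M borel (Z T)" by (rule prob_space_distr) simp
  show "finite_measure (distr M borel (Z T))" by (rule D.finite_measure_axioms)
  fix l u :: "real^'d"
  define A where "A k = {l $ k <..< u $ k}" for k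
  have dist: "distributed M lborel (\<lambda>\<omega>. Z T \<omega> $ k) (?n k)" for k
    using Z_gauss[OF T0, of k] Z_mean[OF T0, of k]
  proof (cases rule: gaussian_rv_centered_cases)
    case deg then show ?thesis using Z_second_moment[OF T0, of k] v_T_pos[of k] by simp
  next
    case (normal s)
    then have "sqrt (v k T) = s" using Z_second_moment[OF T0, of k] by (auto intro: real_sqrt_unique)
    then show ?thesis using normal by simp
  qed
  have pk: "prob ((\<lambda>\<omega>. Z T \<omega> $ k) -` A k \<inter> space M) = enn2real (\<integral>\<^sup>+x. ennreal (indicator (A k) x * ?n k x) \<partial>lborel)" 
    and fin: "(\<integral>\<^sup>+x. ennreal (indicator (A k) x * ?n k x) \<partial>lborel) < \<infinity>" for k
  proof -
    have "emeasure M ((\<lambda>\<omega>. Z T \<omega> $ k) -` A k \<inter> space M) = (\<integral>\<^sup>+x. ennreal (?n k x) * indicator (A k) x \<partial>lborel)"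
      by (rule distributed_emeasure[OF dist]) (auto simp: A_def)
    also have "\<dots> = (\<integral>\<^sup>+x. ennreal (indicator (A k) x * ?n k x) \<partial>lborel)"
      by (intro nn_integral_cong) (auto simp: indicator_def)
    finally have e: "emeasure M ((\<lambda>\<omega>. Z T \<omega> $ k) -` A k \<inter> space M) = \<dots>" .
    show "prob ((\<lambda>\<omega>. Z T \<omega> $ k) -` A k \<inter> space M) = enn2real (\<integral>\<^sup>+x. ennreal (indicator (A k) x * ?n k x) \<partial>lborel)"
      unfolding e[symmetric] by (simp add: measure_def)
    show "(\<integral>\<^sup>+x. ennreal (indicator (A k) x * ?n k x) \<partial>lborel) < \<infinity>"
      unfolding e[symmetric] by (simp add: emeasure_eq_measure)
  qed
  have "emeasure (distr M borel (Z T)) (box l u) = emeasure M (\<Inter>k\<in>UNIV. (\<lambda>\<omega>. Z T \<omega> $ k) -` A k \<inter> space M)"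
    by (subst emeasure_distr) (auto intro!: arg_cong[of _ _ "emeasure M"] simp: mem_box_cart A_def)
  also have "\<dots> = ennreal (\<Prod>k\<in>UNIV. prob ((\<lambda>\<omega>. Z T \<omega> $ k) -` A k \<inter> space M))"
    unfolding emeasure_eq_measure
    by (subst indep_varsD_finite[OF indep_Z_T]) (auto simp: A_def)
  also have "\<dots> = (\<Prod>k\<in>UNIV. ennreal (prob ((\<lambda>\<omega>. Z T \<omega> $ k) -` A k \<inter> space M)))"
    by (rule prod_ennreal[symmetric]) simp
  also have "\<dots> = (\<Prod>k\<in>UNIV. \<integral>\<^sup>+x. ennreal (indicator (A k) x * ?n k x) \<partial>lborel)"
    unfolding pk using fin by (intro prod.cong) auto
  also have "\<dots> = (\<integral>\<^sup>+z. (\<Prod>k\<in>UNIV. indicator (A k) (z $ k) * ?n k (z $ k)) \<partial>lborel)"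
    by (rule nn_integral_lborel_prod_vec[symmetric]) (auto simp: A_def)
  also have "\<dots> = (\<integral>\<^sup>+z. ennreal (\<Prod>i\<in>UNIV. ?n i (z $ i)) * indicator (box l u) z \<partial>lborel)"
  proof (rule nn_integral_cong)
    fix z :: "real^'d"
    have "(\<Prod>k\<in>UNIV. indicator (A k) (z $ k)) = (indicator (box l u) z :: real)"
      by (auto simp: indicator_def A_def mem_box_cart)
    then show "ennreal (\<Prod>k\<in>UNIV. indicator (A k) (z $ k) * ?n k (z $ k)) = ennreal (\<Prod>i\<in>UNIV. ?n i (z $ i)) * indicator (box l u) z"
      by (simp add: prod.distrib indicator_def)
  qed
  also have "\<dots> = emeasure (density lborel (\<lambda>z. ennreal (\<Prod>i\<in>UNIV. ?n i (z $ i)))) (box l u)"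
    by (subst emeasure_density) auto
  finally show "emeasure (distr M borel (Z T)) (box l u) = \<dots>" .
qed auto

lemma comb_exp_moment:
  assumes t: "t \<ge> 0"
  shows "integrable M (\<lambda>\<omega>. exp (a * (\<Sum>i\<in>UNIV. c i * Z t \<omega> $ i)))"
    and "expectation (\<lambda>\<omega>. exp (a * (\<Sum>i\<in>UNIV. c i * Z t \<omega> $ i))) = exp (a\<^sup>2 * (\<Sum>i\<in>UNIV. (c i)\<^sup>2 * v i t) / 2)"
proof -
  have eq: "exp (a * (\<Sum>i\<in>UNIV. c i * z $ i)) = (\<Prod>i\<in>UNIV. exp ((a * c i) * z $ i))" for z :: "real^'d"
    by (simp add: exp_sum[symmetric] sum_distrib_left mult.assoc)
  have ind: "indep_vars (\<lambda>_. borel) (\<lambda>i \<omega>. exp ((a * c i) * Z t \<omega> $ i)) (UNIV :: 'd set)"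
  proof -
    have "indep_vars (\<lambda>_. borel) (\<lambda>k \<omega>. (\<lambda>f. exp ((a * c k) * f t)) (\<lambda>t\<in>{0..}. Z t \<omega> $ k)) (UNIV :: 'd set)"
    proof (rule indep_vars_compose2[OF indep[unfolded independent_processes_def]])
      fix k
      have [measurable]: "(\<lambda>f. f t) \<in> borel_measurable (process_space {0..})"
        unfolding process_space_def using t by (intro measurable_component_singleton) auto
      show "(\<lambda>f. exp ((a * c k) * f t)) \<in> borel_measurable (process_space {0..})" by measurable
    qed
    then show ?thesis using t by simp
  qed
  have i: "integrable M (\<lambda>\<omega>. exp ((a * c i) * Z t \<omega> $ i))" for i
    by (rule gaussian_rv_exp_moment[OF Z_gauss[OF t] Z_mean[OF t]])
  show "integrable M (\<lambda>\<omega>. exp (a * (\<Sum>i\<in>UNIV. c i * Z t \<omega> $ i)))"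
    unfolding eq by (rule indep_vars_integrable[OF _ ind i]) auto
  have "expectation (\<lambda>\<omega>. exp (a * (\<Sum>i\<in>UNIV. c i * Z t \<omega> $ i))) = (\<Prod>i\<in>UNIV. expectation (\<lambda>\<omega>. exp ((a * c i) * Z t \<omega> $ i)))"
    unfolding eq by (rule indep_vars_lebesgue_integral[OF _ ind i]) auto
  also have "\<dots> = (\<Prod>i\<in>UNIV. exp ((a * c i)\<^sup>2 * v i t / 2))"
    by (simp add: gaussian_rv_exp_moment(2)[OF Z_gauss[OF t] Z_mean[OF t]] Z_second_moment[OF t])
  also have "\<dots> = exp (a\<^sup>2 * (\<Sum>i\<in>UNIV. (c i)\<^sup>2 * v i t) / 2)"
    by (simp add: exp_sum[symmetric] sum_distrib_left sum_divide_distrib power_mult_distrib mult.assoc)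
  finally show "expectation (\<lambda>\<omega>. exp (a * (\<Sum>i\<in>UNIV. c i * Z t \<omega> $ i))) = \<dots>" .
qed

text \<open>Chernoff bound for the projection of Z(t) to one direction; by independence only the
  variances of the coordinates enter.\<close>

lemma comb_tail:
  assumes t: "t \<ge> 0" and s: "(\<Sum>i\<in>UNIV. (c i)\<^sup>2 * v i t) \<le> s" "s > 0" and x: "x > 0"
  shows "prob {\<omega> \<in> space M. (\<Sum>i\<in>UNIV. c i * Z t \<omega> $ i) \<ge> x} \<le> exp (- (x\<^sup>2 / (2 * s)))"
proof -
  have [measurable]: "(\<lambda>\<omega>. Z t \<omega> $ i) \<in> borel_measurable M" for i using t by (rule Z_measurable)
  define a where "a = x / s"
  have a: "a > 0" using x s by (simp add: a_def)
  have "prob {\<omega> \<in> space M. (\<Sum>i\<in>UNIV. c i * Z t \<omega> $ i) \<ge> x} \<le> prob {\<omega> \<in> space M. exp (a * (\<Sum>i\<in>UNIV. c i * Z t \<omega> $ i)) \<ge> exp (a * x)}"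
    using a by (intro finite_measure_mono) auto
  also have "\<dots> \<le> expectation (\<lambda>\<omega>. exp (a * (\<Sum>i\<in>UNIV. c i * Z t \<omega> $ i))) / exp (a * x)"
    by (rule integral_Markov_inequality_measure[where A="{}"]) (auto intro: comb_exp_moment[OF t])
  also have "\<dots> = exp (a\<^sup>2 * (\<Sum>i\<in>UNIV. (c i)\<^sup>2 * v i t) / 2 - a * x)"
    by (simp add: comb_exp_moment(2)[OF t] exp_diff)
  also have "\<dots> \<le> exp (a\<^sup>2 * s / 2 - a * x)"
    using s by (simp add: mult_left_mono)
  also have "a\<^sup>2 * s / 2 - a * x = - (x\<^sup>2 / (2 * s))"
    unfolding a_def using s by (simp add: field_simps power2_eq_square)
  finally show ?thesis .
qed

end

subsection \<open>The quadratic program and the law at the final time\<close>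

lemma matrix_inv_eqI:
  fixes A B :: "'a::semiring_1^'n^'n"
  assumes "A ** B = mat 1" "B ** A = mat 1"
  shows "matrix_inv A = B"
proof -
  have "\<exists>B. A ** B = mat 1 \<and> B ** A = mat 1" using assms by blast
  then have "A ** matrix_inv A = mat 1 \<and> matrix_inv A ** A = mat 1"
    unfolding matrix_inv_def by (rule someI_ex)
  then have "matrix_inv A = (matrix_inv A ** A) ** B" by (metis assms(1) matrix_mul_assoc matrix_mul_rid)
  then show ?thesis using \<open>A ** matrix_inv A = mat 1 \<and> _\<close> by simp
qed

lemma invertible_matrix_inv:
  assumes "invertible (A :: real^'n^'n)"
  shows "A ** matrix_inv A = mat 1" "matrix_inv A ** A = mat 1"
  using assms matrix_inv_eqI unfolding invertible_def by metis+

lemma diag_mat_vector: "diag_mat w *v x = (\<chi> i. w $ i * x $ i)"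
  by (simp add: vec_eq_iff diag_mat_def matrix_vector_mult_def if_distrib[of "\<lambda>c. c * _"] cong: if_cong)

locale positive_form =
  fixes S :: "real^'n^'n" and al :: real and a :: "real^'n"
  assumes sym: "x \<bullet> (S *v y) = y \<bullet> (S *v x)" and al: "0 < al" and ge: "al * (x \<bullet> x) \<le> x \<bullet> (S *v x)"
begin

abbreviation "qf x \<equiv> x \<bullet> (S *v x)"
abbreviation "feasible x \<equiv> (\<forall>i. a $ i \<le> x $ i)"

lemma qf_cont: "continuous_on X (\<lambda>x. qf x)"
  by (intro continuous_intros matrix_vector_mult_linear_continuous_on)

lemma qf_add: "qf (x + y) = qf x + 2 * (y \<bullet> (S *v x)) + qf y"
  by (simp add: matrix_vector_right_distrib inner_add_left inner_add_right sym[of x y])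

lemma qf_scale: "qf (r *\<^sub>R x) = r\<^sup>2 * qf x"
  by (simp add: matrix_vector_mult_scaleR power2_eq_square)

lemma qf_nonneg: "0 \<le> qf x"
  using ge[of x] al by (meson inner_ge_zero mult_nonneg_nonneg order_trans less_imp_le)

text \<open>Outside the ball of radius sqrt (qf a / al), ellipticity makes the form larger than at
  the feasible point \<open>a\<close>; inside, compactness applies.\<close>

lemma minimizer_ex: "\<exists>x. is_arg_min qf feasible x"
proof -
  define R where "R = sqrt (qf a / al)"
  let ?K = "{x. \<forall>i. a $ i \<le> x $ i} \<inter> cball 0 R"
  have "al * (a \<bullet> a) \<le> qf a" by (rule ge)
  then have "a \<bullet> a \<le> qf a / al" using al by (simp add: field_simps)
  then have aR: "norm a \<le> R" unfolding R_def norm_eq_sqrt_inner by simp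
  have "closed {x. \<forall>i. a $ i \<le> x $ i}"
    by (intro closed_Collect_all closed_Collect_le continuous_intros)
  then have "compact ?K" by (simp add: compact_Int_closed Int_commute)
  moreover have "?K \<noteq> {}" using aR by auto
  ultimately obtain x where x: "x \<in> ?K" "\<And>y. y \<in> ?K \<Longrightarrow> qf x \<le> qf y"
    using continuous_attains_inf[OF _ _ qf_cont, of ?K] by blast
  have "\<not> qf y < qf x" if y: "feasible y" for y
  proof (cases "norm y \<le> R")
    case True
    then show ?thesis using x(2)[of y] y by auto
  next
    case False
    then have "qf a / al < y \<bullet> y" unfolding R_def norm_eq_sqrt_inner by simp
    then have "qf a < al * (y \<bullet> y)" using al by (simp add: field_simps)
    also have "\<dots> \<le> qf y" by (rule ge)
    finally have "qf a < qf y" .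
    moreover have "qf x \<le> qf a" using x(2)[of a] aR by auto
    ultimately show ?thesis by simp
  qed
  then show ?thesis using x(1) unfolding is_arg_min_def by auto
qed

lemma minimizer_variation:
  assumes x: "is_arg_min qf feasible x" and y: "feasible y"
  shows "(y - x) \<bullet> (S *v x) \<ge> 0"
proof (rule ccontr)
  assume neg: "\<not> ?thesis"
  define d where "d = y - x"
  define g where "g = d \<bullet> (S *v x)"
  have g: "g < 0" using neg by (simp add: g_def d_def)
  \<comment> \<open>A step small enough for the quadratic term t qf d not to exceed - g, half of
    what the linear term 2 g gains; the + 1 avoids division by 0.\<close>
  define t where "t = min 1 (- g / (qf d + 1))"
  have t: "0 < t" "t \<le> 1" using g qf_nonneg[of d] by (auto simp: t_def divide_neg_pos)
  have "feasible (x + t *\<^sub>R d)"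
  proof
    fix i
    have "(1 - t) * a $ i + t * a $ i \<le> (1 - t) * x $ i + t * y $ i"
      using t x y by (intro add_mono mult_left_mono) (auto simp: is_arg_min_def)
    then show "a $ i \<le> (x + t *\<^sub>R d) $ i" by (simp add: d_def algebra_simps)
  qed
  then have "qf (x + t *\<^sub>R d) \<ge> qf x" using x unfolding is_arg_min_def by (meson not_less)
  then have "0 \<le> t * (2 * g + t * qf d)"
    unfolding qf_add by (simp add: qf_scale g_def power2_eq_square algebra_simps)
  then have "0 \<le> 2 * g + t * qf d" using t by (simp add: zero_le_mult_iff)
  moreover have "t * qf d \<le> - g"
  proof -
    have "t * qf d \<le> (- g / (qf d + 1)) * qf d" unfolding t_def using qf_nonneg[of d] by (intro mult_right_mono) auto
    also have "\<dots> \<le> - g" using g qf_nonneg[of d] by (simp add: field_simps)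
    finally show ?thesis .
  qed
  ultimately show False using g by simp
qed

text \<open>Each minimizer is tested against the other; the sum of the two variational inequalities
  bounds the form at the difference by 0.\<close>

lemma minimizer_unique:
  assumes x: "is_arg_min qf feasible x" and y: "is_arg_min qf feasible y"
  shows "x = y"
proof -
  have "(y - x) \<bullet> (S *v x) \<ge> 0" "(x - y) \<bullet> (S *v y) \<ge> 0"
    using minimizer_variation x y by (auto simp: is_arg_min_def)
  then have "(y - x) \<bullet> (S *v (y - x)) \<le> 0"
    by (simp add: matrix_vector_mult_diff_distrib inner_diff_left inner_diff_right)
  with ge[of "y - x"] have "al * ((y - x) \<bullet> (y - x)) \<le> 0" by linarith
  then have "(y - x) \<bullet> (y - x) \<le> 0" using al by (simp add: mult_le_0_iff)
  then show ?thesis by (metis eq_iff_diff_eq_0 inner_ge_zero inner_eq_zero_iff antisym) 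
qed

text \<open>The variational inequality is tested in a coordinate direction: moving up shows the
  sign, moving down to the constraint shows complementary slackness.\<close>

lemma minimizer_KKT:
  assumes x: "is_arg_min qf feasible x"
  defines "l \<equiv> S *v x"
  shows "0 \<le> l $ i" and "0 < l $ i \<Longrightarrow> x $ i = a $ i"
proof -
  have f: "feasible x" using x by (simp add: is_arg_min_def)
  have "(x + axis i 1 - x) \<bullet> l \<ge> 0" unfolding l_def
    using f by (intro minimizer_variation[OF x]) (auto simp: axis_def add_increasing2)
  then show "0 \<le> l $ i" by (simp add: inner_axis')
  have "(x + axis i (a $ i - x $ i) - x) \<bullet> l \<ge> 0" unfolding l_def
    using f by (intro minimizer_variation[OF x]) (auto simp: axis_def)
  then have "(a $ i - x $ i) * l $ i \<ge> 0" by (simp add: inner_axis')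
  moreover have "a $ i \<le> x $ i" using f by simp
  ultimately show "x $ i = a $ i" if "0 < l $ i" using that by (simp add: zero_le_mult_iff)
qed

end

section \<open>The data of the theorem and the law of X(T) around its most likely exceedance\<close>

locale exceedance = gauss_process M Z v dv T for M :: "'w measure" and Z :: "real \<Rightarrow> 'w \<Rightarrow> real^'d" and v dv T +
  fixes A :: "real^'d^'d" and a c :: "real^'d"
  assumes A_inv: "invertible A" and a_pos: "\<exists>i. a $ i > 0"
begin

definition Sig :: "real^'d^'d" where "Sig = A ** diag_mat (\<chi> i. v i T) ** transpose A"
definition S :: "real^'d^'d" where "S = matrix_inv Sig"
definition Ai :: "real^'d^'d" where "Ai = matrix_inv A"
definition Q :: "real^'d^'d" where "Q = diag_mat (\<chi> i. dv i T / v i T)"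
definition atil :: "real^'d" where "atil = qp_solution Sig a"
definition lam :: "real^'d" where "lam = S *v atil"
definition w :: "real^'d" where "w = (A ** Q ** Ai) *v atil"
text \<open>The vector Z(T) is close to u times this one when X(T) is close to u atil.\<close>

definition zt :: "real^'d" where "zt = Ai *v atil"
text \<open>The minimal value of the quadratic form: exceedance at T has exponential rate m u^2 /
  2.\<close>

definition m :: real where "m = lam \<bullet> atil"

lemma A_Ai: "A *v (Ai *v x) = x" "Ai *v (A *v x) = x" "A ** Ai = mat 1" "Ai ** A = mat 1"
  using invertible_matrix_inv[OF A_inv] by (simp_all add: Ai_def matrix_vector_mul_assoc)

lemma S_eq: "S = transpose Ai ** diag_mat (\<chi> i. 1 / v i T) ** Ai"
  unfolding S_def
proof (rule matrix_inv_eqI)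
  have t: "transpose A ** transpose Ai = mat 1" "transpose Ai ** transpose A = mat 1"
    by (metis A_Ai(3,4) matrix_transpose_mul transpose_mat)+
  have vn: "v i T \<noteq> 0" for i using v_T_pos[of i] by simp
  have d: "diag_mat (\<chi> i. v i T) ** diag_mat (\<chi> i. 1 / v i T) = mat 1" "diag_mat (\<chi> i. 1 / v i T) ** diag_mat (\<chi> i. v i T) = mat 1"
    unfolding matrix_eq matrix_vector_mul_assoc[symmetric] diag_mat_vector by (simp_all add: vec_eq_iff vn)
  show "Sig ** (transpose Ai ** diag_mat (\<chi> i. 1 / v i T) ** Ai) = mat 1"
    unfolding Sig_def by (metis A_Ai(3) d(1) matrix_mul_assoc matrix_mul_rid t(1))
  show "(transpose Ai ** diag_mat (\<chi> i. 1 / v i T) ** Ai) ** Sig = mat 1"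
    unfolding Sig_def by (metis A_Ai(4) d(2) matrix_mul_assoc matrix_mul_rid t(2))
qed

lemma S_form: "x \<bullet> (S *v y) = (\<Sum>i\<in>UNIV. (Ai *v x) $ i * (Ai *v y) $ i / v i T)"
proof -
  have "x \<bullet> (S *v y) = x \<bullet> (transpose Ai *v (diag_mat (\<chi> i. 1 / v i T) *v (Ai *v y)))"
    unfolding S_eq by (simp add: matrix_vector_mul_assoc matrix_mul_assoc)
  also have "\<dots> = (Ai *v x) \<bullet> (diag_mat (\<chi> i. 1 / v i T) *v (Ai *v y))"
    by (metis dot_lmul_matrix inner_commute vector_transpose_matrix transpose_matrix_vector)
  also have "\<dots> = (\<Sum>i\<in>UNIV. (Ai *v x) $ i * (Ai *v y) $ i / v i T)"
    unfolding diag_mat_vector by (simp add: inner_vec_real)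
  finally show ?thesis .
qed

lemma S_sym: "x \<bullet> (S *v y) = y \<bullet> (S *v x)"
  unfolding S_form by (simp add: mult.commute)

lemma S_pos_ex: "\<exists>al>0. \<forall>x. al * (x \<bullet> x) \<le> x \<bullet> (S *v x)"
proof -
  obtain B where B: "B > 0" "\<And>x. norm (A *v x) \<le> B * norm x"
    using linear_bounded_pos[of "(*v) A"] matrix_vector_mul_linear by (metis mult.commute)
  define V where "V = (\<Sum>i\<in>UNIV. v i T)"
  have vV: "v i T \<le> V" for i unfolding V_def using v_T_pos by (intro member_le_sum) (auto intro: less_imp_le)
  have V: "V > 0" unfolding V_def using v_T_pos by (intro sum_pos) auto
  have "1 / (B\<^sup>2 * V) * (x \<bullet> x) \<le> x \<bullet> (S *v x)" for x
  proof -
    have "norm x \<le> B * norm (Ai *v x)" using B(2)[of "Ai *v x"] by (simp add: A_Ai)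
    then have "(norm x)\<^sup>2 \<le> (B * norm (Ai *v x))\<^sup>2" by (intro power_mono) auto
    then have "x \<bullet> x \<le> B\<^sup>2 * ((Ai *v x) \<bullet> (Ai *v x))" by (simp add: power_mult_distrib power2_norm_eq_inner)
    also have "(Ai *v x) \<bullet> (Ai *v x) \<le> V * (x \<bullet> (S *v x))"
      unfolding S_form unfolding inner_vec_real sum_distrib_left
    proof (rule sum_mono)
      fix i
      have "1 \<le> V / v i T" using vV[of i] v_T_pos[of i] by simp
      then have "1 * ((Ai *v x) $ i * (Ai *v x) $ i) \<le> V / v i T * ((Ai *v x) $ i * (Ai *v x) $ i)"
        by (intro mult_right_mono) auto
      then show "(Ai *v x) $ i * (Ai *v x) $ i \<le> V * ((Ai *v x) $ i * (Ai *v x) $ i / v i T)" by simp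
    qed
    finally show ?thesis using B V by (simp add: field_simps)
  qed
  then show ?thesis using B V by (intro exI[of _ "1 / (B\<^sup>2 * V)"]) auto
qed

definition al :: real where "al = (SOME al. al > 0 \<and> (\<forall>x. al * (x \<bullet> x) \<le> x \<bullet> (S *v x)))"

lemma al_facts: "al > 0" "al * (x \<bullet> x) \<le> x \<bullet> (S *v x)"
  using someI_ex[OF S_pos_ex] unfolding al_def by blast+

sublocale positive_form S al a
  by standard (auto intro: S_sym al_facts)

lemma qp_sol_iff: "is_qp_solution Sig a x \<longleftrightarrow> is_arg_min qf feasible x"
  by (simp add: is_qp_solution_def S_def)

lemma qp_ex1: "\<exists>!x. is_qp_solution Sig a x"
  unfolding qp_sol_iff using minimizer_ex minimizer_unique by blast

lemma atil_min: "is_arg_min qf feasible atil"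
  using theI'[OF qp_ex1] unfolding qp_sol_iff atil_def qp_solution_def .

lemma atil_feasible: "a $ i \<le> atil $ i"
  using atil_min by (simp add: is_arg_min_def)

lemma atil_nz: "atil \<noteq> 0"
proof
  assume "atil = 0"
  obtain i where "a $ i > 0" using a_pos by blast
  then show False using atil_feasible[of i] \<open>atil = 0\<close> by simp
qed

lemma m_eq: "m = qf atil" unfolding m_def lam_def by (simp add: inner_commute)

lemma m_pos: "m > 0"
proof -
  have "0 < al * (atil \<bullet> atil)" using al_facts(1) atil_nz by simp
  also have "\<dots> \<le> m" unfolding m_eq by (rule al_facts)
  finally show ?thesis .
qed

lemma lam_ge0: "0 \<le> lam $ i" and lam_tight: "0 < lam $ i \<Longrightarrow> atil $ i = a $ i"
  using minimizer_KKT[OF atil_min] by (auto simp: lam_def)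

lemma lam_ex: "\<exists>i. 0 < lam $ i"
proof (rule ccontr)
  assume "\<not> ?thesis"
  then have "lam = 0" using lam_ge0 by (auto simp: vec_eq_iff not_less intro: antisym)
  then show False using m_pos by (simp add: m_def)
qed

sublocale orthant_weight lam by standard (auto intro: lam_ge0 lam_ex)

sublocale gauss_orthant lam S al "a - atil" "T *\<^sub>R c"
  by standard (auto intro: al_facts simp: atil_feasible lam_tight)

lemma lam_a: "lam \<bullet> a = m"
proof -
  have eq: "lam $ i * a $ i = lam $ i * atil $ i" for i
    using lam_tight[of i] lam_not_pos[of i] by (cases "0 < lam $ i") auto
  show ?thesis unfolding m_def inner_vec_real by (simp only: eq)
qed

lemma w_eq: "w = A *v (\<chi> i. dv i T / v i T * zt $ i)"
  unfolding w_def zt_def Q_def by (simp add: matrix_vector_mul_assoc[symmetric] diag_mat_vector)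

lemma lam_w_pos: "lam \<bullet> w > 0"
proof -
  have "lam \<bullet> w = (\<Sum>i\<in>UNIV. dv i T / (v i T)\<^sup>2 * (zt $ i)\<^sup>2)"
    unfolding lam_def by (subst inner_commute) (simp add: S_form w_eq A_Ai zt_def[symmetric] power2_eq_square field_simps)
  moreover have "zt \<noteq> 0" using atil_nz A_Ai(1)[of atil] by (auto simp: zt_def)
  then obtain i where "zt $ i \<noteq> 0" by (auto simp: vec_eq_iff)
  then have "(\<Sum>i\<in>UNIV. dv i T / (v i T)\<^sup>2 * (zt $ i)\<^sup>2) > 0"
    by (intro sum_pos2[of _ i] mult_pos_pos divide_pos_pos mult_nonneg_nonneg divide_nonneg_pos)
      (auto simp: dv_pos v_T_pos less_imp_le less_imp_neq[OF v_T_pos, symmetric])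
  ultimately show ?thesis by simp
qed

lemma sweep_const_pos: "sweep_const w > 0"
proof -
  have "0 < lam \<bullet> w" by (rule lam_w_pos)
  also have "\<dots> \<le> (\<Sum>i\<in>UNIV. max (lam $ i * w $ i) 0)" unfolding inner_vec_real by (intro sum_mono) auto
  finally show ?thesis unfolding sweep_const_def using lam_w_pos by simp
qed

definition excess :: "real \<Rightarrow> 'w \<Rightarrow> real^'d" where
  "excess u \<omega> = A *v Z T \<omega> - T *\<^sub>R c - u *\<^sub>R atil"

definition PT :: "real \<Rightarrow> (real^'d) set \<Rightarrow> real" where
  "PT u E = prob {\<omega> \<in> space M. excess u \<omega> \<in> E}"

lemma ZT_measurable [measurable]: "Z T \<in> borel_measurable M"
  using T_pos by (intro Z_vec_measurable) auto

lemma excess_measurable [measurable]: "excess u \<in> borel_measurable M"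
  unfolding excess_def by measurable

lemma gauss_density: "(\<Prod>i\<in>UNIV. normal_density 0 (sqrt (v i T)) (z $ i)) =
    (\<Prod>i\<in>UNIV. 1 / sqrt (2 * pi * v i T)) * exp (- (qf (A *v z) / 2))"
proof -
  have "(\<Prod>i\<in>UNIV. normal_density 0 (sqrt (v i T)) (z $ i)) = (\<Prod>i\<in>UNIV. 1 / sqrt (2 * pi * v i T) * exp (- ((z $ i)\<^sup>2 / (2 * v i T))))"
    using v_T_pos by (intro prod.cong) (auto simp: normal_density_def less_imp_le)
  also have "\<dots> = (\<Prod>i\<in>UNIV. 1 / sqrt (2 * pi * v i T)) * exp (\<Sum>i\<in>UNIV. - ((z $ i)\<^sup>2 / (2 * v i T)))"
    by (simp add: prod.distrib[symmetric] exp_sum)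
  also have "(\<Sum>i\<in>UNIV. - ((z $ i)\<^sup>2 / (2 * v i T))) = - (qf (A *v z) / 2)"
    unfolding S_form A_Ai by (simp add: sum_negf sum_divide_distrib power2_eq_square field_simps)
  finally show ?thesis .
qed

text \<open>Expanding the form around u atil gives the constant u^2 m, the cross term 2 u lam
  \<bullet> (x + T c), and a form free of u. What does not depend on x is a common factor, which
  cancels in ratios.\<close>

lemma PT_eq_wt: "\<exists>kap>0. \<forall>u. \<forall>E\<in>sets borel. PT u E = kap * exp (- (u\<^sup>2 * m / 2 + u * (lam \<bullet> (T *\<^sub>R c)))) * wt u E"
proof -
  define c0 where "c0 = (\<Prod>i\<in>UNIV. 1 / sqrt (2 * pi * v i T))"
  have c0: "c0 > 0" unfolding c0_def using v_T_pos by (intro prod_pos) auto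
  obtain c1 where c1: "c1 > 0" "\<And>f. f \<in> borel_measurable borel \<Longrightarrow> (\<integral>\<^sup>+x. f (A *v x) \<partial>lborel) = ennreal c1 * (\<integral>\<^sup>+x. f x \<partial>lborel)"
    using nn_integral_lborel_linear_ex[OF A_inv] by blast
  have "PT u E = c0 * c1 * exp (- (u\<^sup>2 * m / 2 + u * (lam \<bullet> (T *\<^sub>R c)))) * wt u E"
    if [measurable]: "E \<in> sets borel" for u E
  proof -
    define y where "y = T *\<^sub>R c + u *\<^sub>R atil"
    define r where "r = exp (- (u\<^sup>2 * m / 2 + u * (lam \<bullet> (T *\<^sub>R c))))"
    define W where "W = (\<integral>\<^sup>+x. indicator E x * ennreal (exp (- (u * (lam \<bullet> x))) * gform x) \<partial>lborel)"
    have [measurable]: "(\<lambda>z. A *v z - y) -` E \<in> sets borel"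
      using measurable_sets[of "\<lambda>z. A *v z - y" borel borel E] by simp
    have ex: "excess u \<omega> = A *v Z T \<omega> - y" for \<omega> by (simp add: excess_def y_def)
    have "emeasure M {\<omega> \<in> space M. excess u \<omega> \<in> E} = emeasure (distr M borel (Z T)) ((\<lambda>z. A *v z - y) -` E)"
      by (subst emeasure_distr) (auto simp: ex measurable_sets_borel intro!: arg_cong[of _ _ "emeasure M"])
    also have "\<dots> = (\<integral>\<^sup>+z. ennreal (c0 * exp (- (qf (A *v z) / 2))) * indicator ((\<lambda>z. A *v z - y) -` E) z \<partial>lborel)"
      unfolding Z_T_density gauss_density c0_def[symmetric]
      by (subst emeasure_density) (auto simp: measurable_sets_borel)
    also have "\<dots> = (\<integral>\<^sup>+z. (\<lambda>x. ennreal (c0 * exp (- (qf x / 2))) * indicator E (x - y)) (A *v z) \<partial>lborel)"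
      by (intro nn_integral_cong) (auto simp: indicator_def)
    also have "\<dots> = ennreal c1 * (\<integral>\<^sup>+x. ennreal (c0 * exp (- (qf x / 2))) * indicator E (x - y) \<partial>lborel)"
      by (rule c1(2)) simp
    also have "(\<integral>\<^sup>+x. ennreal (c0 * exp (- (qf x / 2))) * indicator E (x - y) \<partial>lborel) =
       (\<integral>\<^sup>+x. ennreal (c0 * exp (- (qf (x + y) / 2))) * indicator E (x + y - y) \<partial>lborel)"
      by (rule nn_integral_lborel_translate[symmetric]) simp
    also have "\<dots> = (\<integral>\<^sup>+x. ennreal (c0 * r) * (indicator E x * ennreal (exp (- (u * (lam \<bullet> x))) * gform x)) \<partial>lborel)"
    proof (rule nn_integral_cong)
      fix x
      have "qf (x + y) = qf ((x + T *\<^sub>R c) + u *\<^sub>R atil)" by (simp add: y_def add.assoc)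
      also have "\<dots> = qf (x + T *\<^sub>R c) + 2 * u * (lam \<bullet> (x + T *\<^sub>R c)) + u\<^sup>2 * m"
      proof -
        have "(u *\<^sub>R atil) \<bullet> (S *v (x + T *\<^sub>R c)) = u * ((x + T *\<^sub>R c) \<bullet> (S *v atil))"
          by (simp only: inner_scaleR_left S_sym[of atil "x + T *\<^sub>R c"])
        also have "\<dots> = u * (lam \<bullet> (x + T *\<^sub>R c))" unfolding lam_def by (simp only: inner_commute)
        finally show ?thesis unfolding qf_add qf_scale m_eq by simp
      qed
      finally have "- (qf (x + y) / 2) = - (u\<^sup>2 * m / 2 + u * (lam \<bullet> (T *\<^sub>R c))) + (- (u * (lam \<bullet> x)) + - (qf (x + T *\<^sub>R c) / 2))"
        by (simp add: inner_add_right algebra_simps)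
      then have "exp (- (qf (x + y) / 2)) = r * (exp (- (u * (lam \<bullet> x))) * gform x)"
        unfolding r_def gform_def by (simp add: exp_add[symmetric])
      then show "ennreal (c0 * exp (- (qf (x + y) / 2))) * indicator E (x + y - y) = ennreal (c0 * r) * (indicator E x * ennreal (exp (- (u * (lam \<bullet> x))) * gform x))"
        using c0 by (auto simp: indicator_def r_def gform_nonneg ennreal_mult[symmetric] mult.assoc)
    qed
    also have "\<dots> = ennreal (c0 * r) * W"
      unfolding W_def by (rule nn_integral_cmult) simp
    finally have "PT u E = enn2real (ennreal c1 * (ennreal (c0 * r) * W))"
      unfolding PT_def measure_def by simp
    also have "\<dots> = c0 * c1 * r * wt u E"
      using c0 c1(1) by (simp add: enn2real_mult wt_def W_def[symmetric] r_def)
    finally show ?thesis by (simp add: r_def)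
  qed
  then show ?thesis using c0 c1(1) by (intro exI[of _ "c0 * c1"]) auto
qed

lemma PT_ratio: 
  obtains kap where "kap > 0" "\<And>u E F. E \<in> sets borel \<Longrightarrow> F \<in> sets borel \<Longrightarrow> PT u E / PT u F = wt u E / wt u F"
    "\<And>u. PT u (corner u) = kap * exp (- (u\<^sup>2 * m / 2 + u * (lam \<bullet> (T *\<^sub>R c)))) * wt u (corner u)"
  using PT_eq_wt by (elim exE conjE) (rule that; auto)

lemma PT_sweep_ratio:
  assumes "lam \<bullet> w' > 0" "de > 0" "ep > 0"
  shows "((\<lambda>u. PT u (sweep_event u w' r de ep) / PT u (corner u)) \<longlongrightarrow> sweep_const w' * exp (- (r * (\<Sum>i\<in>UNIV. lam $ i)))) at_top"
proof (rule PT_ratio)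
  fix kap assume "\<And>u E F. E \<in> sets borel \<Longrightarrow> F \<in> sets borel \<Longrightarrow> PT u E / PT u F = wt u E / wt u F"
  then show ?thesis using wt_ratio[OF assms, of r] by simp
qed

lemma PT_corner_pos: "eventually (\<lambda>u. PT u (corner u) > 0) at_top"
proof -
  obtain K where "K > 0" "eventually (\<lambda>u. K / u ^ CARD('d) \<le> wt u (corner u)) at_top"
    using wt_corner_lower by blast
  from this(2) have "eventually (\<lambda>u. 0 < wt u (corner u)) at_top"
    using eventually_gt_at_top[of 0]
  proof eventually_elim
    case (elim u)
    have "0 < K / u ^ CARD('d)" using elim \<open>K > 0\<close> by simp
    with elim show ?case by linarith
  qed
  then show ?thesis
    using PT_eq_wt by (elim exE conjE) (auto elim!: eventually_mono)
qed

lemma PT_sweep_bound: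
  assumes "lam \<bullet> w' > 0"
  shows "\<exists>K>0. eventually (\<lambda>u. \<forall>r\<ge>0. \<forall>de ep. PT u (sweep_event u w' (- r) de ep)
      \<le> K * exp (r * (\<Sum>i\<in>UNIV. lam $ i)) * PT u (corner u)) at_top"
proof -
  obtain kap where kap: "kap > 0" "\<And>u E. E \<in> sets borel \<Longrightarrow> PT u E = kap * exp (- (u\<^sup>2 * m / 2 + u * (lam \<bullet> (T *\<^sub>R c)))) * wt u E"
    using PT_eq_wt by blast
  obtain K where K: "K > 0" "eventually (\<lambda>u. \<forall>r\<ge>0. \<forall>de ep. wt u (sweep_event u w' (- r) de ep)
      \<le> K * exp (r * (\<Sum>i\<in>UNIV. lam $ i)) * wt u (corner u)) at_top"
    using wt_sweep_event_bound[OF assms] by blast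
  from K(2) have "eventually (\<lambda>u. \<forall>r\<ge>0. \<forall>de ep. PT u (sweep_event u w' (- r) de ep)
      \<le> K * exp (r * (\<Sum>i\<in>UNIV. lam $ i)) * PT u (corner u)) at_top"
  proof eventually_elim
    case (elim u)
    show ?case
    proof (intro allI impI)
      fix r de ep :: real assume "r \<ge> 0"
      then have "kap * exp (- (u\<^sup>2 * m / 2 + u * (lam \<bullet> (T *\<^sub>R c)))) * wt u (sweep_event u w' (- r) de ep)
        \<le> kap * exp (- (u\<^sup>2 * m / 2 + u * (lam \<bullet> (T *\<^sub>R c)))) * (K * exp (r * (\<Sum>i\<in>UNIV. lam $ i)) * wt u (corner u))"
        using elim kap(1) by (intro mult_left_mono) auto
      then show "PT u (sweep_event u w' (- r) de ep) \<le> K * exp (r * (\<Sum>i\<in>UNIV. lam $ i)) * PT u (corner u)"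
        by (simp add: kap(2) mult_ac)
    qed
  qed
  with K(1) show ?thesis by blast
qed

text \<open>The probability of the corner is exp (- m u^2 / 2) up to a factor exponential in u and a
  power of u, and a larger rate beats both.\<close>

lemma exp_negligible:
  assumes "m < m'"
  shows "((\<lambda>u. exp (- (m' * u\<^sup>2 / 2)) / PT u (corner u)) \<longlongrightarrow> 0) at_top"
proof -
  obtain kap where kap: "kap > 0" "\<And>u E. E \<in> sets borel \<Longrightarrow> PT u E = kap * exp (- (u\<^sup>2 * m / 2 + u * (lam \<bullet> (T *\<^sub>R c)))) * wt u E"
    using PT_eq_wt by blast
  obtain K where K: "K > 0" "eventually (\<lambda>u. K / u ^ CARD('d) \<le> wt u (corner u)) at_top"
    using wt_corner_lower by blast
  define l where "l = \<bar>lam \<bullet> (T *\<^sub>R c)\<bar>"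
  define e where "e = (m' - m) / 2"
  have e: "e > 0" using assms by (simp add: e_def)
  have lim: "((\<lambda>u. 1 / (kap * K) * (u ^ CARD('d) / exp u)) \<longlongrightarrow> 1 / (kap * K) * 0) at_top"
    by (intro tendsto_mult tendsto_const tendsto_power_div_exp_0)
  show ?thesis
  proof (rule tendsto_sandwich)
    show "((\<lambda>_::real. 0) \<longlongrightarrow> 0) at_top" by simp
    show "((\<lambda>u. 1 / (kap * K) * (u ^ CARD('d) / exp u)) \<longlongrightarrow> 0) at_top" using lim by simp
    show "\<forall>\<^sub>F u in at_top. 0 \<le> exp (- (m' * u\<^sup>2 / 2)) / PT u (corner u)"
      using PT_corner_pos by eventually_elim simp
    show "\<forall>\<^sub>F u in at_top. exp (- (m' * u\<^sup>2 / 2)) / PT u (corner u) \<le> 1 / (kap * K) * (u ^ CARD('d) / exp u)"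
      using K(2) eventually_gt_at_top[of 0] eventually_ge_at_top[of "(l + 1) / e"]
    proof eventually_elim
      case (elim u)
      define p where "p = K / u ^ CARD('d)"
      have p: "p > 0" using elim K by (simp add: p_def)
      \<comment> \<open>The gain e u^2 in the exponent pays l u for the linear term and leaves exp
        (- u) to absorb the power of u.\<close>
      have "(l + 1) * u \<le> (e * u) * u" using elim e by (intro mult_right_mono) (auto simp: field_simps)
      moreover have "u * (lam \<bullet> (T *\<^sub>R c)) \<le> u * l" using elim unfolding l_def by (intro mult_left_mono) auto
      ultimately have ex: "- (m' * u\<^sup>2 / 2) \<le> - u + - (u\<^sup>2 * m / 2 + u * (lam \<bullet> (T *\<^sub>R c)))"
        by (simp add: e_def power2_eq_square field_simps)
      have "kap * exp (- (u\<^sup>2 * m / 2 + u * (lam \<bullet> (T *\<^sub>R c)))) * p \<le> PT u (corner u)"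
        unfolding kap(2)[OF gauss_borel_sets(1)] p_def using elim(1) kap(1) by (intro mult_left_mono) auto
      then have "exp (- (m' * u\<^sup>2 / 2)) / PT u (corner u) \<le> exp (- u + - (u\<^sup>2 * m / 2 + u * (lam \<bullet> (T *\<^sub>R c)))) / (kap * exp (- (u\<^sup>2 * m / 2 + u * (lam \<bullet> (T *\<^sub>R c)))) * p)"
        using ex kap(1) p by (intro frac_le) auto
      also have "\<dots> = exp (- u) / (kap * p)" unfolding exp_add by simp
      also have "\<dots> = 1 / (kap * K) * (u ^ CARD('d) / exp u)"
        by (simp add: p_def exp_minus field_simps)
      finally show ?case .
    qed
  qed
qed

end

subsection \<open>Exceedance close to the final time\<close>

context exceedance begin

text \<open>Chaining without conditioning, with \<open>G\<close> the whole space, for the process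
  started at \<open>s0\<close>.\<close>

lemma Z_oscillation:
  assumes s0: "s0 \<ge> 0" and L: "L > 0" and eta: "eta > 0" "\<And>h. 0 < h \<Longrightarrow> h \<le> L \<Longrightarrow> v i h \<le> eta * h" and x: "x > 0"
  shows "\<exists>D\<in>events. prob D \<le> 4 ^ 8 * exp (- (x\<^sup>2 / (32 * eta * L))) \<and>
    (AE \<omega> in M. \<omega> \<notin> D \<longrightarrow> (\<forall>t\<in>{s0..s0 + L}. \<bar>Z t \<omega> $ i - Z s0 \<omega> $ i\<bar> \<le> x))"
proof -
  have "\<exists>D\<in>events. prob D \<le> 4 ^ 8 * exp (- (x\<^sup>2 / (32 * eta * L))) * prob (space M) \<and>
     (AE \<omega> in M. \<omega> \<in> space M \<longrightarrow> \<omega> \<notin> D \<longrightarrow> (\<forall>h\<in>{0..L}. \<bar>Z (s0 + h) \<omega> $ i - Z (s0 + 0) \<omega> $ i\<bar> \<le> x))"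
  proof (rule dyadic_chaining[OF L eta(1) x])
    show "(\<lambda>\<omega>. Z (s0 + t) \<omega> $ i) \<in> borel_measurable M" if "t \<in> {0..L}" for t
      using that s0 by (intro Z_measurable) auto
    show "AE \<omega> in M. continuous_on {0..L} (\<lambda>t. Z (s0 + t) \<omega> $ i)"
      using cont_paths[of i]
    proof eventually_elim
      case (elim \<omega>)
      show ?case
        by (rule continuous_on_compose2[OF elim, of _ "\<lambda>t. s0 + t"]) (use s0 in \<open>auto intro!: continuous_intros\<close>)
    qed
    fix s t y :: real assume st: "0 \<le> s" "s < t" "t \<le> L" "0 < y"
    let ?U = "\<lambda>\<omega>. Z (s0 + t) \<omega> $ i - Z (s0 + s) \<omega> $ i"
    have "gaussian_rv M (\<lambda>\<omega>. 1 * Z (s0 + t) \<omega> $ i + (- 1) * Z (s0 + s) \<omega> $ i + 0 * Z (s0 + s) \<omega> $ i)"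
      by (rule gaussian_process_comb3[OF gauss]) (use st s0 in auto)
    then have g: "gaussian_rv M ?U" by simp
    have "prob {\<omega> \<in> space M. \<bar>?U \<omega>\<bar> > y} \<le> 2 * exp (- (y\<^sup>2 / (2 * (eta * (t - s)))))"
    proof (rule gaussian_rv_tail[OF g])
      show "expectation ?U = 0" using st s0 by (simp add: Z_integrable Z_mean)
      show "expectation (\<lambda>\<omega>. (?U \<omega>)\<^sup>2) \<le> eta * (t - s)"
        using Z_increment[of "s0 + s" "s0 + t" i] eta(2)[of "t - s"] st s0 by simp
    qed (use st eta in auto)
    then show "prob {\<omega> \<in> space M. \<bar>?U \<omega>\<bar> > y} \<le> 2 * exp (- (y\<^sup>2 / (2 * eta * (t - s)))) * prob (space M)"
      by (simp add: prob_space mult.assoc)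
  qed auto
  then obtain D where D: "D \<in> events" "prob D \<le> 4 ^ 8 * exp (- (x\<^sup>2 / (32 * eta * L)))"
    "AE \<omega> in M. \<omega> \<in> space M \<longrightarrow> \<omega> \<notin> D \<longrightarrow> (\<forall>h\<in>{0..L}. \<bar>Z (s0 + h) \<omega> $ i - Z (s0 + 0) \<omega> $ i\<bar> \<le> x)"
    by (auto simp: prob_space)
  have "AE \<omega> in M. \<omega> \<notin> D \<longrightarrow> (\<forall>t\<in>{s0..s0 + L}. \<bar>Z t \<omega> $ i - Z s0 \<omega> $ i\<bar> \<le> x)"
    using D(3) AE_space
  proof eventually_elim
    case (elim \<omega>)
    show ?case
    proof (intro impI ballI)
      fix t assume "\<omega> \<notin> D" "t \<in> {s0..s0 + L}"
      then show "\<bar>Z t \<omega> $ i - Z s0 \<omega> $ i\<bar> \<le> x"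
        using elim by (auto dest!: bspec[of _ _ "t - s0"])
    qed
  qed
  with D show ?thesis by blast
qed

lemma ex_event_all_coordinates:
  fixes P :: "'d \<Rightarrow> 'w \<Rightarrow> bool"
  assumes "\<And>i. \<exists>D\<in>events. prob D \<le> b \<and> (AE \<omega> in M. \<omega> \<notin> D \<longrightarrow> P i \<omega>)"
  shows "\<exists>D\<in>events. prob D \<le> real CARD('d) * b \<and> (AE \<omega> in M. \<omega> \<notin> D \<longrightarrow> (\<forall>i. P i \<omega>))"
proof -
  have "\<exists>D. \<forall>i. D i \<in> events \<and> prob (D i) \<le> b \<and> (AE \<omega> in M. \<omega> \<notin> D i \<longrightarrow> P i \<omega>)"
    using assms by (intro choice) blast
  then obtain D where D: "\<And>i. D i \<in> events" "\<And>i. prob (D i) \<le> b" "\<And>i. AE \<omega> in M. \<omega> \<notin> D i \<longrightarrow> P i \<omega>"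
    by blast
  have "prob (\<Union>i\<in>UNIV. D i) \<le> (\<Sum>i\<in>UNIV. prob (D i))"
    by (intro finite_measure_subadditive_finite) (use D(1) in auto)
  also have "\<dots> \<le> (\<Sum>i\<in>(UNIV::'d set). b)" by (intro sum_mono D(2))
  finally have "prob (\<Union>i\<in>UNIV. D i) \<le> real CARD('d) * b" by simp
  moreover have "AE \<omega> in M. \<forall>i\<in>UNIV. \<omega> \<notin> D i \<longrightarrow> P i \<omega>" using D(3) by (intro AE_finite_allI) auto
  then have "AE \<omega> in M. \<omega> \<notin> (\<Union>i\<in>UNIV. D i) \<longrightarrow> (\<forall>i. P i \<omega>)" by eventually_elim auto
  moreover have "(\<Union>i\<in>UNIV. D i) \<in> events" using D(1) by auto
  ultimately show ?thesis by blast
qed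

lemma v_continuous: "continuous_on {0..T} (v i)"
  using v_deriv by (rule DERIV_continuous_on)

lemma bridge_continuous: "AE \<omega> in M. continuous_on {0..T} (\<lambda>h. bridge i (T - h) \<omega>)"
  using cont_paths[of i]
proof eventually_elim
  case (elim \<omega>)
  have 1: "continuous_on {0..T} (\<lambda>h. Z (T - h) \<omega> $ i)"
    by (rule continuous_on_compose2[OF elim]) (auto intro!: continuous_intros)
  have 2: "continuous_on {0..T} (\<lambda>h. v i (T - h))"
    by (rule continuous_on_compose2[OF v_continuous]) (auto intro!: continuous_intros)
  have "v i T \<noteq> 0" using v_T_pos[of i] by simp
  then show ?case unfolding bridge_def rho_def
    using v_continuous[of i] by (intro continuous_intros 1 2) auto
qed

lemma bridge_T: "bridge i T \<omega> = 0"
  using v_T_pos[of i] by (simp add: bridge_def rho_def v_zero)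

text \<open>Time runs backwards from T, so that chaining starts at h = 0, where the bridge vanishes
  and increments become values.\<close>

lemma bridge_sup_dyadic:
  assumes de: "0 < de" "de \<le> T" and eta: "eta > 0" "\<And>h. 0 < h \<Longrightarrow> h \<le> de \<Longrightarrow> v i h \<le> eta * h"
    and x: "x > 0" and l: "l > 0" and E: "E \<in> sets borel"
  shows "\<exists>D\<in>events. prob D \<le> 4 ^ 8 * exp (- (x\<^sup>2 / (32 * eta * l))) * prob {\<omega> \<in> space M. Z T \<omega> \<in> E} \<and>
    (AE \<omega> in M. Z T \<omega> \<in> E \<longrightarrow> \<omega> \<notin> D \<longrightarrow> (\<forall>h. 0 \<le> h \<and> h \<le> l \<and> h \<le> de \<longrightarrow> \<bar>bridge i (T - h) \<omega>\<bar> \<le> x))"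
proof -
  \<comment> \<open>The block may reach beyond \<open>de\<close>, where the variance bound is not
    assumed; shortening the interval only improves the exponent.\<close>
  define L where "L = min l de"
  have L: "L > 0" "L \<le> de" "L \<le> l" using l de by (auto simp: L_def)
  let ?G = "{\<omega> \<in> space M. Z T \<omega> \<in> E}"
  have "\<exists>D\<in>events. prob D \<le> 4 ^ 8 * exp (- (x\<^sup>2 / (32 * eta * L))) * prob ?G \<and>
     (AE \<omega> in M. \<omega> \<in> ?G \<longrightarrow> \<omega> \<notin> D \<longrightarrow> (\<forall>h\<in>{0..L}. \<bar>bridge i (T - h) \<omega> - bridge i (T - 0) \<omega>\<bar> \<le> x))"
  proof (rule dyadic_chaining[OF L(1) eta(1) x])
    show "?G \<in> events" using E by measurable
    show "bridge i (T - t) \<in> borel_measurable M" if "t \<in> {0..L}" for t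
      using that L de by (intro bridge_measurable) auto
    show "AE \<omega> in M. continuous_on {0..L} (\<lambda>t. bridge i (T - t) \<omega>)"
      using bridge_continuous[of i] L de by (auto elim!: eventually_mono continuous_on_subset)
    fix s t y :: real assume st: "0 \<le> s" "s < t" "t \<le> L" "0 < y"
    have "prob {\<omega> \<in> ?G. \<bar>bridge i (T - s) \<omega> - bridge i (T - t) \<omega>\<bar> > y}
     \<le> 2 * exp (- (y\<^sup>2 / (2 * eta * ((T - s) - (T - t))))) * prob ?G"
      by (rule bridge_increment_tail[OF _ _ _ E]) (use st L de eta in auto)
    then show "prob {\<omega> \<in> ?G. \<bar>bridge i (T - t) \<omega> - bridge i (T - s) \<omega>\<bar> > y} \<le> 2 * exp (- (y\<^sup>2 / (2 * eta * (t - s)))) * prob ?G"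
      by (simp add: abs_minus_commute)
  qed
  then obtain D where D: "D \<in> events" "prob D \<le> 4 ^ 8 * exp (- (x\<^sup>2 / (32 * eta * L))) * prob ?G"
    "AE \<omega> in M. \<omega> \<in> ?G \<longrightarrow> \<omega> \<notin> D \<longrightarrow> (\<forall>h\<in>{0..L}. \<bar>bridge i (T - h) \<omega> - bridge i (T - 0) \<omega>\<bar> \<le> x)" by blast
  have "x\<^sup>2 / (32 * eta * l) \<le> x\<^sup>2 / (32 * eta * L)"
    using L eta x by (intro divide_left_mono mult_left_mono mult_pos_pos) auto
  then have "4 ^ 8 * exp (- (x\<^sup>2 / (32 * eta * L))) * prob ?G \<le> 4 ^ 8 * exp (- (x\<^sup>2 / (32 * eta * l))) * prob ?G"
    by (intro mult_right_mono mult_left_mono) auto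
  with D(2) have "prob D \<le> 4 ^ 8 * exp (- (x\<^sup>2 / (32 * eta * l))) * prob ?G" by linarith
  moreover have "AE \<omega> in M. Z T \<omega> \<in> E \<longrightarrow> \<omega> \<notin> D \<longrightarrow> (\<forall>h. 0 \<le> h \<and> h \<le> l \<and> h \<le> de \<longrightarrow> \<bar>bridge i (T - h) \<omega>\<bar> \<le> x)"
    using D(3) AE_space by eventually_elim (auto simp: bridge_T L_def)
  ultimately show ?thesis using D(1) by blast
qed

text \<open>In the time scale \<open>s = u\<^sup>2 h\<close> the scaled bridge has increments of variance at most \<open>eta\<close> times
  their length. The bound is obtained on each dyadic block \<open>s \<le> 2 ^ j\<close> separately.\<close>

lemma bridge_sup:
  assumes de: "0 < de" "de \<le> T" and eta: "eta > 0" "\<And>h. 0 < h \<Longrightarrow> h \<le> de \<Longrightarrow> v i h \<le> eta * h"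
    and ep: "ep > 0" and q: "exp (- (ep\<^sup>2 / (128 * eta))) \<le> q" "q \<le> 1 / 2" and u: "u > 0" and E: "E \<in> sets borel"
  shows "\<exists>D\<in>events. prob D \<le> 2 * 4 ^ 8 * q ^ (n + 1) * prob {\<omega> \<in> space M. Z T \<omega> \<in> E} \<and>
    (AE \<omega> in M. Z T \<omega> \<in> E \<longrightarrow> \<omega> \<notin> D \<longrightarrow> (\<forall>h\<in>{0..de}. u * \<bar>bridge i (T - h) \<omega>\<bar> \<le> ep * (1 + u\<^sup>2 * h) + real n * ep))"
proof -
  let ?p = "prob {\<omega> \<in> space M. Z T \<omega> \<in> E}"
  \<comment> \<open>Half of ep 2^j suffices: a time s in block j but not in block j - 1 has s > 2^j
    / 2, and block 0 is covered by the 1 in ep (1 + s).\<close>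
  define x where "x j = (ep * 2 ^ j / 2 + real n * ep) / u" for j :: nat
  define l where "l j = 2 ^ j / u\<^sup>2" for j :: nat
  have q0: "0 \<le> q" using q(1) by (meson exp_ge_zero order_trans)
  have xp: "x j > 0" and lp: "l j > 0" for j using ep u by (auto simp: x_def l_def add_pos_nonneg)
  have "\<exists>D. \<forall>j. D j \<in> events \<and> prob (D j) \<le> 4 ^ 8 * exp (- ((x j)\<^sup>2 / (32 * eta * l j))) * ?p \<and>
    (AE \<omega> in M. Z T \<omega> \<in> E \<longrightarrow> \<omega> \<notin> D j \<longrightarrow> (\<forall>h. 0 \<le> h \<and> h \<le> l j \<and> h \<le> de \<longrightarrow> \<bar>bridge i (T - h) \<omega>\<bar> \<le> x j))"
    using bridge_sup_dyadic[OF de eta xp lp E] by (intro choice) blast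
  then obtain D where D: "\<And>j. D j \<in> events" "\<And>j. prob (D j) \<le> 4 ^ 8 * exp (- ((x j)\<^sup>2 / (32 * eta * l j))) * ?p"
    "\<And>j. AE \<omega> in M. Z T \<omega> \<in> E \<longrightarrow> \<omega> \<notin> D j \<longrightarrow> (\<forall>h. 0 \<le> h \<and> h \<le> l j \<and> h \<le> de \<longrightarrow> \<bar>bridge i (T - h) \<omega>\<bar> \<le> x j)"
    by blast
  have pj: "prob (D j) \<le> 4 ^ 8 * q ^ (n + 1) * ?p * (1/2) ^ j" for j
  proof -
    have b: "real j + 1 \<le> 2 ^ j" by (induction j) auto
    \<comment> \<open>Squaring 2^j / 2 + n and dividing by the block length leaves the terms 2^j and
      4 n, whose sum is at least n + 1 + j. So both the level n and the block j produce powers of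
      q.\<close>
    have "(x j)\<^sup>2 / (32 * eta * l j) = ep\<^sup>2 / (128 * eta) * (2 ^ j + 4 * real n + 4 * (real n)\<^sup>2 / 2 ^ j)"
      unfolding x_def l_def using u eta by (simp add: field_simps power2_eq_square)
    also have "\<dots> \<ge> ep\<^sup>2 / (128 * eta) * real (n + 1 + j)"
      using eta b by (intro mult_left_mono) (auto simp: add_increasing2)
    finally have "exp (- ((x j)\<^sup>2 / (32 * eta * l j))) \<le> exp (- (ep\<^sup>2 / (128 * eta) * real (n + 1 + j)))" by simp
    also have "\<dots> = exp (- (ep\<^sup>2 / (128 * eta))) ^ (n + 1 + j)"
      by (simp only: exp_of_nat_mult[symmetric]) (simp add: algebra_simps)
    also have "\<dots> \<le> q ^ (n + 1 + j)" using q by (intro power_mono) auto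
    also have "\<dots> = q ^ (n + 1) * q ^ j" by (simp add: power_add)
    also have "\<dots> \<le> q ^ (n + 1) * (1/2) ^ j" using q q0 by (intro mult_left_mono power_mono) auto
    finally have "4 ^ 8 * exp (- ((x j)\<^sup>2 / (32 * eta * l j))) * ?p \<le> 4 ^ 8 * (q ^ (n + 1) * (1/2) ^ j) * ?p"
      by (intro mult_right_mono mult_left_mono) auto
    with D(2)[of j] show ?thesis by (simp add: mult_ac)
  qed
  have P: "prob (\<Union>j. D j) \<le> 2 * 4 ^ 8 * q ^ (n + 1) * ?p"
    using prob_UN_geometric[OF D(1) pj] by simp
  have "AE \<omega> in M. \<forall>j. Z T \<omega> \<in> E \<longrightarrow> \<omega> \<notin> D j \<longrightarrow> (\<forall>h. 0 \<le> h \<and> h \<le> l j \<and> h \<le> de \<longrightarrow> \<bar>bridge i (T - h) \<omega>\<bar> \<le> x j)"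
    unfolding AE_all_countable using D(3) by blast
  then have "AE \<omega> in M. Z T \<omega> \<in> E \<longrightarrow> \<omega> \<notin> (\<Union>j. D j) \<longrightarrow> (\<forall>h\<in>{0..de}. u * \<bar>bridge i (T - h) \<omega>\<bar> \<le> ep * (1 + u\<^sup>2 * h) + real n * ep)"
  proof (eventually_elim, intro impI ballI)
    fix \<omega> h assume a: "\<forall>j. Z T \<omega> \<in> E \<longrightarrow> \<omega> \<notin> D j \<longrightarrow> (\<forall>h. 0 \<le> h \<and> h \<le> l j \<and> h \<le> de \<longrightarrow> \<bar>bridge i (T - h) \<omega>\<bar> \<le> x j)"
      and w: "Z T \<omega> \<in> E" "\<omega> \<notin> (\<Union>j. D j)" and h: "h \<in> {0..de}"
    define s where "s = u\<^sup>2 * h"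
    have s0: "s \<ge> 0" using h by (simp add: s_def)
    have "\<exists>j. s \<le> 2 ^ j" using real_arch_pow[of 2 s] by (auto intro: less_imp_le)
    \<comment> \<open>Minimality of the block gives the lower bound on s that makes its allowance at
      most ep (1 + s).\<close>
    define j where "j = (LEAST j. s \<le> 2 ^ j)"
    have ls: "s \<le> 2 ^ j" unfolding j_def by (rule LeastI_ex) fact
    have xj: "ep * 2 ^ j / 2 \<le> ep * (1 + s)"
    proof (cases j)
      case 0 then show ?thesis using ep s0 by simp
    next
      case (Suc k)
      then have "\<not> s \<le> 2 ^ k" unfolding j_def using not_less_Least by (metis lessI)
      then have "2 ^ j / 2 \<le> 1 + s" by (simp add: Suc)
      then have "ep * (2 ^ j / 2) \<le> ep * (1 + s)" using ep by (intro mult_left_mono) auto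
      then show ?thesis by simp
    qed
    have "h \<le> l j" using ls u unfolding l_def s_def by (simp add: field_simps)
    then have "\<bar>bridge i (T - h) \<omega>\<bar> \<le> x j" using a w h by auto
    then have "u * \<bar>bridge i (T - h) \<omega>\<bar> \<le> u * x j" using u by (intro mult_left_mono) auto
    also have "u * x j = ep * 2 ^ j / 2 + real n * ep" using u by (simp add: x_def)
    also have "\<dots> \<le> ep * (1 + s) + real n * ep" using xj by simp
    finally show "u * \<bar>bridge i (T - h) \<omega>\<bar> \<le> ep * (1 + u\<^sup>2 * h) + real n * ep" unfolding s_def .
  qed
  then show ?thesis using P D(1) by (intro bexI[of _ "\<Union>j. D j"]) auto
qed

text \<open>The term ep u^2 h is later absorbed by tilting the drift and the rest by the margin; n
  measures the excess of the bridge in units of ep.\<close>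

definition bridge_bounded :: "real \<Rightarrow> real \<Rightarrow> nat \<Rightarrow> real \<Rightarrow> 'w \<Rightarrow> bool" where
  "bridge_bounded u ep n h \<omega> \<longleftrightarrow> (\<forall>i. u * \<bar>bridge i (T - h) \<omega>\<bar> \<le> ep * (1 + u\<^sup>2 * h) + real n * ep)"

lemma bridge_sup_vector:
  assumes de: "0 < de" "de \<le> T" and eta: "eta > 0" "\<And>i h. 0 < h \<Longrightarrow> h \<le> de \<Longrightarrow> v i h \<le> eta * h"
    and ep: "ep > 0" and q: "exp (- (ep\<^sup>2 / (128 * eta))) \<le> q" "q \<le> 1 / 2" and u: "u > 0" and E: "E \<in> sets borel"
  shows "\<exists>D\<in>events. prob D \<le> real CARD('d) * (2 * 4 ^ 8) * q ^ (n + 1) * prob {\<omega> \<in> space M. Z T \<omega> \<in> E} \<and>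
    (AE \<omega> in M. Z T \<omega> \<in> E \<longrightarrow> \<omega> \<notin> D \<longrightarrow> (\<forall>h\<in>{0..de}. bridge_bounded u ep n h \<omega>))"
proof -
  let ?P = "\<lambda>i \<omega>. Z T \<omega> \<in> E \<longrightarrow> (\<forall>h\<in>{0..de}. u * \<bar>bridge i (T - h) \<omega>\<bar> \<le> ep * (1 + u\<^sup>2 * h) + real n * ep)"
  let ?b = "2 * 4 ^ 8 * q ^ (n + 1) * prob {\<omega> \<in> space M. Z T \<omega> \<in> E}"
  have "\<exists>D\<in>events. prob D \<le> ?b \<and> (AE \<omega> in M. \<omega> \<notin> D \<longrightarrow> ?P i \<omega>)" for i
  proof -
    have "\<exists>D\<in>events. prob D \<le> ?b \<and> (AE \<omega> in M. Z T \<omega> \<in> E \<longrightarrow> \<omega> \<notin> D \<longrightarrow>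
        (\<forall>h\<in>{0..de}. u * \<bar>bridge i (T - h) \<omega>\<bar> \<le> ep * (1 + u\<^sup>2 * h) + real n * ep))"
      by (rule bridge_sup[OF de eta ep q u E])
    then obtain D where D: "D \<in> events" "prob D \<le> ?b" "AE \<omega> in M. Z T \<omega> \<in> E \<longrightarrow> \<omega> \<notin> D \<longrightarrow>
        (\<forall>h\<in>{0..de}. u * \<bar>bridge i (T - h) \<omega>\<bar> \<le> ep * (1 + u\<^sup>2 * h) + real n * ep)"
      by (elim bexE conjE) (rule that)
    from D(3) have "AE \<omega> in M. \<omega> \<notin> D \<longrightarrow> ?P i \<omega>" by eventually_elim iprover
    with D(1,2) show ?thesis by (intro bexI[of _ D] conjI)
  qed
  from ex_event_all_coordinates[where P = ?P, OF this] obtain D where D: "D \<in> events" "prob D \<le> real CARD('d) * ?b"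
    "AE \<omega> in M. \<omega> \<notin> D \<longrightarrow> (\<forall>i. ?P i \<omega>)" by (elim bexE conjE) (rule that)
  from D(3) have "AE \<omega> in M. Z T \<omega> \<in> E \<longrightarrow> \<omega> \<notin> D \<longrightarrow> (\<forall>h\<in>{0..de}. bridge_bounded u ep n h \<omega>)"
    unfolding bridge_bounded_def by eventually_elim simp
  with D(1,2) show ?thesis by (intro bexI[of _ D]) (simp_all only: mult.assoc simp_thms)
qed

text \<open>One has 1 - rho(T - h) = (v(T) - v(T - h) + v(h)) / (2 v(T)), where the difference is h
  v'(T) + o(h) and v(h) = o(h) by (BII).\<close>

lemma eventually_rho: 
  assumes "ep > 0"
  shows "eventually (\<lambda>h. \<bar>1 - rho i (T - h) - h * (dv i T / v i T) / 2\<bar> \<le> ep * h) (at_right 0)"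
proof -
  \<comment> \<open>Two errors of size e h, divided by 2 v(T), add up to ep h.\<close>
  define e where "e = ep * v i T"
  have e: "e > 0" using assms v_T_pos[of i] by (simp add: e_def)
  have "((\<lambda>y. (v i y - v i T) / (y - T)) \<longlongrightarrow> dv i T) (at T within {0..T})"
    using v_deriv[of T i] T_pos by (simp add: has_field_derivative_iff)
  from tendstoD[OF this e] obtain d where d: "d > 0"
    "\<And>y. y \<in> {0..T} \<Longrightarrow> y \<noteq> T \<Longrightarrow> dist y T < d \<Longrightarrow> dist ((v i y - v i T) / (y - T)) (dv i T) < e"
    unfolding eventually_at by blast
  have "eventually (\<lambda>h. \<bar>v i h\<bar> \<le> e * \<bar>h\<bar>) (at_right 0)"
    using landau_o.smallD[OF v_small e] by simp
  moreover have "eventually (\<lambda>h. h < min d T) (at_right 0)"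
    using d(1) T_pos by (intro eventually_at_rightI[of 0 "min d T"]) auto
  moreover have "eventually (\<lambda>h. h > (0::real)) (at_right 0)"
    by (rule eventually_at_rightI[of 0 1]) auto
  ultimately show ?thesis
  proof eventually_elim
    case (elim h)
    have "dist ((v i (T - h) - v i T) / (T - h - T)) (dv i T) < e"
      using elim by (intro d(2)) (auto simp: dist_real_def)
    then have "\<bar>(v i T - v i (T - h)) / h - dv i T\<bar> < e"
      by (simp add: dist_real_def minus_divide_left[symmetric] divide_minus_right minus_divide_left)
    then have "\<bar>(v i T - v i (T - h)) / h - dv i T\<bar> * h \<le> e * h" using elim by (intro mult_right_mono) auto
    then have 1: "\<bar>v i T - v i (T - h) - h * dv i T\<bar> \<le> e * h"
      using elim by (simp add: abs_mult_pos[symmetric] field_simps del: abs_mult_pos)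
    have 2: "\<bar>v i h\<bar> \<le> e * h" using elim by simp
    have "1 - rho i (T - h) - h * (dv i T / v i T) / 2 = ((v i T - v i (T - h) - h * dv i T) + v i h) / (2 * v i T)"
      using v_T_pos[of i] by (simp add: rho_def field_simps)
    also have "\<bar>\<dots>\<bar> \<le> (e * h + e * h) / (2 * v i T)"
      unfolding abs_divide using v_T_pos[of i] 1 2 by (intro frac_le) linarith+
    also have "\<dots> = ep * h" using v_T_pos[of i] by (simp add: e_def field_simps)
    finally show ?case .
  qed
qed

lemma small_scale:
  assumes "ep > 0" "eta > 0"
  shows "\<exists>de>0. de \<le> T \<and> (\<forall>h i. 0 < h \<and> h \<le> de \<longrightarrow> v i h \<le> eta * h \<and> \<bar>1 - rho i (T - h) - h * (dv i T / v i T) / 2\<bar> \<le> ep * h)"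
proof -
  have "eventually (\<lambda>h. \<bar>v i h\<bar> \<le> eta * \<bar>h\<bar>) (at_right 0)" for i
    using landau_o.smallD[OF v_small assms(2)] by simp
  then have "eventually (\<lambda>h. \<forall>i\<in>UNIV. \<bar>v i h\<bar> \<le> eta * \<bar>h\<bar> \<and> \<bar>1 - rho i (T - h) - h * (dv i T / v i T) / 2\<bar> \<le> ep * h) (at_right 0)"
    using eventually_rho[OF assms(1)] by (intro eventually_ball_finite ballI eventually_conj) auto
  then obtain b where b: "b > 0" "\<And>h. 0 < h \<Longrightarrow> h < b \<Longrightarrow> \<forall>i\<in>UNIV. \<bar>v i h\<bar> \<le> eta * \<bar>h\<bar> \<and> \<bar>1 - rho i (T - h) - h * (dv i T / v i T) / 2\<bar> \<le> ep * h"
    unfolding eventually_at_right_field by blast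
  show ?thesis
  proof (intro exI[of _ "min (b / 2) T"] conjI allI impI)
    show "0 < min (b / 2) T" "min (b / 2) T \<le> T" using b T_pos by auto
    fix h i assume h: "0 < h \<and> h \<le> min (b / 2) T"
    from b(2)[of h] h b(1) have *: "\<bar>v i h\<bar> \<le> eta * \<bar>h\<bar>" "\<bar>1 - rho i (T - h) - h * (dv i T / v i T) / 2\<bar> \<le> ep * h" by auto
    then show "v i h \<le> eta * h" "\<bar>1 - rho i (T - h) - h * (dv i T / v i T) / 2\<bar> \<le> ep * h" using h by auto
  qed
qed

section \<open>Linearization of the motion near time T\<close>

lemma matrix_vector_bound: 
  fixes B :: "real^'d^'d"
  shows "\<exists>K>0. \<forall>y b i. (\<forall>j. \<bar>y $ j\<bar> \<le> b) \<longrightarrow> \<bar>(B *v y) $ i\<bar> \<le> K * b"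
proof -
  define K where "K = (\<Sum>i\<in>UNIV. \<Sum>j\<in>UNIV. \<bar>B $ i $ j\<bar>) + 1"
  have "\<bar>(B *v y) $ i\<bar> \<le> K * b" if y: "\<forall>j. \<bar>y $ j\<bar> \<le> b" for y b i
  proof -
    have b: "b \<ge> 0" using y by (meson abs_ge_zero order_trans)
    have "\<bar>(B *v y) $ i\<bar> \<le> (\<Sum>j\<in>UNIV. \<bar>B $ i $ j * y $ j\<bar>)"
      by (simp add: matrix_vector_mult_def sum_abs)
    also have "\<dots> \<le> (\<Sum>j\<in>UNIV. \<bar>B $ i $ j\<bar> * b)" using y by (intro sum_mono) (auto simp: abs_mult mult_left_mono)
    also have "\<dots> = (\<Sum>j\<in>UNIV. \<bar>B $ i $ j\<bar>) * b" by (simp add: sum_distrib_right)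
    also have "\<dots> \<le> K * b"
    proof (rule mult_right_mono[OF _ b])
      have "(\<Sum>j\<in>UNIV. \<bar>B $ i $ j\<bar>) \<le> (\<Sum>i\<in>UNIV. \<Sum>j\<in>UNIV. \<bar>B $ i $ j\<bar>)"
        by (rule member_le_sum) (auto intro: sum_nonneg)
      then show "(\<Sum>j\<in>UNIV. \<bar>B $ i $ j\<bar>) \<le> K" by (simp add: K_def)
    qed
    finally show ?thesis .
  qed
  moreover have "K > 0" unfolding K_def by (intro add_nonneg_pos sum_nonneg) auto
  ultimately show ?thesis by blast
qed

text \<open>A deterministic statement: z stands for the value of \<open>Z T\<close> and
  \<open>be\<close> for that of the bridge at T - h. Quantifying over both makes the threshold for u
  independent of the sample point.\<close>

definition locally_linear :: "real \<Rightarrow> real \<Rightarrow> real \<Rightarrow> bool" where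
  "locally_linear K ep u \<longleftrightarrow> (\<forall>h z be. \<forall>n::nat. 0 \<le> h \<longrightarrow>
     (\<forall>i. \<bar>1 - rho i (T - h) - h * (dv i T / v i T) / 2\<bar> \<le> ep * h) \<longrightarrow>
     norm (A *v z - T *\<^sub>R c - u *\<^sub>R atil) \<le> ep * u \<longrightarrow>
     (\<forall>i. u * \<bar>be i\<bar> \<le> ep * (1 + u\<^sup>2 * h) + real n * ep) \<longrightarrow>
     (\<forall>i. \<bar>u * ((A *v (\<chi> j. rho j (T - h) * z $ j + be j) - (T - h) *\<^sub>R c - u *\<^sub>R a) $ i)
        - (u * (A *v z - T *\<^sub>R c - u *\<^sub>R atil) $ i - u\<^sup>2 * (a - atil) $ i - u\<^sup>2 * h * w $ i / 2)\<bar> \<le> K * ep * (1 + u\<^sup>2 * h + real n)))"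

text \<open>Four errors occur: that of \<open>rho\<close>, multiplied by z = O(u); the drift acting
  on the deviation of z from u zt, which is O(ep u); the bridge; and the change of c t over the time
  h. After multiplication by u each is of order ep (1 + u^2 h + n).\<close>

lemma local_expansion:
  "\<exists>K>0. \<forall>ep. 0 < ep \<and> ep \<le> 1 \<longrightarrow> eventually (locally_linear K ep) at_top"
proof -
  obtain KA where KA: "KA > 0" "\<And>y b i. (\<And>j. \<bar>y $ j\<bar> \<le> b) \<Longrightarrow> \<bar>(A *v y) $ i\<bar> \<le> KA * b"
    using matrix_vector_bound[of A] by blast
  obtain KI where KI: "KI > 0" "\<And>x. norm (Ai *v x) \<le> KI * norm x"
    using linear_bounded_pos[of "(*v) Ai"] matrix_vector_mul_linear by (metis mult.commute)
  define q where "q j = dv j T / v j T" for j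
  define Zm where "Zm = (\<Sum>j\<in>UNIV. \<bar>zt $ j\<bar>)"
  define Qm where "Qm = (\<Sum>j\<in>UNIV. \<bar>q j\<bar>)"
  have Zm: "\<bar>zt $ j\<bar> \<le> Zm" and Qm: "\<bar>q j\<bar> \<le> Qm" for j unfolding Zm_def Qm_def by (auto intro!: member_le_sum)
  have Zm0: "Zm \<ge> 0" and Qm0: "Qm \<ge> 0" unfolding Zm_def Qm_def by (auto intro!: sum_nonneg)
  define K3 where "K3 = Zm + 2 * KI"
  define K4 where "K4 = K3 + Qm * KI + 1"
  define K where "K = KA * K4 + 1"
  have K3: "K3 \<ge> 0" using Zm0 KI by (simp add: K3_def)
  have K4: "K4 > 0" using K3 Qm0 KI by (simp add: K4_def add_nonneg_pos)
  have K: "K > 0" using KA K4 by (simp add: K_def add_pos_pos)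
  \<comment> \<open>From this u on, c and T c have norm at most ep u; the 1 makes u
    positive.\<close>
  have "\<forall>u\<ge>(norm c + norm (T *\<^sub>R c) + 1) / ep. locally_linear K ep u" if ep: "0 < ep" "ep \<le> 1" for ep
    unfolding locally_linear_def
  proof (intro allI impI)
    fix u h :: real and z and be :: "'d \<Rightarrow> real" and i and n :: nat
    assume u0: "u \<ge> (norm c + norm (T *\<^sub>R c) + 1) / ep" and h: "0 \<le> h"
      and r: "\<forall>i. \<bar>1 - rho i (T - h) - h * (dv i T / v i T) / 2\<bar> \<le> ep * h"
      and loc: "norm (A *v z - T *\<^sub>R c - u *\<^sub>R atil) \<le> ep * u"
      and be: "\<forall>i. u * \<bar>be i\<bar> \<le> ep * (1 + u\<^sup>2 * h) + real n * ep"
    have epu: "norm c + norm (T *\<^sub>R c) + 1 \<le> ep * u" using u0 ep by (simp add: field_simps)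
    then have "0 < ep * u" by (smt (verit) norm_ge_zero)
    then have u: "u > 0" using ep by (simp add: zero_less_mult_iff)
    define x where "x = A *v z - T *\<^sub>R c - u *\<^sub>R atil"
    define ze where "ze = z - u *\<^sub>R zt"
    have "A *v ze = x + T *\<^sub>R c" unfolding ze_def x_def zt_def
      by (simp add: matrix_vector_mult_diff_distrib matrix_vector_mult_scaleR A_Ai)
    then have "ze = Ai *v (x + T *\<^sub>R c)" by (metis A_Ai(2))
    then have "norm ze \<le> KI * norm (x + T *\<^sub>R c)" using KI(2) by simp
    also have "\<dots> \<le> KI * (ep * u + ep * u)"
    proof (intro mult_left_mono)
      have "norm (x + T *\<^sub>R c) \<le> norm x + norm (T *\<^sub>R c)" by (rule norm_triangle_ineq)
      also have "\<dots> \<le> ep * u + ep * u" using loc epu norm_ge_zero[of c] unfolding x_def[symmetric] by linarith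
      finally show "norm (x + T *\<^sub>R c) \<le> ep * u + ep * u" .
    qed (use KI in auto)
    finally have ze: "\<bar>ze $ j\<bar> \<le> 2 * KI * (ep * u)" for j using component_le_norm_cart[of ze j] by simp
    have zj: "\<bar>z $ j\<bar> \<le> K3 * u" for j
    proof -
      have "\<bar>z $ j\<bar> \<le> u * \<bar>zt $ j\<bar> + \<bar>ze $ j\<bar>"
        using abs_triangle_ineq[of "u * zt $ j" "ze $ j"] u by (simp add: ze_def abs_mult)
      also have "\<dots> \<le> u * Zm + 2 * KI * (1 * u)"
        using Zm[of j] ze[of j] u ep KI by (intro add_mono mult_left_mono order_trans[OF ze[of j]] mult_right_mono) auto
      finally show ?thesis by (simp add: K3_def algebra_simps)
    qed
    \<comment> \<open>The error vector: the regression value plus bridge is z + y minus the motion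
      (u h / 2) q zt. Writing z = u zt + ze makes the leading parts of y cancel.\<close>
    define y where "y = (\<chi> j. (rho j (T - h) - 1) * z $ j + u * h / 2 * (q j * zt $ j) + be j)"
    have yj: "u * \<bar>y $ j\<bar> \<le> K4 * ep * (1 + u\<^sup>2 * h + real n)" for j
    proof -
      have "y $ j = - ((1 - rho j (T - h) - h * q j / 2) * z $ j) + (- (h * q j / 2 * ze $ j)) + be j"
        unfolding y_def ze_def by (simp add: field_simps)
      then have "\<bar>y $ j\<bar> \<le> \<bar>1 - rho j (T - h) - h * q j / 2\<bar> * \<bar>z $ j\<bar> + h * \<bar>q j\<bar> / 2 * \<bar>ze $ j\<bar> + \<bar>be j\<bar>"
        using h abs_triangle_ineq[of "- ((1 - rho j (T - h) - h * q j / 2) * z $ j) + (- (h * q j / 2 * ze $ j))" "be j"]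
          abs_triangle_ineq[of "- ((1 - rho j (T - h) - h * q j / 2) * z $ j)" "- (h * q j / 2 * ze $ j)"]
        by (simp add: abs_mult)
      also have "\<dots> \<le> (ep * h) * (K3 * u) + h * Qm / 2 * (2 * KI * (ep * u)) + \<bar>be j\<bar>"
        using r[rule_format, of j] zj[of j] ze[of j] Qm[of j] h ep KI u Qm0 unfolding q_def[symmetric]
        by (intro add_mono mult_mono divide_right_mono mult_left_mono order_refl) (auto intro!: mult_nonneg_nonneg)
      finally have "u * \<bar>y $ j\<bar> \<le> u * ((ep * h) * (K3 * u) + h * Qm / 2 * (2 * KI * (ep * u)) + \<bar>be j\<bar>)"
        using u by (intro mult_left_mono) auto
      also have "\<dots> = ep * (u\<^sup>2 * h) * (K3 + Qm * KI) + u * \<bar>be j\<bar>"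
        by (simp add: power2_eq_square field_simps)
      also have "\<dots> \<le> ep * (1 + u\<^sup>2 * h + real n) * (K3 + Qm * KI) + (ep * (1 + u\<^sup>2 * h) + real n * ep)"
        using be h ep K3 Qm0 KI by (intro add_mono mult_right_mono mult_left_mono) auto
      also have "\<dots> = K4 * ep * (1 + u\<^sup>2 * h + real n)" by (simp add: K4_def algebra_simps)
      finally show ?thesis .
    qed
    have "\<bar>(A *v y) $ i\<bar> \<le> KA * (K4 * ep * (1 + u\<^sup>2 * h + real n) / u)"
      using yj u by (intro KA(2)) (simp add: field_simps)
    then have "u * \<bar>(A *v y) $ i\<bar> \<le> u * (KA * (K4 * ep * (1 + u\<^sup>2 * h + real n) / u))" using u by (intro mult_left_mono) auto
    then have Ay: "u * \<bar>(A *v y) $ i\<bar> \<le> KA * K4 * ep * (1 + u\<^sup>2 * h + real n)" using u by (simp add: mult_ac)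
    have "\<bar>c $ i\<bar> \<le> ep * u" using component_le_norm_cart[of c i] epu norm_ge_zero[of "T *\<^sub>R c"] by linarith
    then have "u * h * \<bar>c $ i\<bar> \<le> u * h * (ep * u)" using u h by (intro mult_left_mono) auto
    also have "\<dots> = ep * (u\<^sup>2 * h)" by (simp add: power2_eq_square)
    also have "\<dots> \<le> ep * (1 + u\<^sup>2 * h + real n)" using ep by (intro mult_left_mono) auto
    finally have ci: "u * h * \<bar>c $ i\<bar> \<le> ep * (1 + u\<^sup>2 * h + real n)" .
    have "(\<chi> j. rho j (T - h) * z $ j + be j) = z + y - (u * h / 2) *\<^sub>R (\<chi> j. q j * zt $ j)"
      by (simp add: vec_eq_iff y_def algebra_simps)
    then have Ae: "A *v (\<chi> j. rho j (T - h) * z $ j + be j) = A *v z + A *v y - (u * h / 2) *\<^sub>R w"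
      by (simp add: matrix_vector_mult_diff_distrib matrix_vector_right_distrib matrix_vector_mult_scaleR w_eq q_def)
    have "u * ((A *v (\<chi> j. rho j (T - h) * z $ j + be j) - (T - h) *\<^sub>R c - u *\<^sub>R a) $ i)
        - (u * (A *v z - T *\<^sub>R c - u *\<^sub>R atil) $ i - u\<^sup>2 * (a - atil) $ i - u\<^sup>2 * h * w $ i / 2)
        = u * (A *v y) $ i + u * h * c $ i"
      unfolding Ae by (simp add: power2_eq_square field_simps)
    also have "\<bar>\<dots>\<bar> \<le> u * \<bar>(A *v y) $ i\<bar> + u * h * \<bar>c $ i\<bar>"
      using abs_triangle_ineq[of "u * (A *v y) $ i" "u * h * c $ i"] u h by (simp add: abs_mult)
    also have "\<dots> \<le> KA * K4 * ep * (1 + u\<^sup>2 * h + real n) + ep * (1 + u\<^sup>2 * h + real n)"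
      using Ay ci by (rule add_mono)
    also have "\<dots> = K * ep * (1 + u\<^sup>2 * h + real n)" by (simp add: K_def algebra_simps)
    finally show "\<bar>u * ((A *v (\<chi> j. rho j (T - h) * z $ j + be j) - (T - h) *\<^sub>R c - u *\<^sub>R a) $ i)
        - (u * (A *v z - T *\<^sub>R c - u *\<^sub>R atil) $ i - u\<^sup>2 * (a - atil) $ i - u\<^sup>2 * h * w $ i / 2)\<bar> \<le> K * ep * (1 + u\<^sup>2 * h + real n)" .
  qed
  then show ?thesis using K unfolding eventually_at_top_linorder by blast
qed

section \<open>Comparison of exceedance near T with the swept orthant\<close>

definition exceeds :: "real \<Rightarrow> real \<Rightarrow> 'w \<Rightarrow> bool" where
  "exceeds u t \<omega> \<longleftrightarrow> (\<forall>i. (A *v Z t \<omega> - t *\<^sub>R c) $ i > u * a $ i)"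

definition excess_set :: "real \<Rightarrow> (real^'d) set \<Rightarrow> (real^'d) set" where
  "excess_set u E = {z. A *v z - T *\<^sub>R c - u *\<^sub>R atil \<in> E}"

lemma excess_set_borel: "E \<in> sets borel \<Longrightarrow> excess_set u E \<in> sets borel"
  using measurable_sets[of "\<lambda>z. A *v z - T *\<^sub>R c - u *\<^sub>R atil" borel borel E] by (simp add: excess_set_def vimage_def)

lemma Z_T_excess_set: "Z T \<omega> \<in> excess_set u E \<longleftrightarrow> excess u \<omega> \<in> E"
  by (simp add: excess_set_def excess_def)

lemma exceeds_expansion:
  assumes ll: "locally_linear K ep u" and h: "0 \<le> h" "\<And>i. \<bar>1 - rho i (T - h) - h * (dv i T / v i T) / 2\<bar> \<le> ep * h"
    and loc: "norm (excess u \<omega>) \<le> ep * u" and br: "bridge_bounded u ep n h \<omega>"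
  shows "\<bar>u * ((A *v Z (T - h) \<omega> - (T - h) *\<^sub>R c) $ i - u * a $ i) - (u * excess u \<omega> $ i - u\<^sup>2 * (a - atil) $ i - u\<^sup>2 * h * w $ i / 2)\<bar>
     \<le> K * ep * (1 + u\<^sup>2 * h + real n)"
proof -
  have Z: "(\<chi> j. rho j (T - h) * Z T \<omega> $ j + bridge j (T - h) \<omega>) = Z (T - h) \<omega>"
    by (simp add: vec_eq_iff bridge_def)
  show ?thesis
    using ll[unfolded locally_linear_def, rule_format, of h "Z T \<omega>" "\<lambda>j. bridge j (T - h) \<omega>" n i] h loc br[unfolded bridge_bounded_def]
    unfolding Z by (simp add: excess_def)
qed

text \<open>Any failure rate q of the bridge is attainable, because (BII) allows every variance
  slope \<open>eta\<close> sufficiently close to T.\<close>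

lemma q_to_eta:
  fixes ep q :: real
  assumes "ep > 0" "0 < q" "q \<le> 1 / 2"
  shows "\<exists>eta>0. exp (- (ep\<^sup>2 / (128 * eta))) \<le> q"
proof -
  have l: "- ln q > 0" using assms by (simp add: ln_less_zero_iff)
  define eta where "eta = ep\<^sup>2 / (128 * (- ln q))"
  have "eta > 0" unfolding eta_def using l assms by (intro divide_pos_pos) auto
  moreover have "ep\<^sup>2 / (128 * eta) = - ln q" unfolding eta_def using assms l by (simp add: field_simps)
  then have "exp (- (ep\<^sup>2 / (128 * eta))) = q" using assms by simp
  ultimately show ?thesis by auto
qed

lemma rho_small_scale_0: "\<bar>1 - rho i (T - h) - h * (dv i T / v i T) / 2\<bar> \<le> ep * h"
  if "0 \<le> h" "h \<le> de" "\<forall>h i. 0 < h \<and> h \<le> de \<longrightarrow> v i h \<le> eta * h \<and> \<bar>1 - rho i (T - h) - h * (dv i T / v i T) / 2\<bar> \<le> ep * h"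
proof (cases "h = 0")
  case True
  then show ?thesis using v_T_pos[of i] by (simp add: rho_def v_zero)
next
  case False
  then show ?thesis using that by auto
qed

text \<open>A bridge of excess level \<open>n + 1\<close> enlarges the target of \<open>X(T)\<close>, but by independence it costs a factor
  \<open>q ^ (n + 1)\<close>, which beats the growth of the probability of the enlarged target.\<close>

lemma near_upper:
  fixes K ep th :: real
  assumes K: "K > 0" and ll: "eventually (locally_linear K ep) at_top" and ep: "0 < ep" and th: "th > 0"
    and wpos: "lam \<bullet> (\<chi> i. w $ i / 2 - K * ep) > 0"
  defines "wm \<equiv> (\<chi> i. w $ i / 2 - K * ep) :: real^'d"
  shows "\<exists>d0>0. d0 \<le> T \<and> (\<forall>de. 0 < de \<and> de \<le> d0 \<longrightarrow> eventually (\<lambda>u. \<exists>D\<in>events.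
     prob D \<le> PT u (sweep_event u wm (- (K * ep)) de ep) + th * PT u (corner u) \<and>
     (AE \<omega> in M. norm (excess u \<omega>) \<le> ep * u \<longrightarrow> (\<exists>h\<in>{0..de}. exceeds u (T - h) \<omega>) \<longrightarrow> \<omega> \<in> D)) at_top)"
proof -
  define Lm where "Lm = (\<Sum>i\<in>UNIV. lam $ i)"
  have Lm: "Lm \<ge> 0" unfolding Lm_def by (intro sum_nonneg) (auto simp: lam_ge0)
  obtain Kb where Kb: "Kb > 0" "eventually (\<lambda>u. \<forall>r\<ge>0. \<forall>de ep. PT u (sweep_event u wm (- r) de ep)
      \<le> Kb * exp (r * Lm) * PT u (corner u)) at_top"
    using PT_sweep_bound[OF wpos] unfolding Lm_def wm_def by blast
  \<comment> \<open>The factor by which the bound for the enlarged target grows per level.\<close>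
  define x where "x = exp (K * ep * Lm)"
  have x: "x \<ge> 1" unfolding x_def using K ep Lm by simp
  define c2 where "c2 = real CARD('d) * (2 * 4 ^ 8) * Kb * x"
  have c2: "c2 > 0" unfolding c2_def using Kb x by (intro mult_pos_pos) auto
  \<comment> \<open>The failure events of all levels together cost at most 2 c2 g, to be kept below
    th.\<close>
  define g where "g = min (1 / 2) (th / (2 * c2))"
  have g: "0 < g" "g \<le> 1 / 2" "2 * c2 * g \<le> th"
  proof -
    show "0 < g" unfolding g_def using th c2 by simp
    show "g \<le> 1 / 2" unfolding g_def by (rule min.cobounded1)
    have "2 * c2 * g \<le> 2 * c2 * (th / (2 * c2))" unfolding g_def using c2 by (intro mult_left_mono) auto
    then show "2 * c2 * g \<le> th" using c2 by simp
  qed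
  \<comment> \<open>Dividing by x offsets the growth of the target, so that level n costs c2 g^(n +
    1).\<close>
  define q where "q = g / x"
  have q: "0 < q" "q \<le> 1 / 2" "q * x = g"
    using g x by (auto simp: q_def field_simps) 
  obtain eta where eta: "eta > 0" "exp (- (ep\<^sup>2 / (128 * eta))) \<le> q"
    using q_to_eta[OF ep q(1,2)] by blast
  obtain d0 where d0: "d0 > 0" "d0 \<le> T" "\<forall>h i. 0 < h \<and> h \<le> d0 \<longrightarrow> v i h \<le> eta * h \<and> \<bar>1 - rho i (T - h) - h * (dv i T / v i T) / 2\<bar> \<le> ep * h"
    using small_scale[OF ep eta(1)] by blast
  have "eventually (\<lambda>u. \<exists>D\<in>events.
     prob D \<le> PT u (sweep_event u wm (- (K * ep)) de ep) + th * PT u (corner u) \<and>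
     (AE \<omega> in M. norm (excess u \<omega>) \<le> ep * u \<longrightarrow> (\<exists>h\<in>{0..de}. exceeds u (T - h) \<omega>) \<longrightarrow> \<omega> \<in> D)) at_top"
    if de: "0 < de" "de \<le> d0" for de
    using ll Kb(2) eventually_gt_at_top[of 0]
  proof eventually_elim
    case (elim u)
    note u = elim(3)
    \<comment> \<open>The values of X(T) compatible with exceedance when the bridge has level
      n.\<close>
    define U where "U n = sweep_event u wm (- (K * ep * (1 + real n))) de ep" for n :: nat
    have Ub: "U n \<in> sets borel" for n unfolding U_def by (rule sweep_event_borel)
    have deT: "de \<le> T" using de d0 by simp
    have etad: "v i h \<le> eta * h" if "0 < h" "h \<le> de" for i h using d0(3) de that by auto
    \<comment> \<open>For each n, the event that the bridge fails level n while X(T) lies in the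
      target of the next level.\<close>
    have "\<exists>D. D \<in> events \<and> prob D \<le> real CARD('d) * (2 * 4 ^ 8) * q ^ (n + 1) * PT u (U (Suc n)) \<and>
      (AE \<omega> in M. excess u \<omega> \<in> U (Suc n) \<longrightarrow> \<omega> \<notin> D \<longrightarrow> (\<forall>h\<in>{0..de}. bridge_bounded u ep n h \<omega>))" for n
      using bridge_sup_vector[where n = n, OF de(1) deT eta(1) etad ep eta(2) q(2) u excess_set_borel[OF Ub[of "Suc n"]], of u]
      by (simp add: Z_T_excess_set PT_def Bex_def)
    then have "\<exists>D. \<forall>n. D n \<in> events \<and> prob (D n) \<le> real CARD('d) * (2 * 4 ^ 8) * q ^ (n + 1) * PT u (U (Suc n)) \<and>
      (AE \<omega> in M. excess u \<omega> \<in> U (Suc n) \<longrightarrow> \<omega> \<notin> D n \<longrightarrow> (\<forall>h\<in>{0..de}. bridge_bounded u ep n h \<omega>))"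
      by (intro choice allI)
    then obtain S where Sev: "\<And>n. S n \<in> events"
      and S: "\<And>n. prob (S n) \<le> real CARD('d) * (2 * 4 ^ 8) * q ^ (n + 1) * PT u (U (Suc n))"
      and Sae: "\<And>n. AE \<omega> in M. excess u \<omega> \<in> U (Suc n) \<longrightarrow> \<omega> \<notin> S n \<longrightarrow> (\<forall>h\<in>{0..de}. bridge_bounded u ep n h \<omega>)"
      by (auto simp only:)
    have pS: "prob (S n) \<le> c2 * g * PT u (corner u) * (1 / 2) ^ n" for n
    proof -
      have "prob (S n) \<le> real CARD('d) * (2 * 4 ^ 8) * q ^ (n + 1) * PT u (U (Suc n))" by (rule S)
      also have "\<dots> \<le> real CARD('d) * (2 * 4 ^ 8) * q ^ (n + 1) * (Kb * exp (K * ep * (1 + real (Suc n)) * Lm) * PT u (corner u))"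
        using elim(2)[rule_format, of "K * ep * (1 + real (Suc n))" de ep] K ep q unfolding U_def
        by (intro mult_left_mono) auto
      also have "exp (K * ep * (1 + real (Suc n)) * Lm) = x * x ^ (n + 1)"
        unfolding x_def by (simp only: exp_of_nat_mult[symmetric] exp_add[symmetric]) (simp add: algebra_simps)
      also have "real CARD('d) * (2 * 4 ^ 8) * q ^ (n + 1) * (Kb * (x * x ^ (n + 1)) * PT u (corner u)) = c2 * (q * x) ^ (n + 1) * PT u (corner u)"
        unfolding c2_def power_mult_distrib by (simp only: mult_ac)
      also have "\<dots> = c2 * g * PT u (corner u) * g ^ n" by (simp add: q(3))
      also have "\<dots> \<le> c2 * g * PT u (corner u) * (1 / 2) ^ n"
        using g c2 by (intro mult_left_mono power_mono) (auto simp: PT_def)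
      finally show ?thesis .
    qed
    have "prob (\<Union>n. S n) \<le> 2 * c2 * g * PT u (corner u)"
      using prob_UN_geometric[OF Sev pS] by (simp add: mult.assoc)
    also have "\<dots> \<le> th * PT u (corner u)" using g(3) by (intro mult_right_mono) (auto simp: PT_def)
    finally have pSU: "prob (\<Union>n. S n) \<le> th * PT u (corner u)" .
    define F where "F = {\<omega> \<in> space M. excess u \<omega> \<in> U 0} \<union> (\<Union>n. S n)"
    have E0: "{\<omega> \<in> space M. excess u \<omega> \<in> U 0} \<in> events"
      using measurable_sets[OF excess_measurable[of u] Ub[of 0]] by (simp add: vimage_def Int_def conj_commute)
    have Fev: "F \<in> events" unfolding F_def using E0 Sev by auto
    have "prob F \<le> prob {\<omega> \<in> space M. excess u \<omega> \<in> U 0} + prob (\<Union>n. S n)"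
      unfolding F_def by (rule measure_Un_le) (use E0 Sev in auto)
    also have "prob {\<omega> \<in> space M. excess u \<omega> \<in> U 0} = PT u (sweep_event u wm (- (K * ep)) de ep)"
      by (simp add: PT_def U_def)
    finally have pF: "prob F \<le> PT u (sweep_event u wm (- (K * ep)) de ep) + th * PT u (corner u)" using pSU by linarith
    have "AE \<omega> in M. \<forall>n. excess u \<omega> \<in> U (Suc n) \<longrightarrow> \<omega> \<notin> S n \<longrightarrow> (\<forall>h\<in>{0..de}. bridge_bounded u ep n h \<omega>)"
      unfolding AE_all_countable using Sae by blast
    then have "AE \<omega> in M. norm (excess u \<omega>) \<le> ep * u \<longrightarrow> (\<exists>h\<in>{0..de}. exceeds u (T - h) \<omega>) \<longrightarrow> \<omega> \<in> F"
      using AE_space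
    proof (eventually_elim, intro impI)
      fix \<omega> assume ae: "\<forall>n. excess u \<omega> \<in> U (Suc n) \<longrightarrow> \<omega> \<notin> S n \<longrightarrow> (\<forall>h\<in>{0..de}. bridge_bounded u ep n h \<omega>)"
        and sp: "\<omega> \<in> space M" and loc: "norm (excess u \<omega>) \<le> ep * u" and "\<exists>h\<in>{0..de}. exceeds u (T - h) \<omega>"
      then obtain h where h: "0 \<le> h" "h \<le> de" and exc: "exceeds u (T - h) \<omega>" by auto
      have inU: "excess u \<omega> \<in> U n" if "bridge_bounded u ep n h \<omega>" for n
      proof -
        \<comment> \<open>Of the error K ep (1 + u^2 h + n), the part proportional to u^2 h turns w
          / 2 into \<open>wm\<close>, the rest becomes the negative margin.\<close>
        have "u * excess u \<omega> $ i > u\<^sup>2 * (a - atil) $ i + (u\<^sup>2 * h) * wm $ i + - (K * ep * (1 + real n))" for i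
        proof -
          have "\<bar>u * ((A *v Z (T - h) \<omega> - (T - h) *\<^sub>R c) $ i - u * a $ i) - (u * excess u \<omega> $ i - u\<^sup>2 * (a - atil) $ i - u\<^sup>2 * h * w $ i / 2)\<bar>
             \<le> K * ep * (1 + u\<^sup>2 * h + real n)"
            by (rule exceeds_expansion[OF elim(1) h(1) rho_small_scale_0[OF h(1) _ d0(3)] loc])
               (use that h de in auto)
          moreover have "u * ((A *v Z (T - h) \<omega> - (T - h) *\<^sub>R c) $ i - u * a $ i) > 0"
            using exc u unfolding exceeds_def by simp
          ultimately have "u * excess u \<omega> $ i - u\<^sup>2 * (a - atil) $ i - u\<^sup>2 * h * w $ i / 2 + K * ep * (1 + u\<^sup>2 * h + real n) > 0" by linarith
          then show ?thesis by (simp add: wm_def algebra_simps)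
        qed
        then show ?thesis unfolding U_def sweep_event_def using loc h u
          by (auto intro!: bexI[of _ "u\<^sup>2 * h"] simp: mult.commute mult_left_mono)
      qed
      have "\<exists>n. bridge_bounded u ep n h \<omega>"
      proof -
        define b where "b = (\<Sum>i\<in>UNIV. u * \<bar>bridge i (T - h) \<omega>\<bar>)"
        obtain n where "b / ep < real n" using reals_Archimedean2 by blast
        then have "b < real n * ep" using ep by (simp add: field_simps)
        moreover have "u * \<bar>bridge i (T - h) \<omega>\<bar> \<le> b" for i unfolding b_def
          using u by (intro member_le_sum) auto
        moreover have "0 \<le> ep * (1 + u\<^sup>2 * h)" using ep h by simp
        ultimately have "bridge_bounded u ep n h \<omega>" unfolding bridge_bounded_def by (metis add_increasing less_le_not_le order_trans)
        then show ?thesis ..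
      qed
      then have L: "bridge_bounded u ep (LEAST n. bridge_bounded u ep n h \<omega>) h \<omega>" by (rule LeastI_ex)
      show "\<omega> \<in> F"
      \<comment> \<open>If the least level is k + 1, then level k fails while level k + 1 places
        X(T) in \<open>U (Suc k)\<close>; precisely this is collected in \<open>S k\<close>.\<close>
      proof (cases "LEAST n. bridge_bounded u ep n h \<omega>")
        case 0
        then show ?thesis using inU[of 0] L sp by (simp add: F_def)
      next
        case (Suc k)
        then have "\<not> bridge_bounded u ep k h \<omega>" using not_less_Least[of k "\<lambda>n. bridge_bounded u ep n h \<omega>"] by simp
        moreover have "excess u \<omega> \<in> U (Suc k)" using inU L Suc by simp
        ultimately have "\<omega> \<in> S k" using ae h by force
        then show ?thesis unfolding F_def by blast
      qed
    qed
    then show ?case using Fev pF by blast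
  qed
  then show ?thesis using d0 by blast
qed

text \<open>Level 0 alone matters here: if X(T) lies in a sweep with steeper drift and positive
  margin, the error cannot prevent exceedance at T - s / u^2 unless the bridge is large, which by
  independence has conditional probability at most th.\<close>

lemma near_lower:
  fixes K ep th :: real
  assumes K: "K > 0" and ll: "eventually (locally_linear K ep) at_top" and ep: "0 < ep" and th: "th > 0"
  defines "wp \<equiv> (\<chi> i. w $ i / 2 + K * ep) :: real^'d"
  shows "\<exists>d0>0. d0 \<le> T \<and> (\<forall>de. 0 < de \<and> de \<le> d0 \<longrightarrow> eventually (\<lambda>u. \<exists>D\<in>events.
     prob D \<le> th * PT u (sweep_event u wp (K * ep) de ep) \<and>
     (AE \<omega> in M. excess u \<omega> \<in> sweep_event u wp (K * ep) de ep \<longrightarrow> \<omega> \<notin> D \<longrightarrow> (\<exists>h\<in>{0..de}. exceeds u (T - h) \<omega>))) at_top)"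
proof -
  define c2 where "c2 = real CARD('d) * (2 * 4 ^ 8)"
  have c2: "c2 > 0" unfolding c2_def by simp
  define q where "q = min (1 / 2) (th / c2)"
  have q: "0 < q" "q \<le> 1 / 2" "c2 * q \<le> th"
  proof -
    show "0 < q" unfolding q_def using th c2 by simp
    show "q \<le> 1 / 2" unfolding q_def by (rule min.cobounded1)
    have "c2 * q \<le> c2 * (th / c2)" unfolding q_def using c2 by (intro mult_left_mono) auto
    then show "c2 * q \<le> th" using c2 by simp
  qed
  obtain eta where eta: "eta > 0" "exp (- (ep\<^sup>2 / (128 * eta))) \<le> q"
    using q_to_eta[OF ep q(1,2)] by blast
  obtain d0 where d0: "d0 > 0" "d0 \<le> T" "\<forall>h i. 0 < h \<and> h \<le> d0 \<longrightarrow> v i h \<le> eta * h \<and> \<bar>1 - rho i (T - h) - h * (dv i T / v i T) / 2\<bar> \<le> ep * h"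
    using small_scale[OF ep eta(1)] by blast
  have "eventually (\<lambda>u. \<exists>D\<in>events.
     prob D \<le> th * PT u (sweep_event u wp (K * ep) de ep) \<and>
     (AE \<omega> in M. excess u \<omega> \<in> sweep_event u wp (K * ep) de ep \<longrightarrow> \<omega> \<notin> D \<longrightarrow> (\<exists>h\<in>{0..de}. exceeds u (T - h) \<omega>))) at_top"
    if de: "0 < de" "de \<le> d0" for de
    using ll eventually_gt_at_top[of 0]
  proof eventually_elim
    case (elim u)
    note u = elim(2)
    define U where "U = sweep_event u wp (K * ep) de ep"
    have Ub: "U \<in> sets borel" unfolding U_def by (rule sweep_event_borel)
    have deT: "de \<le> T" using de d0 by simp
    have etad: "v i h \<le> eta * h" if "0 < h" "h \<le> de" for i h using d0(3) de that by auto
    have "\<exists>F. F \<in> events \<and> prob F \<le> real CARD('d) * (2 * 4 ^ 8) * q * PT u U \<and>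
      (AE \<omega> in M. excess u \<omega> \<in> U \<longrightarrow> \<omega> \<notin> F \<longrightarrow> (\<forall>h\<in>{0..de}. bridge_bounded u ep 0 h \<omega>))"
      using bridge_sup_vector[where n = 0, OF de(1) deT eta(1) etad ep eta(2) q(2) u excess_set_borel[OF Ub], of u]
      by (simp add: Z_T_excess_set PT_def Bex_def)
    then obtain F where Fev: "F \<in> events" and F: "prob F \<le> real CARD('d) * (2 * 4 ^ 8) * q * PT u U"
      and Fae: "AE \<omega> in M. excess u \<omega> \<in> U \<longrightarrow> \<omega> \<notin> F \<longrightarrow> (\<forall>h\<in>{0..de}. bridge_bounded u ep 0 h \<omega>)"
      by (elim exE conjE) (rule that)
    have "prob F \<le> c2 * q * PT u U" using F by (simp add: c2_def)
    also have "\<dots> \<le> th * PT u U" using q by (intro mult_right_mono) (auto simp: PT_def)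
    finally have pF: "prob F \<le> th * PT u U" .
    have "AE \<omega> in M. excess u \<omega> \<in> U \<longrightarrow> \<omega> \<notin> F \<longrightarrow> (\<exists>h\<in>{0..de}. exceeds u (T - h) \<omega>)"
      using Fae
    proof (eventually_elim, intro impI)
      fix \<omega> assume ae: "excess u \<omega> \<in> U \<longrightarrow> \<omega> \<notin> F \<longrightarrow> (\<forall>h\<in>{0..de}. bridge_bounded u ep 0 h \<omega>)"
        and inU: "excess u \<omega> \<in> U" and nF: "\<omega> \<notin> F"
      from inU obtain s where loc: "norm (excess u \<omega>) \<le> ep * u" and s: "0 \<le> s" "s \<le> de * u\<^sup>2"
        and i: "\<And>i. u * excess u \<omega> $ i > u\<^sup>2 * (a - atil) $ i + s * wp $ i + K * ep"
        unfolding U_def sweep_event_def by auto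
      define h where "h = s / u\<^sup>2"
      have h: "0 \<le> h" "h \<le> de" "u\<^sup>2 * h = s" using s u by (auto simp: h_def field_simps)
      have "exceeds u (T - h) \<omega>" unfolding exceeds_def
      proof
        fix i
        have "\<bar>u * ((A *v Z (T - h) \<omega> - (T - h) *\<^sub>R c) $ i - u * a $ i) - (u * excess u \<omega> $ i - u\<^sup>2 * (a - atil) $ i - u\<^sup>2 * h * w $ i / 2)\<bar>
           \<le> K * ep * (1 + u\<^sup>2 * h + real (0::nat))"
          by (rule exceeds_expansion[OF elim(1) h(1) rho_small_scale_0[OF h(1) _ d0(3)] loc])
             (use ae inU nF h de in auto)
        moreover have "u * excess u \<omega> $ i - u\<^sup>2 * (a - atil) $ i - u\<^sup>2 * h * w $ i / 2 > K * ep * (1 + u\<^sup>2 * h + real (0::nat))"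
          using i[of i] unfolding h(3) by (simp add: wp_def algebra_simps)
        ultimately have "u * ((A *v Z (T - h) \<omega> - (T - h) *\<^sub>R c) $ i - u * a $ i) > 0" by linarith
        then show "(A *v Z (T - h) \<omega> - (T - h) *\<^sub>R c) $ i > u * a $ i" using u by (simp add: zero_less_mult_iff)
      qed
      then show "\<exists>h\<in>{0..de}. exceeds u (T - h) \<omega>" using h by auto
    qed
    then show ?case using Fev pF unfolding U_def by blast
  qed
  then show ?thesis using d0 by blast
qed

end

subsection \<open>Exceedance away from the most likely point\<close>

context exceedance begin

text \<open>A fraction th of the exponent is spent on the decay in r; the remaining fraction 1 - th
  keeps the density integrable.\<close>

lemma quadratic_tail:
  assumes th: "0 < th" "th < 1"
  shows "\<exists>C>0. \<forall>r. prob {\<omega> \<in> space M. qf (A *v Z T \<omega>) \<ge> r} \<le> C * exp (- (th * r / 2))"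
proof -
  define c0 where "c0 = (\<Prod>i\<in>UNIV. 1 / sqrt (2 * pi * v i T))"
  have c0: "c0 > 0" unfolding c0_def using v_T_pos by (intro prod_pos) auto
  define f where "f i x = exp (- (((1 - th) / v i T) / 2 * (x + 0)\<^sup>2))" for i and x :: real
  define J where "J = (\<integral>\<^sup>+z. ennreal (\<Prod>i\<in>UNIV. f i (z $ i)) \<partial>(lborel :: (real^'d) measure))"
  have J: "J < \<infinity>"
  proof -
    have "J = (\<Prod>i\<in>UNIV. \<integral>\<^sup>+x. ennreal (f i x) \<partial>lborel)"
      unfolding J_def by (rule nn_integral_lborel_prod_vec) (auto simp: f_def)
    moreover have "(\<integral>\<^sup>+x. ennreal (f i x) \<partial>lborel) < \<infinity>" for i
      unfolding f_def by (rule nn_integral_gauss_finite) (use th v_T_pos[of i] in auto)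
    ultimately show ?thesis by (simp add: ennreal_prod_eq_top less_top[symmetric] less_imp_neq)
  qed
  have fq: "(\<Prod>i\<in>UNIV. f i (z $ i)) = exp (- ((1 - th) * qf (A *v z) / 2))" for z
  proof -
    have "(\<Prod>i\<in>UNIV. f i (z $ i)) = exp (\<Sum>i\<in>UNIV. - (((1 - th) / v i T) / 2 * (z $ i)\<^sup>2))"
      unfolding f_def by (simp add: exp_sum)
    also have "(\<Sum>i\<in>UNIV. - (((1 - th) / v i T) / 2 * (z $ i)\<^sup>2)) = - ((1 - th) * qf (A *v z) / 2)"
      unfolding S_form A_Ai by (simp add: sum_negf sum_divide_distrib sum_distrib_left power2_eq_square)
    finally show ?thesis .
  qed
  have "prob {\<omega> \<in> space M. qf (A *v Z T \<omega>) \<ge> r} \<le> (c0 * enn2real J + 1) * exp (- (th * r / 2))" for r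
  proof -
    have qm: "(\<lambda>x. qf x) \<in> borel_measurable borel" by (rule borel_measurable_continuous_onI[OF qf_cont])
    then have qm2 [measurable]: "(\<lambda>z. qf (A *v z)) \<in> borel_measurable borel"
      using measurable_compose[OF matrix_vector_measurable[of A] qm] by simp
    have B [measurable]: "{z. qf (A *v z) \<ge> r} \<in> sets borel" by measurable
    have "emeasure M {\<omega> \<in> space M. qf (A *v Z T \<omega>) \<ge> r} = emeasure (distr M borel (Z T)) {z. qf (A *v z) \<ge> r}"
      by (subst emeasure_distr) (auto intro!: arg_cong[of _ _ "emeasure M"])
    also have "\<dots> = (\<integral>\<^sup>+z. ennreal (c0 * exp (- (qf (A *v z) / 2))) * indicator {z. qf (A *v z) \<ge> r} z \<partial>lborel)"
      unfolding Z_T_density gauss_density c0_def[symmetric] by (subst emeasure_density) auto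
    also have "\<dots> \<le> (\<integral>\<^sup>+z. ennreal (c0 * exp (- (th * r / 2))) * ennreal (\<Prod>i\<in>UNIV. f i (z $ i)) \<partial>lborel)"
    proof (rule nn_integral_mono)
      fix z
      show "ennreal (c0 * exp (- (qf (A *v z) / 2))) * indicator {z. qf (A *v z) \<ge> r} z
        \<le> ennreal (c0 * exp (- (th * r / 2))) * ennreal (\<Prod>i\<in>UNIV. f i (z $ i))"
      proof (cases "qf (A *v z) \<ge> r")
        case True
        then have "th * r \<le> th * qf (A *v z)" using th by (intro mult_left_mono) auto
        then have "- (qf (A *v z) / 2) \<le> - (th * r / 2) + - ((1 - th) * qf (A *v z) / 2)" by (simp add: field_simps)
        then have "exp (- (qf (A *v z) / 2)) \<le> exp (- (th * r / 2)) * exp (- ((1 - th) * qf (A *v z) / 2))"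
          by (simp only: exp_add[symmetric] exp_le_cancel_iff)
        then have "c0 * exp (- (qf (A *v z) / 2)) \<le> (c0 * exp (- (th * r / 2))) * exp (- ((1 - th) * qf (A *v z) / 2))"
          using c0 by (simp add: mult.assoc)
        then show ?thesis unfolding fq using c0 True by (simp add: ennreal_mult'[symmetric] ennreal_leI)
      qed simp
    qed
    also have "\<dots> = ennreal (c0 * exp (- (th * r / 2))) * J"
      unfolding J_def by (rule nn_integral_cmult) (simp add: f_def)
    also have "\<dots> = ennreal (c0 * exp (- (th * r / 2)) * enn2real J)"
      using J c0 by (simp add: ennreal_mult')
    finally have "prob {\<omega> \<in> space M. qf (A *v Z T \<omega>) \<ge> r} \<le> c0 * exp (- (th * r / 2)) * enn2real J"
      unfolding emeasure_eq_measure using c0 by (subst (asm) ennreal_le_iff) auto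
    also have "\<dots> \<le> (c0 * enn2real J + 1) * exp (- (th * r / 2))" by (simp add: algebra_simps)
    finally show ?thesis .
  qed
  moreover have "c0 * enn2real J + 1 > 0" using c0 by (intro add_nonneg_pos) auto
  ultimately show ?thesis by blast
qed

lemma lam_sum_nonneg: "0 \<le> (\<Sum>i\<in>UNIV. lam $ i)"
  by (intro sum_nonneg) (auto simp: lam_ge0)

lemma lam_inner_lower:
  assumes "\<And>i. a $ i - e \<le> y $ i"
  shows "lam \<bullet> y \<ge> m - e * (\<Sum>i\<in>UNIV. lam $ i)"
proof -
  have "lam \<bullet> y \<ge> (\<Sum>i\<in>UNIV. lam $ i * (a $ i - e))"
    unfolding inner_vec_real using assms lam_ge0 by (intro sum_mono mult_left_mono) auto
  also have "(\<Sum>i\<in>UNIV. lam $ i * (a $ i - e)) = lam \<bullet> a - e * (\<Sum>i\<in>UNIV. lam $ i)"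
    unfolding inner_vec_real by (simp add: algebra_simps sum_subtractf sum_distrib_left)
  finally show ?thesis by (simp add: lam_a)
qed

text \<open>Expansion around the minimizer: the linear term loses at most 2 e (sum of lam) for a
  violation e of the constraints, and ellipticity gives the gain from the distance.\<close>

lemma qf_gap:
  assumes "\<And>i. a $ i - e \<le> y $ i"
  shows "qf y \<ge> m - 2 * e * (\<Sum>i\<in>UNIV. lam $ i) + al * (norm (y - atil))\<^sup>2"
proof -
  have "qf y = qf (atil + (y - atil))" by simp
  also have "\<dots> = m + 2 * (lam \<bullet> y - m) + qf (y - atil)"
  proof -
    have ml: "atil \<bullet> lam = m" unfolding m_def by (rule inner_commute)
    have d: "(y - atil) \<bullet> lam = lam \<bullet> y - m" by (subst inner_diff_left, subst ml, subst inner_commute, rule refl)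
    show ?thesis unfolding qf_add m_eq[symmetric] lam_def[symmetric] d by (simp add: ml)
  qed
  finally have "qf y = m + 2 * (lam \<bullet> y - m) + qf (y - atil)" .
  moreover have "al * (norm (y - atil))\<^sup>2 \<le> qf (y - atil)"
    using al_facts(2)[of "y - atil"] by (simp add: power2_norm_eq_inner)
  moreover have "lam \<bullet> y \<ge> m - e * (\<Sum>i\<in>UNIV. lam $ i)" by (rule lam_inner_lower[OF assms])
  ultimately show ?thesis by (simp add: algebra_simps)
qed

text \<open>An exceedance at s carries over to a nearby time t up to an error e u, half of it for
  the oscillation of Z and half for the drift.\<close>

lemma exceeds_shift:
  assumes ex: "exceeds u s \<omega>" and s: "0 \<le> s" "s \<le> T"
    and KA: "\<And>y b i. (\<And>j. \<bar>y $ j\<bar> \<le> b) \<Longrightarrow> \<bar>(A *v y) $ i\<bar> \<le> KA * b"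
    and osc: "\<And>j. \<bar>Z s \<omega> $ j - Z t \<omega> $ j\<bar> \<le> b" and b: "KA * b \<le> e * u / 2" "T * norm c \<le> e * u / 2"
  shows "(A *v Z t \<omega>) $ i \<ge> u * (a $ i - e)"
proof -
  have "\<bar>(A *v (Z s \<omega> - Z t \<omega>)) $ i\<bar> \<le> KA * b" using osc by (intro KA) simp
  then have 1: "(A *v Z t \<omega>) $ i \<ge> (A *v Z s \<omega>) $ i - e * u / 2"
    using b(1) by (simp add: matrix_vector_mult_diff_distrib abs_le_iff)
  have "\<bar>s * c $ i\<bar> \<le> T * norm c"
    unfolding abs_mult using s component_le_norm_cart[of c i] by (intro mult_mono) auto
  then have "s * c $ i \<ge> - (e * u / 2)" using b(2) by linarith
  moreover have "(A *v Z s \<omega>) $ i - s * c $ i > u * a $ i" using ex by (simp add: exceeds_def)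
  ultimately show ?thesis using 1 by (simp add: algebra_simps)
qed

lemma norm_c_small:
  assumes "e > 0"
  shows "eventually (\<lambda>u. T * norm c \<le> e * u / 2) at_top"
proof -
  have "eventually (\<lambda>u. u \<ge> 2 * (T * norm c) / e) at_top" by (rule eventually_ge_at_top)
  then show ?thesis by eventually_elim (use assms in \<open>simp add: field_simps\<close>)
qed

text \<open>Either Z oscillates by a multiple of u within the short time de, or X(T) / u is almost
  feasible but far from the minimizer, where the form exceeds m by a fixed amount. Both have a rate
  larger than m.\<close>

lemma nonlocal_bound:
  assumes ep: "ep > 0"
  shows "\<exists>d1>0. \<forall>de. 0 < de \<and> de \<le> d1 \<and> de \<le> T \<longrightarrow> (\<exists>m'>m. \<exists>C>0. eventually (\<lambda>u. \<exists>D\<in>events. prob D \<le> C * exp (- (m' * u\<^sup>2 / 2)) \<and>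
    (AE \<omega> in M. (\<exists>h\<in>{0..de}. exceeds u (T - h) \<omega>) \<longrightarrow> norm (excess u \<omega>) > ep * u \<longrightarrow> \<omega> \<in> D)) at_top)"
proof -
  obtain KA where KA: "KA > 0" "\<And>y b i. (\<And>j. \<bar>y $ j\<bar> \<le> b) \<Longrightarrow> \<bar>(A *v y) $ i\<bar> \<le> KA * b"
    using matrix_vector_bound[of A] by blast
  define Lm where "Lm = (\<Sum>i\<in>UNIV. lam $ i)"
  have Lm: "Lm \<ge> 0" unfolding Lm_def by (rule lam_sum_nonneg)
  \<comment> \<open>Distance at least ep / 2 gains al ep^2 / 4 = 2 g; the violation e costs at most
    g, so a gap of g remains.\<close>
  define g where "g = al * ep\<^sup>2 / 8"
  have g: "g > 0" unfolding g_def using al_facts(1) ep by simp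
  define e where "e = g / (2 * (Lm + 1))"
  have e: "e > 0" unfolding e_def using g Lm by simp
  have eL: "2 * e * Lm \<le> g" unfolding e_def using g Lm by (simp add: field_simps)
  define m0 where "m0 = m + g"
  \<comment> \<open>Strictly between m and m0, since \<open>quadratic_tail\<close> loses a little of
    the rate.\<close>
  define m' where "m' = m + g / 2"
  have mm: "m < m'" "m' < m0" "0 < m'" using g m_pos by (auto simp: m0_def m'_def)
  define th where "th = m' / m0"
  have th: "0 < th" "th < 1" "th * m0 = m'" using mm by (auto simp: th_def)
  obtain C0 where C0: "C0 > 0" "\<And>r. prob {\<omega> \<in> space M. qf (A *v Z T \<omega>) \<ge> r} \<le> C0 * exp (- (th * r / 2))"
    using quadratic_tail[OF th(1,2)] by blast
  \<comment> \<open>Both T - h and T are compared with T - de, so the oscillation counts twice: KA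
    (2 si u) = e u / 2.\<close>
  define si where "si = e / (4 * KA)"
  have si: "si > 0" unfolding si_def using e KA by simp
  obtain da where da: "da > 0" "da \<le> T" "\<forall>h i. 0 < h \<and> h \<le> da \<longrightarrow> v i h \<le> 1 * h \<and> \<bar>1 - rho i (T - h) - h * (dv i T / v i T) / 2\<bar> \<le> 1 * h"
    using small_scale[of 1 1] by auto
  define C where "C = C0 + real CARD('d) * 4 ^ 8"
  have C: "C > 0" unfolding C_def using C0 by (intro add_pos_nonneg) auto
  \<comment> \<open>For de up to this bound the chaining exponent (si u)^2 / (32 de) is at least m'
    u^2 / 2.\<close>
  define d1 where "d1 = min da (si\<^sup>2 / (16 * m'))"
  have d1: "d1 > 0" unfolding d1_def using da si mm by simp
  have "eventually (\<lambda>u. \<exists>D\<in>events. prob D \<le> C * exp (- (m' * u\<^sup>2 / 2)) \<and>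
    (AE \<omega> in M. (\<exists>h\<in>{0..de}. exceeds u (T - h) \<omega>) \<longrightarrow> norm (excess u \<omega>) > ep * u \<longrightarrow> \<omega> \<in> D)) at_top"
    if de: "0 < de" "de \<le> d1" "de \<le> T" for de
    using eventually_gt_at_top[of 0] norm_c_small[OF e] norm_c_small[OF ep]
  proof eventually_elim
    case (elim u)
    have "m' * u\<^sup>2 / 2 \<le> (si * u)\<^sup>2 / (32 * 1 * de)"
    proof -
      have "de * (16 * m') \<le> si\<^sup>2" using de mm by (simp add: d1_def field_simps)
      then have "(de * (16 * m')) * u\<^sup>2 \<le> si\<^sup>2 * u\<^sup>2" by (intro mult_right_mono) auto
      then show ?thesis using de by (simp add: field_simps power_mult_distrib)
    qed
    then have ex: "4 ^ 8 * exp (- ((si * u)\<^sup>2 / (32 * 1 * de))) \<le> 4 ^ 8 * exp (- (m' * u\<^sup>2 / 2))" by simp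
    have "\<exists>D\<in>events. prob D \<le> 4 ^ 8 * exp (- ((si * u)\<^sup>2 / (32 * 1 * de))) \<and>
      (AE \<omega> in M. \<omega> \<notin> D \<longrightarrow> (\<forall>t\<in>{(T - de)..(T - de) + de}. \<bar>Z t \<omega> $ i - Z (T - de) \<omega> $ i\<bar> \<le> si * u))" for i
      by (rule Z_oscillation) (use de da si elim in \<open>auto simp: d1_def\<close>)
    from ex_event_all_coordinates[where P = "\<lambda>i \<omega>. \<forall>t\<in>{(T - de)..(T - de) + de}. \<bar>Z t \<omega> $ i - Z (T - de) \<omega> $ i\<bar> \<le> si * u", OF this]
    obtain D where D: "D \<in> events"
      "prob D \<le> real CARD('d) * (4 ^ 8 * exp (- ((si * u)\<^sup>2 / (32 * 1 * de))))"
      "AE \<omega> in M. \<omega> \<notin> D \<longrightarrow> (\<forall>i. \<forall>t\<in>{(T - de)..(T - de) + de}. \<bar>Z t \<omega> $ i - Z (T - de) \<omega> $ i\<bar> \<le> si * u)" by blast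
    have pD: "prob D \<le> real CARD('d) * (4 ^ 8 * exp (- (m' * u\<^sup>2 / 2)))"
      using D(2) mult_left_mono[OF ex, of "real CARD('d)"] by linarith
    define B where "B = {\<omega> \<in> space M. qf (A *v Z T \<omega>) \<ge> m0 * u\<^sup>2}"
    have "(\<lambda>x. qf x) \<in> borel_measurable borel" by (rule borel_measurable_continuous_onI[OF qf_cont])
    then have [measurable]: "(\<lambda>\<omega>. qf (A *v Z T \<omega>)) \<in> borel_measurable M"
      using measurable_compose[OF measurable_compose[OF ZT_measurable matrix_vector_measurable[of A]]] by simp
    have Bev: "B \<in> events" unfolding B_def by measurable
    have "prob B \<le> C0 * exp (- (th * (m0 * u\<^sup>2) / 2))" unfolding B_def by (rule C0(2))
    also have "th * (m0 * u\<^sup>2) = m' * u\<^sup>2" using th(3) by (simp add: mult.assoc[symmetric])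
    finally have pB: "prob B \<le> C0 * exp (- (m' * u\<^sup>2 / 2))" .
    have "prob (B \<union> D) \<le> prob B + prob D" by (rule measure_Un_le) (use Bev D(1) in auto)
    then have "prob (B \<union> D) \<le> C * exp (- (m' * u\<^sup>2 / 2))"
      using pB pD by (simp add: C_def algebra_simps)
    moreover have "B \<union> D \<in> events" using Bev D(1) by auto
    moreover have "AE \<omega> in M. (\<exists>h\<in>{0..de}. exceeds u (T - h) \<omega>) \<longrightarrow> norm (excess u \<omega>) > ep * u \<longrightarrow> \<omega> \<in> B \<union> D"
      using D(3) AE_space
    proof (eventually_elim, intro impI)
      fix \<omega> assume ae: "\<omega> \<notin> D \<longrightarrow> (\<forall>i. \<forall>t\<in>{(T - de)..(T - de) + de}. \<bar>Z t \<omega> $ i - Z (T - de) \<omega> $ i\<bar> \<le> si * u)"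
        and sp: "\<omega> \<in> space M" and ex: "\<exists>h\<in>{0..de}. exceeds u (T - h) \<omega>" and nl: "norm (excess u \<omega>) > ep * u"
      show "\<omega> \<in> B \<union> D"
      proof (rule ccontr)
        assume nB: "\<omega> \<notin> B \<union> D"
        from ex obtain h where h: "0 \<le> h" "h \<le> de" "exceeds u (T - h) \<omega>" by auto
        have osc: "\<bar>Z (T - h) \<omega> $ j - Z T \<omega> $ j\<bar> \<le> 2 * si * u" for j
        proof -
          have "\<bar>Z (T - h) \<omega> $ j - Z (T - de) \<omega> $ j\<bar> \<le> si * u" "\<bar>Z T \<omega> $ j - Z (T - de) \<omega> $ j\<bar> \<le> si * u"
            using ae nB h by auto
          then show ?thesis by linarith
        qed
        define y where "y = (1 / u) *\<^sub>R (A *v Z T \<omega>)"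
        have uy: "A *v Z T \<omega> = u *\<^sub>R y" using elim(1) by (simp add: y_def)
        have yi: "a $ i - e \<le> y $ i" for i
        proof -
          have "(A *v Z T \<omega>) $ i \<ge> u * (a $ i - e)"
            by (rule exceeds_shift[OF h(3) _ _ KA(2) osc]) (use h de elim KA in \<open>auto simp: si_def field_simps\<close>)
          then show ?thesis unfolding uy using elim(1) by simp
        qed
        have "excess u \<omega> = u *\<^sub>R (y - atil) - T *\<^sub>R c" unfolding excess_def uy by (simp add: algebra_simps)
        then have "norm (excess u \<omega>) \<le> u * norm (y - atil) + T * norm c"
          using norm_triangle_ineq4[of "u *\<^sub>R (y - atil)" "T *\<^sub>R c"] elim(1) T_pos by simp
        then have "ep * u / 2 < u * norm (y - atil)" using nl elim(3) by linarith
        then have "ep / 2 < norm (y - atil)" using elim(1) by (simp add: field_simps)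
        then have "(ep / 2)\<^sup>2 \<le> (norm (y - atil))\<^sup>2" using ep by (intro power_mono) auto
        then have "al * (ep / 2)\<^sup>2 \<le> al * (norm (y - atil))\<^sup>2" using al_facts(1) by (intro mult_left_mono) auto
        then have "2 * g \<le> al * (norm (y - atil))\<^sup>2" by (simp add: g_def power_divide)
        then have "m0 \<le> qf y" using qf_gap[OF yi] eL unfolding Lm_def[symmetric] m0_def by linarith
        then have "u\<^sup>2 * m0 \<le> u\<^sup>2 * qf y" by (intro mult_left_mono) auto
        then have "m0 * u\<^sup>2 \<le> qf (A *v Z T \<omega>)" unfolding uy qf_scale by (simp only: mult.commute)
        then show False using nB sp by (auto simp: B_def)
      qed
    qed
    ultimately show ?case by blast
  qed
  then show ?thesis using d1 mm(1) C by blast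
qed

text \<open>Near 0 this is (BII); for h bounded away from 0 it follows from v(h) \<le> v(T).\<close>

lemma v_linear_bound: "\<exists>eta>0. \<forall>i h. 0 < h \<and> h \<le> T \<longrightarrow> v i h \<le> eta * h"
proof -
  obtain da where da: "da > 0" "\<And>h i. 0 < h \<Longrightarrow> h \<le> da \<Longrightarrow> v i h \<le> 1 * h"
    using small_scale[of 1 1] by auto
  define V where "V = (\<Sum>i\<in>UNIV. v i T)"
  have vV: "v i T \<le> V" for i unfolding V_def using v_T_pos by (intro member_le_sum) (auto intro: less_imp_le)
  have V: "V \<ge> 0" unfolding V_def using v_T_pos by (intro sum_nonneg) (auto intro: less_imp_le)
  have "v i h \<le> (1 + V / da) * h" if h: "0 < h" "h \<le> T" for i h
  proof (cases "h \<le> da")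
    case True
    then show ?thesis using da(2)[OF h(1) True, of i] V h da(1) by (simp add: distrib_right add_increasing2)
  next
    case False
    have "v i h \<le> v i T" using strict_mono_on_leD[OF v_mono[of i]] h T_pos by auto
    also have "\<dots> \<le> V" by (rule vV)
    also have "\<dots> \<le> V / da * h" using False da(1) V by (simp add: field_simps mult_left_mono)
    also have "\<dots> \<le> (1 + V / da) * h" using h by (simp add: distrib_right)
    finally show ?thesis .
  qed
  moreover have "1 + V / da > 0" using V da by (intro add_pos_nonneg) auto
  ultimately show ?thesis by blast
qed

text \<open>Projecting on \<open>lam\<close> suffices here because the variance of \<open>lam \<bullet> A Z(t)\<close> is strictly increasing in \<open>t\<close>
  and equals \<open>m\<close> at \<open>T\<close>.\<close>

lemma far_bound:
  assumes de: "0 < de" "de \<le> T"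
  shows "\<exists>m'>m. \<exists>C>0. eventually (\<lambda>u. \<exists>D\<in>events. prob D \<le> C * exp (- (m' * u\<^sup>2 / 2)) \<and>
    (AE \<omega> in M. (\<exists>t\<in>{0..T - de}. exceeds u t \<omega>) \<longrightarrow> \<omega> \<in> D)) at_top"
proof -
  obtain KA where KA: "KA > 0" "\<And>y b i. (\<And>j. \<bar>y $ j\<bar> \<le> b) \<Longrightarrow> \<bar>(A *v y) $ i\<bar> \<le> KA * b"
    using matrix_vector_bound[of A] by blast
  obtain eta where eta: "eta > 0" "\<And>i h. 0 < h \<Longrightarrow> h \<le> T \<Longrightarrow> v i h \<le> eta * h"
    using v_linear_bound by blast
  define Lm where "Lm = (\<Sum>i\<in>UNIV. lam $ i)"
  have Lm: "Lm \<ge> 0" unfolding Lm_def by (rule lam_sum_nonneg)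
  \<comment> \<open>The coefficients of the projection of A Z(t) on \<open>lam\<close>, in the
    independent coordinates of Z.\<close>
  define k where "k i = zt $ i / v i T" for i
  have lamA: "lam \<bullet> (A *v z) = (\<Sum>i\<in>UNIV. k i * z $ i)" for z
  proof -
    have "lam \<bullet> (A *v z) = (A *v z) \<bullet> (S *v atil)" by (simp add: lam_def inner_commute)
    also have "\<dots> = (\<Sum>i\<in>UNIV. k i * z $ i)" unfolding S_form A_Ai zt_def[symmetric] by (simp add: k_def mult.commute)
    finally show ?thesis .
  qed
  define sd where "sd = (\<Sum>i\<in>UNIV. (k i)\<^sup>2 * v i (T - de))"
  have sd0: "sd \<ge> 0" unfolding sd_def using de by (intro sum_nonneg mult_nonneg_nonneg v_nonneg) auto
  have mk: "m = (\<Sum>i\<in>UNIV. (k i)\<^sup>2 * v i T)"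
    unfolding m_eq S_form zt_def[symmetric] k_def
    by (intro sum.cong) (auto simp: power2_eq_square v_T_pos[THEN less_imp_neq, symmetric])
  have sdm: "sd < m"
  proof -
    obtain i where i: "k i \<noteq> 0"
    proof (rule ccontr)
      assume "\<not> thesis"
      then have "k i = 0" for i using that by blast
      then show False using mk m_pos by simp
    qed
    have lt: "v i (T - de) < v i T" for i using strict_mono_onD[OF v_mono[of i]] de T_pos by auto
    show ?thesis unfolding sd_def mk
    proof (rule sum_strict_mono_ex1)
      show "\<forall>i\<in>UNIV. (k i)\<^sup>2 * v i (T - de) \<le> (k i)\<^sup>2 * v i T"
        by (intro ballI mult_left_mono less_imp_le[OF lt]) auto
      show "\<exists>i\<in>UNIV. (k i)\<^sup>2 * v i (T - de) < (k i)\<^sup>2 * v i T"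
        using i lt[of i] by (intro bexI[of _ i]) auto
    qed simp
  qed
  \<comment> \<open>There is room for two losses: the variance is rounded up to s' < m, and a
    fraction ka of the level m is given away to oscillations. Since sqrt (s' / m) < 1 - ka, the rate
    (m (1 - ka))^2 / s' still exceeds m.\<close>
  define s' where "s' = (sd + m) / 2"
  have s': "0 < s'" "s' < m" "sd \<le> s'" using sd0 sdm m_pos by (auto simp: s'_def)
  define r where "r = sqrt (s' / m)"
  have r: "0 < r" "r < 1" "r\<^sup>2 = s' / m" using s' m_pos by (auto simp: r_def)
  define ka where "ka = (1 - r) / 2"
  have ka: "0 < ka" "r < 1 - ka" using r by (auto simp: ka_def field_simps)
  define e where "e = m * ka / (Lm + 1)"
  have e: "e > 0" unfolding e_def using m_pos ka Lm by simp
  have eL: "e * Lm \<le> m * ka" unfolding e_def using m_pos ka Lm by (simp add: field_simps)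
  define m' where "m' = (m * (1 - ka))\<^sup>2 / s'"
  have mm: "m < m'"
  proof -
    have "s' / m < (1 - ka)\<^sup>2" unfolding r(3)[symmetric] using ka r by (intro power_strict_mono) auto
    then have "s' < m * (1 - ka)\<^sup>2" using m_pos by (simp add: field_simps)
    then have "m * s' < m * (m * (1 - ka)\<^sup>2)" using m_pos by simp
    then show ?thesis unfolding m'_def using s' by (simp add: field_simps power2_eq_square)
  qed
  then have m'0: "m' > 0" using m_pos by simp
  define si where "si = e / (2 * KA)"
  have si: "si > 0" unfolding si_def using e KA by simp
  \<comment> \<open>The mesh T / N is fine enough for oscillations of size si u to have a rate of at
    least m'.\<close>
  obtain N :: nat where N: "real N > 16 * m' * eta * T / si\<^sup>2" using reals_Archimedean2 by blast
  have "16 * m' * eta * T / si\<^sup>2 > 0" using m'0 eta T_pos si by simp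
  then have N0: "real N > 0" using N by linarith
  define L where "L = T / real N"
  have L: "L > 0" "L \<le> T" "real N * L = T" using N0 T_pos by (auto simp: L_def field_simps)
  have siL: "m' / 2 \<le> si\<^sup>2 / (32 * eta * L)"
  proof -
    have "16 * m' * eta * T < real N * si\<^sup>2" using N si by (simp add: field_simps)
    then have "16 * m' * eta * L \<le> si\<^sup>2" using N0 unfolding L_def by (simp add: field_simps)
    then show ?thesis using eta L by (simp add: field_simps)
  qed
  define C where "C = real N * (1 + real CARD('d) * 4 ^ 8)"
  have C: "C > 0" unfolding C_def using N0 by (intro mult_pos_pos add_pos_nonneg) auto
  have "eventually (\<lambda>u. \<exists>D\<in>events. prob D \<le> C * exp (- (m' * u\<^sup>2 / 2)) \<and>
    (AE \<omega> in M. (\<exists>t\<in>{0..T - de}. exceeds u t \<omega>) \<longrightarrow> \<omega> \<in> D)) at_top"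
    using eventually_gt_at_top[of 0] norm_c_small[OF e]
  proof eventually_elim
    case (elim u)
    define s0 where "s0 n = real n * L" for n :: nat
    have s00: "s0 n \<ge> 0" for n using L by (simp add: s0_def)
    have "m' * u\<^sup>2 / 2 \<le> (si * u)\<^sup>2 / (32 * eta * L)"
      using mult_right_mono[OF siL, of "u\<^sup>2"] by (simp add: power_mult_distrib)
    then have ex: "4 ^ 8 * exp (- ((si * u)\<^sup>2 / (32 * eta * L))) \<le> 4 ^ 8 * exp (- (m' * u\<^sup>2 / 2))" by simp
    have "\<exists>D\<in>events. prob D \<le> 4 ^ 8 * exp (- ((si * u)\<^sup>2 / (32 * eta * L))) \<and>
      (AE \<omega> in M. \<omega> \<notin> D \<longrightarrow> (\<forall>t\<in>{s0 n..s0 n + L}. \<bar>Z t \<omega> $ i - Z (s0 n) \<omega> $ i\<bar> \<le> si * u))" for n i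
      by (rule Z_oscillation) (use s00 L eta si elim in auto)
    from ex_event_all_coordinates[where P = "\<lambda>i \<omega>. \<forall>t\<in>{s0 n..s0 n + L}. \<bar>Z t \<omega> $ i - Z (s0 n) \<omega> $ i\<bar> \<le> si * u" for n, OF this]
    have "\<exists>D. \<forall>n. D n \<in> events \<and>
        prob (D n) \<le> real CARD('d) * (4 ^ 8 * exp (- ((si * u)\<^sup>2 / (32 * eta * L)))) \<and>
        (AE \<omega> in M. \<omega> \<notin> D n \<longrightarrow> (\<forall>i. \<forall>t\<in>{s0 n..s0 n + L}. \<bar>Z t \<omega> $ i - Z (s0 n) \<omega> $ i\<bar> \<le> si * u))"
      by (intro choice) blast
    then obtain D where D: "\<And>n. D n \<in> events"
      "\<And>n. prob (D n) \<le> real CARD('d) * (4 ^ 8 * exp (- ((si * u)\<^sup>2 / (32 * eta * L))))"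
      "\<And>n. AE \<omega> in M. \<omega> \<notin> D n \<longrightarrow> (\<forall>i. \<forall>t\<in>{s0 n..s0 n + L}. \<bar>Z t \<omega> $ i - Z (s0 n) \<omega> $ i\<bar> \<le> si * u)" by blast
    have pD: "prob (D n) \<le> real CARD('d) * (4 ^ 8 * exp (- (m' * u\<^sup>2 / 2)))" for n
      using D(2)[of n] mult_left_mono[OF ex, of "real CARD('d)"] by linarith
    define x where "x = u * (m * (1 - ka))"
    have x: "x > 0" unfolding x_def using elim m_pos ka r by simp
    \<comment> \<open>The variance bound \<open>sd\<close> covers only times up to T - de. No grid
      point is lost: each t is compared with one to its left.\<close>
    define B where "B n = (if s0 n \<le> T - de then {\<omega> \<in> space M. (\<Sum>i\<in>UNIV. k i * Z (s0 n) \<omega> $ i) \<ge> x} else {})" for n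
    have Bev: "B n \<in> events" for n
    proof -
      have [measurable]: "(\<lambda>\<omega>. Z (s0 n) \<omega> $ i) \<in> borel_measurable M" for i using s00 by (rule Z_measurable)
      show ?thesis unfolding B_def by auto
    qed
    have pB: "prob (B n) \<le> exp (- (m' * u\<^sup>2 / 2))" for n
    proof (cases "s0 n \<le> T - de")
      case True
      have "(\<Sum>i\<in>UNIV. (k i)\<^sup>2 * v i (s0 n)) \<le> sd" unfolding sd_def
        using True s00[of n] de by (intro sum_mono mult_left_mono strict_mono_on_leD[OF v_mono]) auto
      then have "prob (B n) \<le> exp (- (x\<^sup>2 / (2 * s')))"
        unfolding B_def using True s' x by (simp, intro comb_tail[OF s00]) auto
      also have "x\<^sup>2 / (2 * s') = m' * u\<^sup>2 / 2" unfolding x_def m'_def by (simp add: power_mult_distrib mult_ac)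
      finally show ?thesis .
    qed (simp add: B_def)
    define F where "F = (\<Union>n<N. B n \<union> D n)"
    have Fn: "B n \<union> D n \<in> events" for n using Bev D(1) by auto
    have Fev: "F \<in> events" unfolding F_def using Fn by auto
    have pn: "prob (B n \<union> D n) \<le> (1 + real CARD('d) * 4 ^ 8) * exp (- (m' * u\<^sup>2 / 2))" for n
    proof -
      have "prob (B n \<union> D n) \<le> prob (B n) + prob (D n)" by (rule measure_Un_le) (use Bev D(1) in auto)
      then show ?thesis using pB[of n] pD[of n] by (simp add: algebra_simps)
    qed
    have "prob F \<le> (\<Sum>n<N. prob (B n \<union> D n))" unfolding F_def
      by (intro finite_measure_subadditive_finite) (use Fn in auto)
    also have "\<dots> \<le> (\<Sum>n<N. (1 + real CARD('d) * 4 ^ 8) * exp (- (m' * u\<^sup>2 / 2)))" by (intro sum_mono pn)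
    finally have pF: "prob F \<le> C * exp (- (m' * u\<^sup>2 / 2))" by (simp add: C_def)
    have "AE \<omega> in M. \<forall>n. \<omega> \<notin> D n \<longrightarrow> (\<forall>i. \<forall>t\<in>{s0 n..s0 n + L}. \<bar>Z t \<omega> $ i - Z (s0 n) \<omega> $ i\<bar> \<le> si * u)"
      unfolding AE_all_countable using D(3) by blast
    then have "AE \<omega> in M. (\<exists>t\<in>{0..T - de}. exceeds u t \<omega>) \<longrightarrow> \<omega> \<in> F"
      using AE_space
    proof (eventually_elim, intro impI)
      fix \<omega> assume ae: "\<forall>n. \<omega> \<notin> D n \<longrightarrow> (\<forall>i. \<forall>t\<in>{s0 n..s0 n + L}. \<bar>Z t \<omega> $ i - Z (s0 n) \<omega> $ i\<bar> \<le> si * u)"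
        and sp: "\<omega> \<in> space M" and ex: "\<exists>t\<in>{0..T - de}. exceeds u t \<omega>"
      show "\<omega> \<in> F"
      proof (rule ccontr)
        assume nF: "\<omega> \<notin> F"
        from ex obtain t where t: "0 \<le> t" "t \<le> T - de" "exceeds u t \<omega>" by auto
        define n where "n = nat \<lfloor>t / L\<rfloor>"
        have tl: "0 \<le> t / L" using t L by simp
        then have n1: "real n \<le> t / L" "t / L < real n + 1" unfolding n_def by linarith+
        have n2: "s0 n \<le> t" "t \<le> s0 n + L" using n1 L by (auto simp: s0_def field_simps)
        have "real n * L \<le> t" using n2 by (simp add: s0_def)
        also have "t < real N * L" using t de L by simp
        finally have "real n < real N" using L(1) by (simp only: mult_less_cancel_right_pos)
        then have nN: "n < N" by simp
        then have nD: "\<omega> \<notin> D n" and nB: "\<omega> \<notin> B n" using nF unfolding F_def by auto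
        have osc: "\<bar>Z t \<omega> $ j - Z (s0 n) \<omega> $ j\<bar> \<le> si * u" for j using ae nD n2 by auto
        have "(A *v Z (s0 n) \<omega>) $ i \<ge> u * (a $ i - e)" for i
          by (rule exceeds_shift[OF t(3) _ _ KA(2) osc]) (use t de elim KA in \<open>auto simp: si_def field_simps\<close>)
        then have "a $ i - e \<le> ((1 / u) *\<^sub>R (A *v Z (s0 n) \<omega>)) $ i" for i using elim(1) by (simp add: field_simps)
        then have "lam \<bullet> ((1 / u) *\<^sub>R (A *v Z (s0 n) \<omega>)) \<ge> m - e * Lm" unfolding Lm_def by (rule lam_inner_lower)
        also have "m - e * Lm \<ge> m * (1 - ka)" using eL by (simp add: algebra_simps)
        finally have "m * (1 - ka) \<le> (1 / u) * (lam \<bullet> (A *v Z (s0 n) \<omega>))" by simp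
        then have "x \<le> lam \<bullet> (A *v Z (s0 n) \<omega>)" unfolding x_def using elim(1) by (simp add: field_simps)
        then have "\<omega> \<in> B n" unfolding B_def lamA using sp n2 t by simp
        with nB show False by simp
      qed
    qed
    then show ?case using Fev pF by blast
  qed
  then show ?thesis using mm C by blast
qed

section \<open>Measurability of the exceedance event\<close>

lemma exceeds_measurable:
  assumes "t \<ge> 0"
  shows "{\<omega> \<in> space M. exceeds u t \<omega>} \<in> events"
proof -
  have [measurable]: "Z t \<in> borel_measurable M" using assms by (rule Z_vec_measurable)
  have "{x. \<forall>i. (x - t *\<^sub>R c) $ i > u * a $ i} = (\<Inter>i\<in>UNIV. {x. (x - t *\<^sub>R c) $ i > u * a $ i})" by auto
  moreover have "open (\<Inter>i\<in>UNIV. {x. (x - t *\<^sub>R c) $ i > u * a $ i})"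
    by (intro ballI open_INT open_Collect_less continuous_intros) auto
  ultimately have "open {x. \<forall>i. (x - t *\<^sub>R c) $ i > u * a $ i}" by simp
  then have "{x. \<forall>i. (x - t *\<^sub>R c) $ i > u * a $ i} \<in> sets borel" by (rule borel_open)
  moreover have "(\<lambda>\<omega>. A *v Z t \<omega>) \<in> borel_measurable M" by measurable
  ultimately show ?thesis
    using measurable_sets[of "\<lambda>\<omega>. A *v Z t \<omega>" M borel "{x. \<forall>i. (x - t *\<^sub>R c) $ i > u * a $ i}"]
    by (simp add: exceeds_def vimage_def Int_def conj_commute)
qed

text \<open>By path continuity and strictness of the inequalities, rational times suffice almost surely.\<close>

definition rat_event :: "real \<Rightarrow> 'w set" where
  "rat_event u = (\<Union>t\<in>\<rat> \<inter> {0..T}. {\<omega> \<in> space M. exceeds u t \<omega>})"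

lemma rat_event_measurable: "rat_event u \<in> events"
  unfolding rat_event_def
  by (rule sets.countable_UN'') (auto intro: exceeds_measurable countable_subset[OF _ countable_rat])

lemma rat_event_AE: "AE \<omega> in M. \<omega> \<in> rat_event u \<longleftrightarrow> (\<exists>t\<in>{0..T}. exceeds u t \<omega>)"
proof -
  have "AE \<omega> in M. \<forall>i\<in>UNIV. continuous_on {0..} (\<lambda>t. Z t \<omega> $ i)"
    using cont_paths by (intro AE_finite_allI) auto
  then show ?thesis using AE_space
  proof eventually_elim
    case (elim \<omega>)
    show ?case
    proof
      assume "\<omega> \<in> rat_event u" then show "\<exists>t\<in>{0..T}. exceeds u t \<omega>" by (auto simp: rat_event_def)
    next
      assume "\<exists>t\<in>{0..T}. exceeds u t \<omega>"
      then obtain t where t: "t \<in> {0..T}" "exceeds u t \<omega>" by blast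
      have "continuous_on {0..T} (\<lambda>t. \<chi> i. Z t \<omega> $ i)"
        by (rule continuous_on_vec_lambda) (rule continuous_on_subset[OF elim(1)[rule_format]], auto)
      then have "continuous_on {0..T} (\<lambda>t. Z t \<omega>)" by simp
      then have cA: "continuous_on {0..T} (\<lambda>t. A *v Z t \<omega>)"
        by (intro continuous_on_compose2[OF matrix_vector_mult_linear_continuous_on[of UNIV A]]) auto
      have lim: "((\<lambda>s. (A *v Z s \<omega> - s *\<^sub>R c) $ i) \<longlongrightarrow> (A *v Z t \<omega> - t *\<^sub>R c) $ i) (at t within {0..T})" for i
        using cA t(1) by (intro tendsto_intros) (auto simp: continuous_on)
      have "eventually (\<lambda>s. \<forall>i\<in>UNIV. (A *v Z s \<omega> - s *\<^sub>R c) $ i > u * a $ i) (at t within {0..T})"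
        using t(2) by (intro eventually_ball_finite ballI order_tendstoD(1)[OF lim]) (auto simp: exceeds_def)
      then obtain d where d: "d > 0" "\<And>s. s \<in> {0..T} \<Longrightarrow> s \<noteq> t \<Longrightarrow> dist s t < d \<Longrightarrow> exceeds u s \<omega>"
        unfolding eventually_at exceeds_def by auto
      have ds: "exceeds u s \<omega>" if "s \<in> {0..T}" "dist s t < d" for s using d(2)[OF that(1)] that(2) t(2) by (cases "s = t") auto
      \<comment> \<open>This interval is non-empty even if t is an endpoint of [0,T].\<close>
      have "max 0 (t - d) < min T (t + d)" using t(1) d(1) T_pos by auto
      then obtain s where s: "s \<in> \<rat>" "max 0 (t - d) < s" "s < min T (t + d)" using Rats_dense_in_real by blast
      then have "exceeds u s \<omega>" by (intro ds) (auto simp: dist_real_def abs_less_iff)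
      then show "\<omega> \<in> rat_event u" using s elim(2) by (auto simp: rat_event_def)
    qed
  qed
qed

text \<open>Almost sure agreement with a measurable event places a possibly non-measurable one in
  the completion, with the same probability.\<close>

lemma completion_measure_eq:
  assumes E: "E \<in> events" and ae: "AE \<omega> in M. \<omega> \<in> E \<longleftrightarrow> P \<omega>"
  shows "measure (completion M) {\<omega> \<in> space M. P \<omega>} = prob E"
proof -
  have ae': "AE \<omega> in completion M. \<omega> \<in> E \<longleftrightarrow> P \<omega>" using ae by (rule AE_completion)
  have Es: "E \<in> sets (completion M)" using E by auto
  have "{\<omega> \<in> space M. P \<omega>} \<in> sets (completion M)"
  proof -
    obtain N where N: "N \<in> null_sets M" "{\<omega> \<in> space M. \<not> (\<omega> \<in> E \<longleftrightarrow> P \<omega>)} \<subseteq> N"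
      using ae unfolding eventually_ae_filter by auto
    have eq: "{\<omega> \<in> space M. P \<omega>} = (E - N) \<union> ({\<omega> \<in> space M. P \<omega>} \<inter> N)"
      using N(2) sets.sets_into_space[OF E] by auto
    have "{\<omega> \<in> space M. P \<omega>} \<inter> N \<in> null_sets (completion M)"
      by (rule null_sets_completion_subset[OF _ null_sets_completionI[OF N(1)]]) simp
    then have "{\<omega> \<in> space M. P \<omega>} \<inter> N \<in> sets (completion M)" by (rule null_setsD2)
    moreover have "E - N \<in> sets (completion M)" using E N(1) by auto
    ultimately show ?thesis by (subst eq) auto
  qed
  then have "measure (completion M) {\<omega> \<in> space M. P \<omega>} = measure (completion M) E"
    using Es ae' AE_space[of "completion M"]
    by (intro measure_eq_AE) (auto elim: eventually_elim2)
  then show ?thesis using E by (simp add: measure_completion)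
qed

section \<open>The two-sided bound for the ratio\<close>

lemma corner_eq_exceeds: "{\<omega> \<in> space M. excess u \<omega> \<in> corner u} = {\<omega> \<in> space M. exceeds u T \<omega>}"
  by (auto simp: excess_def corner_def exceeds_def right_diff_distrib)

text \<open>The factor 1/2 of the motion cancels in the limit by homogeneity. The tilt s is K for
  the lower and - K for the upper bound.\<close>

lemma sweep_const_tendsto:
  "((\<lambda>e. sweep_const (\<chi> i. w $ i / 2 + s * e)) \<longlongrightarrow> sweep_const w) (at_right 0)"
proof -
  have in2: "lam \<bullet> (\<chi> i. w $ i / 2 + s * e) = (\<Sum>i\<in>UNIV. lam $ i * (w $ i / 2 + s * e))" for e
    by (simp add: inner_vec_real)
  have h: "(\<Sum>i\<in>UNIV. lam $ i * (w $ i / 2 + s * 0)) = (lam \<bullet> w) / 2"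
    unfolding inner_vec_real by (simp add: sum_divide_distrib)
  have "((\<lambda>e. (\<Sum>i\<in>UNIV. max (lam $ i * (w $ i / 2 + s * e)) 0) / (\<Sum>i\<in>UNIV. lam $ i * (w $ i / 2 + s * e))) \<longlongrightarrow>
     (\<Sum>i\<in>UNIV. max (lam $ i * (w $ i / 2 + s * 0)) 0) / (\<Sum>i\<in>UNIV. lam $ i * (w $ i / 2 + s * 0))) (at_right 0)"
    by (intro tendsto_intros tendsto_max) (use h lam_w_pos in auto)
  moreover have "(\<Sum>i\<in>UNIV. max (lam $ i * (w $ i / 2 + s * 0)) 0) / (\<Sum>i\<in>UNIV. lam $ i * (w $ i / 2 + s * 0)) = sweep_const w"
  proof -
    have "max (lam $ i * (w $ i / 2 + s * 0)) 0 = max (lam $ i * w $ i) 0 / 2" for i by (auto simp: max_def)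
    then have "(\<Sum>i\<in>UNIV. max (lam $ i * (w $ i / 2 + s * 0)) 0) = (\<Sum>i\<in>UNIV. max (lam $ i * w $ i) 0) / 2"
      by (simp only: sum_divide_distrib)
    then show ?thesis unfolding h sweep_const_def by simp
  qed
  ultimately show ?thesis unfolding sweep_const_def in2 by simp
qed

lemma lam_inner_tendsto: "eventually (\<lambda>e. lam \<bullet> (\<chi> i. w $ i / 2 + s * e) > 0) (at_right 0)"
proof -
  have "((\<lambda>e. lam \<bullet> (\<chi> i. w $ i / 2 + s * e)) \<longlongrightarrow> lam \<bullet> (\<chi> i. w $ i / 2 + s * 0)) (at_right 0)"
    unfolding inner_vec_real vec_lambda_beta by (intro tendsto_intros)
  moreover have "lam \<bullet> (\<chi> i. w $ i / 2 + s * 0) = (lam \<bullet> w) / 2"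
    unfolding inner_vec_real by (simp add: sum_divide_distrib)
  ultimately have lim: "((\<lambda>e. lam \<bullet> (\<chi> i. w $ i / 2 + s * e)) \<longlongrightarrow> (lam \<bullet> w) / 2) (at_right 0)"
    by (simp only:)
  show ?thesis using lam_w_pos by (intro order_tendstoD(1)[OF lim]) simp
qed

text \<open>The constants are chosen in the order K, ep, de, u. The tolerance is shared by the limit
  constant and the large bridges, a quarter each, and by the two exponentially negligible events, an
  eighth each.\<close>

lemma upper_bound:
  assumes ta: "ta > 0"
  shows "eventually (\<lambda>u. prob (rat_event u) / PT u (corner u) \<le> sweep_const w + ta) at_top"
proof -
  obtain K where K: "K > 0" "\<And>ep. 0 < ep \<Longrightarrow> ep \<le> 1 \<Longrightarrow> eventually (locally_linear K ep) at_top"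
    using local_expansion by blast
  define Lm where "Lm = (\<Sum>i\<in>UNIV. lam $ i)"
  have "((\<lambda>e. sweep_const (\<chi> i. w $ i / 2 + (- K) * e) * exp (- (- (K * e) * Lm))) \<longlongrightarrow> sweep_const w * exp (- (- (K * 0) * Lm))) (at_right 0)"
    by (intro tendsto_intros sweep_const_tendsto)
  then have "eventually (\<lambda>e. sweep_const (\<chi> i. w $ i / 2 + (- K) * e) * exp (- (- (K * e) * Lm)) < sweep_const w + ta / 4) (at_right 0)"
    using ta by (intro order_tendstoD(2)) auto
  moreover have "eventually (\<lambda>e. e > 0 \<and> e \<le> (1::real)) (at_right 0)"
    by (rule eventually_at_rightI[of 0 1]) auto
  ultimately have "eventually (\<lambda>e. (e > 0 \<and> e \<le> (1::real)) \<and> lam \<bullet> (\<chi> i. w $ i / 2 + (- K) * e) > 0 \<and>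
      sweep_const (\<chi> i. w $ i / 2 + (- K) * e) * exp (- (- (K * e) * Lm)) < sweep_const w + ta / 4) (at_right 0)"
    using lam_inner_tendsto[of "- K"] by eventually_elim auto
  then obtain ep where ep': "0 < ep" "ep \<le> 1" "lam \<bullet> (\<chi> i. w $ i / 2 + (- K) * ep) > 0"
     "sweep_const (\<chi> i. w $ i / 2 + (- K) * ep) * exp (- (- (K * ep) * Lm)) < sweep_const w + ta / 4"
    using eventually_happens'[OF trivial_limit_at_right_real] by blast
  have "(\<chi> i. w $ i / 2 + (- K) * ep) = (\<chi> i. w $ i / 2 - K * ep)" by simp
  note ep = ep'[unfolded this]
  define wm where "wm = ((\<chi> i. w $ i / 2 - K * ep) :: real^'d)"
  obtain d0 where d0: "d0 > 0" "d0 \<le> T" "\<And>de. 0 < de \<Longrightarrow> de \<le> d0 \<Longrightarrow> eventually (\<lambda>u. \<exists>D\<in>events.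
     prob D \<le> PT u (sweep_event u wm (- (K * ep)) de ep) + ta / 4 * PT u (corner u) \<and>
     (AE \<omega> in M. norm (excess u \<omega>) \<le> ep * u \<longrightarrow> (\<exists>h\<in>{0..de}. exceeds u (T - h) \<omega>) \<longrightarrow> \<omega> \<in> D)) at_top"
    using near_upper[OF K(1) K(2)[OF ep(1,2)] ep(1) _ ep(3), of "ta / 4"] ta unfolding wm_def by auto
  obtain d1 where d1: "d1 > 0" "\<And>de. 0 < de \<Longrightarrow> de \<le> d1 \<Longrightarrow> de \<le> T \<Longrightarrow> \<exists>m'>m. \<exists>C>0. eventually (\<lambda>u. \<exists>D\<in>events. prob D \<le> C * exp (- (m' * u\<^sup>2 / 2)) \<and>
    (AE \<omega> in M. (\<exists>h\<in>{0..de}. exceeds u (T - h) \<omega>) \<longrightarrow> norm (excess u \<omega>) > ep * u \<longrightarrow> \<omega> \<in> D)) at_top"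
    using nonlocal_bound[OF ep(1)] by blast
  define de where "de = min d0 d1"
  have de: "0 < de" "de \<le> d0" "de \<le> d1" "de \<le> T" using d0 d1 by (auto simp: de_def)
  obtain m1 C1 where m1: "m1 > m" "C1 > 0" "eventually (\<lambda>u. \<exists>D\<in>events. prob D \<le> C1 * exp (- (m1 * u\<^sup>2 / 2)) \<and>
    (AE \<omega> in M. (\<exists>h\<in>{0..de}. exceeds u (T - h) \<omega>) \<longrightarrow> norm (excess u \<omega>) > ep * u \<longrightarrow> \<omega> \<in> D)) at_top"
    using d1(2)[OF de(1,3,4)] by blast
  obtain m2 C2 where m2: "m2 > m" "C2 > 0" "eventually (\<lambda>u. \<exists>D\<in>events. prob D \<le> C2 * exp (- (m2 * u\<^sup>2 / 2)) \<and>
    (AE \<omega> in M. (\<exists>t\<in>{0..T - de}. exceeds u t \<omega>) \<longrightarrow> \<omega> \<in> D)) at_top"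
    using far_bound[OF de(1,4)] by blast
  have neg: "eventually (\<lambda>u. C * (exp (- (m' * u\<^sup>2 / 2)) / PT u (corner u)) < ta / 8) at_top" if "m' > m" for C m'
  proof -
    have "((\<lambda>u. C * (exp (- (m' * u\<^sup>2 / 2)) / PT u (corner u))) \<longlongrightarrow> C * 0) at_top"
      by (intro tendsto_mult tendsto_const exp_negligible that)
    then show ?thesis using ta by (intro order_tendstoD(2)) auto
  qed
  have "((\<lambda>u. PT u (sweep_event u wm (- (K * ep)) de ep) / PT u (corner u)) \<longlongrightarrow> sweep_const wm * exp (- (- (K * ep) * Lm))) at_top"
    unfolding Lm_def using ep(3) de ep(1) by (intro PT_sweep_ratio) (auto simp: wm_def)
  then have near: "eventually (\<lambda>u. PT u (sweep_event u wm (- (K * ep)) de ep) / PT u (corner u) < sweep_const w + ta / 4) at_top"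
    using ep(4) unfolding wm_def by (rule order_tendstoD(2))
  show ?thesis
    using d0(3)[OF de(1,2)] m1(3) m2(3) neg[OF m1(1), of C1] neg[OF m2(1), of C2] near PT_corner_pos
  proof eventually_elim
    case (elim u)
    let ?P = "PT u (corner u)"
    from elim(1) obtain D0 where D0: "D0 \<in> events" "prob D0 \<le> PT u (sweep_event u wm (- (K * ep)) de ep) + ta / 4 * ?P"
      "AE \<omega> in M. norm (excess u \<omega>) \<le> ep * u \<longrightarrow> (\<exists>h\<in>{0..de}. exceeds u (T - h) \<omega>) \<longrightarrow> \<omega> \<in> D0" by blast
    from elim(2) obtain D1 where D1: "D1 \<in> events" "prob D1 \<le> C1 * exp (- (m1 * u\<^sup>2 / 2))"
      "AE \<omega> in M. (\<exists>h\<in>{0..de}. exceeds u (T - h) \<omega>) \<longrightarrow> norm (excess u \<omega>) > ep * u \<longrightarrow> \<omega> \<in> D1" by blast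
    from elim(3) obtain D2 where D2: "D2 \<in> events" "prob D2 \<le> C2 * exp (- (m2 * u\<^sup>2 / 2))"
      "AE \<omega> in M. (\<exists>t\<in>{0..T - de}. exceeds u t \<omega>) \<longrightarrow> \<omega> \<in> D2" by blast
    have "AE \<omega> in M. \<omega> \<in> rat_event u \<longrightarrow> \<omega> \<in> (D0 \<union> D1) \<union> D2"
      using rat_event_AE[of u] D0(3) D1(3) D2(3)
    proof (eventually_elim, intro impI)
      fix \<omega> assume r: "\<omega> \<in> rat_event u \<longleftrightarrow> (\<exists>t\<in>{0..T}. exceeds u t \<omega>)" "\<omega> \<in> rat_event u"
        and ae: "norm (excess u \<omega>) \<le> ep * u \<longrightarrow> (\<exists>h\<in>{0..de}. exceeds u (T - h) \<omega>) \<longrightarrow> \<omega> \<in> D0"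
          "(\<exists>h\<in>{0..de}. exceeds u (T - h) \<omega>) \<longrightarrow> norm (excess u \<omega>) > ep * u \<longrightarrow> \<omega> \<in> D1"
          "(\<exists>t\<in>{0..T - de}. exceeds u t \<omega>) \<longrightarrow> \<omega> \<in> D2"
      from r obtain t where t: "t \<in> {0..T}" "exceeds u t \<omega>" by blast
      show "\<omega> \<in> (D0 \<union> D1) \<union> D2"
      proof (cases "t \<le> T - de")
        case True
        then show ?thesis using t ae(3) by auto
      next
        case False
        then have "\<exists>h\<in>{0..de}. exceeds u (T - h) \<omega>" using t by (intro bexI[of _ "T - t"]) auto
        then show ?thesis using ae(1,2) by (cases "norm (excess u \<omega>) \<le> ep * u") auto
      qed
    qed
    then have "prob (rat_event u) \<le> prob ((D0 \<union> D1) \<union> D2)"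
      by (rule finite_measure_mono_AE) (use D0 D1 D2 in auto)
    also have "\<dots> \<le> prob (D0 \<union> D1) + prob D2" by (rule measure_Un_le) (use D0 D1 D2 in auto)
    also have "prob (D0 \<union> D1) \<le> prob D0 + prob D1" by (rule measure_Un_le) (use D0 D1 in auto)
    finally have "prob (rat_event u) \<le> PT u (sweep_event u wm (- (K * ep)) de ep) + ta / 4 * ?P + C1 * exp (- (m1 * u\<^sup>2 / 2)) + C2 * exp (- (m2 * u\<^sup>2 / 2))"
      using D0(2) D1(2) D2(2) by linarith
    then have "prob (rat_event u) / ?P \<le> (PT u (sweep_event u wm (- (K * ep)) de ep) + ta / 4 * ?P + C1 * exp (- (m1 * u\<^sup>2 / 2)) + C2 * exp (- (m2 * u\<^sup>2 / 2))) / ?P"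
      using elim(7) by (intro divide_right_mono) auto
    also have "\<dots> = PT u (sweep_event u wm (- (K * ep)) de ep) / ?P + ta / 4 + C1 * (exp (- (m1 * u\<^sup>2 / 2)) / ?P) + C2 * (exp (- (m2 * u\<^sup>2 / 2)) / ?P)"
      using elim(7) by (simp add: add_divide_distrib)
    finally show ?case using elim(4,5,6) ta by linarith
  qed
qed

lemma lower_bound:
  assumes ta: "ta > 0"
  shows "eventually (\<lambda>u. prob (rat_event u) / PT u (corner u) \<ge> sweep_const w - ta) at_top"
proof -
  obtain K where K: "K > 0" "\<And>ep. 0 < ep \<Longrightarrow> ep \<le> 1 \<Longrightarrow> eventually (locally_linear K ep) at_top"
    using local_expansion by blast
  define Lm where "Lm = (\<Sum>i\<in>UNIV. lam $ i)"
  define f where "f e = sweep_const (\<chi> i. w $ i / 2 + K * e) * exp (- (K * e * Lm))" for e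
  \<comment> \<open>The ratio x below is less than \<open>sweep_const w + ta\<close>, so the loss th
    x is at most ta / 4.\<close>
  define th where "th = ta / (4 * (sweep_const w + ta))"
  have th: "th > 0" "th * (sweep_const w + ta) = ta / 4"
    unfolding th_def using ta sweep_const_pos by (auto simp: field_simps intro!: divide_pos_pos add_pos_pos)
  have "(f \<longlongrightarrow> sweep_const w * exp (- (K * 0 * Lm))) (at_right 0)"
    unfolding f_def by (intro tendsto_intros sweep_const_tendsto)
  then have "(f \<longlongrightarrow> sweep_const w) (at_right 0)" by simp
  then have "eventually (\<lambda>e. f e < sweep_const w + ta / 4) (at_right 0)" "eventually (\<lambda>e. f e > sweep_const w - ta / 4) (at_right 0)"
    using ta by (auto intro: order_tendstoD)
  moreover have "eventually (\<lambda>e. e > 0 \<and> e \<le> (1::real)) (at_right 0)"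
    by (rule eventually_at_rightI[of 0 1]) auto
  ultimately have "eventually (\<lambda>e. (e > 0 \<and> e \<le> (1::real)) \<and> lam \<bullet> (\<chi> i. w $ i / 2 + K * e) > 0 \<and>
      f e < sweep_const w + ta / 4 \<and> f e > sweep_const w - ta / 4) (at_right 0)"
    using lam_inner_tendsto[of K] by eventually_elim auto
  then obtain ep where ep: "0 < ep" "ep \<le> 1" "lam \<bullet> (\<chi> i. w $ i / 2 + K * ep) > 0"
     "f ep < sweep_const w + ta / 4" "f ep > sweep_const w - ta / 4"
    using eventually_happens'[OF trivial_limit_at_right_real] by blast
  define wp where "wp = ((\<chi> i. w $ i / 2 + K * ep) :: real^'d)"
  obtain de where de: "de > 0" "de \<le> T" "eventually (\<lambda>u. \<exists>D\<in>events.
     prob D \<le> th * PT u (sweep_event u wp (K * ep) de ep) \<and>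
     (AE \<omega> in M. excess u \<omega> \<in> sweep_event u wp (K * ep) de ep \<longrightarrow> \<omega> \<notin> D \<longrightarrow> (\<exists>h\<in>{0..de}. exceeds u (T - h) \<omega>))) at_top"
    using near_lower[OF K(1) K(2)[OF ep(1,2)] ep(1) th(1)] unfolding wp_def by blast
  have lim: "((\<lambda>u. PT u (sweep_event u wp (K * ep) de ep) / PT u (corner u)) \<longlongrightarrow> f ep) at_top"
    unfolding f_def Lm_def wp_def[symmetric] using ep(3) de ep(1) by (intro PT_sweep_ratio) (auto simp: wp_def)
  show ?thesis
    using de(3) order_tendstoD(1)[OF lim ep(5)] order_tendstoD(2)[OF lim ep(4)] PT_corner_pos
  proof eventually_elim
    case (elim u)
    let ?P = "PT u (corner u)" and ?U = "sweep_event u wp (K * ep) de ep"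
    define x where "x = PT u ?U / ?P"
    from elim(1) obtain D where D: "D \<in> events" "prob D \<le> th * PT u ?U"
      "AE \<omega> in M. excess u \<omega> \<in> ?U \<longrightarrow> \<omega> \<notin> D \<longrightarrow> (\<exists>h\<in>{0..de}. exceeds u (T - h) \<omega>)" by blast
    have "AE \<omega> in M. \<omega> \<in> {\<omega> \<in> space M. excess u \<omega> \<in> ?U} \<longrightarrow> \<omega> \<in> rat_event u \<union> D"
      using rat_event_AE[of u] D(3)
    proof eventually_elim
      case (elim \<omega>)
      show ?case
      proof
        assume w: "\<omega> \<in> {\<omega> \<in> space M. excess u \<omega> \<in> ?U}"
        show "\<omega> \<in> rat_event u \<union> D"
        proof (cases "\<omega> \<in> D")
          case False
          then obtain h where "h \<in> {0..de}" "exceeds u (T - h) \<omega>" using elim(2) w by auto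
          then have "\<exists>t\<in>{0..T}. exceeds u t \<omega>" using de by (intro bexI[of _ "T - h"]) auto
          then show ?thesis using elim(1) by simp
        qed simp
      qed
    qed
    then have "PT u ?U \<le> prob (rat_event u \<union> D)"
      unfolding PT_def by (rule finite_measure_mono_AE) (use rat_event_measurable D in auto)
    also have "\<dots> \<le> prob (rat_event u) + prob D" by (rule measure_Un_le) (use rat_event_measurable D in auto)
    finally have "PT u ?U - th * PT u ?U \<le> prob (rat_event u)" using D(2) by linarith
    then have "(PT u ?U - th * PT u ?U) / ?P \<le> prob (rat_event u) / ?P" using elim(4) by (intro divide_right_mono) auto
    moreover have "(PT u ?U - th * PT u ?U) / ?P = x - th * x" by (simp add: x_def diff_divide_distrib)
    moreover have "th * x \<le> th * (sweep_const w + ta)" using elim(3) th ta unfolding x_def[symmetric] by (intro mult_left_mono) auto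
    moreover have "x > sweep_const w - ta / 4" using elim(2) unfolding x_def .
    ultimately show ?case using th(2) ta by linarith
  qed
qed

lemma exceedance_ratio: "((\<lambda>u. prob (rat_event u) / PT u (corner u)) \<longlongrightarrow> sweep_const w) at_top"
proof (rule tendstoI)
  fix e :: real assume e: "e > 0"
  show "\<forall>\<^sub>F u in at_top. dist (prob (rat_event u) / PT u (corner u)) (sweep_const w) < e"
    using upper_bound[OF half_gt_zero[OF e]] lower_bound[OF half_gt_zero[OF e]]
  proof eventually_elim
    case (elim u)
    then show ?case using e by (simp add: dist_real_def abs_less_iff)
  qed
qed

end

theorem theorem3p3:
  fixes M :: "'w measure"
    and Z X :: "real \<Rightarrow> 'w \<Rightarrow> real ^ 'd"
    and v dv :: "'d \<Rightarrow> real \<Rightarrow> real"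
    and A Sigma Q :: "real ^ 'd ^ 'd"
    and a c atil lam :: "real ^ 'd"
    and T C :: real
  assumes "prob_space M"
    and "T > 0"
    and "independent_processes M {0..} (\<lambda>i t \<omega>. Z t \<omega> $ i) UNIV"
    and "\<And>i. centered_gaussian_process M {0..} (\<lambda>t \<omega>. Z t \<omega> $ i)"
    and "\<And>i. AE \<omega> in M. continuous_on {0..} (\<lambda>t. Z t \<omega> $ i)"
    and "\<And>i. stationary_increments M (\<lambda>t \<omega>. Z t \<omega> $ i)"
    and "\<And>i t. t \<ge> 0 \<Longrightarrow> v i t = prob_space.variance M (\<lambda>\<omega>. Z t \<omega> $ i)"
    and B0_deriv: "\<And>i t. t \<in> {0..T} \<Longrightarrow> (v i has_real_derivative dv i t) (at t within {0..T})"
    and B0_cont: "\<And>i. continuous_on {0..T} (dv i)"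
    and B0_mono: "\<And>i. strict_mono_on {0..T} (v i)"
    and B0_zero: "\<And>i. v i 0 = 0"
    and BI: "\<And>i. dv i T > 0"
    and BII: "\<And>i. v i \<in> o[at_right 0](\<lambda>t. t)"
    and "invertible A"
    and "\<And>t \<omega>. X t \<omega> = A *v Z t \<omega>"
    and "a \<notin> {x. \<forall>i. x $ i \<le> 0}"
    and "Sigma = A ** diag_mat (\<chi> i. v i T) ** transpose A"
    and "Q = diag_mat (\<chi> i. dv i T / v i T)"
    and "atil = qp_solution Sigma a"
    and "lam = matrix_inv Sigma *v atil"
    and "C = (\<Sum>i\<in>UNIV. max (lam $ i * ((A ** Q ** matrix_inv A) *v atil) $ i) 0)
           / (\<Sum>i\<in>UNIV. lam $ i * ((A ** Q ** matrix_inv A) *v atil) $ i)"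
  shows "(\<exists>!x. is_qp_solution Sigma a x) \<and> C > 0 \<and>
    ((\<lambda>u. exceed_prob M X c {0..T} (u *\<^sub>R a) / (C * exceed_prob M X c {T} (u *\<^sub>R a)))
       \<longlongrightarrow> 1) at_top"
proof -
  interpret P: prob_space M by fact
  interpret E: exceedance M Z v dv T A a c
    using assms by unfold_locales (auto simp: not_le)
  have S: "Sigma = E.Sig" using assms by (simp add: E.Sig_def)
  have at: "atil = E.atil" using assms S by (simp add: E.atil_def)
  have la: "lam = E.lam" using assms S at by (simp add: E.lam_def E.S_def)
  have w: "(A ** Q ** matrix_inv A) *v atil = E.w" using assms at by (simp add: E.w_def E.Q_def E.Ai_def)
  have C: "C = E.sweep_const E.w"
    using assms(21) unfolding w la E.sweep_const_def by (simp add: inner_vec_real)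
  have Cp: "C > 0" unfolding C by (rule E.sweep_const_pos)
  have ex: "(\<forall>i. (X t \<omega> - t *\<^sub>R c) $ i > (u *\<^sub>R a) $ i) \<longleftrightarrow> E.exceeds u t \<omega>" for u t \<omega>
    using assms(15) by (simp add: E.exceeds_def)
  have n: "exceed_prob M X c {0..T} (u *\<^sub>R a) = P.prob (E.rat_event u)" for u
    unfolding exceed_prob_def ex by (rule E.completion_measure_eq[OF E.rat_event_measurable E.rat_event_AE])
  have d: "exceed_prob M X c {T} (u *\<^sub>R a) = E.PT u (E.corner u)" for u
    unfolding exceed_prob_def ex E.PT_def E.corner_eq_exceeds
    using E.completion_measure_eq[OF E.exceeds_measurable[of T u], of "\<lambda>\<omega>. E.exceeds u T \<omega>"] \<open>T > 0\<close> by (simp add: AE_I2)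
  have "((\<lambda>u. P.prob (E.rat_event u) / E.PT u (E.corner u) / C) \<longlongrightarrow> C / C) at_top"
    using Cp by (intro tendsto_divide tendsto_const) (auto simp: C E.exceedance_ratio)
  moreover have "P.prob (E.rat_event u) / E.PT u (E.corner u) / C = exceed_prob M X c {0..T} (u *\<^sub>R a) / (C * exceed_prob M X c {T} (u *\<^sub>R a))" for u
    by (simp add: n d mult.commute)
  ultimately show ?thesis using Cp E.qp_ex1 by (simp add: S)
qed

end
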